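(* Let $\mathbb{D}\subset\mathbb{R}^2$ be the unit disk. Then for all $\lambda>0$, $$\mathcal{N}^{\mathrm{Dir}}_{\mathbb{D}}(\lambda)<\frac{\lambda^2}{4}-\frac{\lfloor\omega_0\lambda\rfloor}{2},\qquad\text{where}\quad \omega_0:=\frac{\sqrt3}{2\pi}-\frac16 .$$
   Context: $\mathcal{N}^{\mathrm{Dir}}_{\mathbb{D}}(\lambda):=\#\{n\in\mathbb{N}:\lambda_n(\mathbb{D})\le\lambda^2\}$, where $\lambda_1(\mathbb{D})\le\lambda_2(\mathbb{D})\le\dots$ are the eigenvalues, enumerated with multiplicity, of the Dirichlet Laplacian $-\Delta$ on $\mathbb{D}$. *)

theory Defs
  imports "HOL-Analysis.Analysis"
begin

definition L2_on :: "'a::euclidean_space set \<Rightarrow> ('a \<Rightarrow> 'b::euclidean_space) \<Rightarrow> bool" where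
  "L2_on \<Omega> f \<longleftrightarrow> f \<in> borel_measurable (lebesgue_on \<Omega>) \<and>
     integrable (lebesgue_on \<Omega>) (\<lambda>x. (norm (f x))\<^sup>2)"

text \<open>A test function is a continuously differentiable function on the whole space whose support
  is a compact subset of \<open>\<Omega>\<close>; it is carried together with its classical gradient.\<close>

definition C1_compact_support ::
    "'a::euclidean_space set \<Rightarrow> ('a \<Rightarrow> real) \<Rightarrow> ('a \<Rightarrow> 'a) \<Rightarrow> bool" where
  "C1_compact_support \<Omega> \<phi> D\<phi> \<longleftrightarrow>
     (\<forall>x. GDERIV \<phi> x :> D\<phi> x) \<and> continuous_on UNIV D\<phi> \<and>
     (\<exists>K. compact K \<and> K \<subseteq> \<Omega> \<and> (\<forall>x. x \<notin> K \<longrightarrow> \<phi> x = 0))"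

text \<open>\<open>H10 \<Omega> u Du\<close>: the function \<open>u\<close> belongs to the Sobolev space \<open>H\<^sub>0\<^sup>1(\<Omega>)\<close> and \<open>Du\<close> is its weak
  gradient (unique up to null sets). As in Gilbarg and Trudinger, the space is the closure of the
  compactly supported \<open>C\<^sup>1\<close> functions with respect to the \<open>H\<^sup>1\<close> norm (mollification shows that
  \<open>C\<^sup>\<infinity>\<close> functions have the same closure). Only the values on \<open>\<Omega>\<close> of \<open>u\<close> and \<open>Du\<close> matter.\<close>

definition H10 :: "'a::euclidean_space set \<Rightarrow> ('a \<Rightarrow> real) \<Rightarrow> ('a \<Rightarrow> 'a) \<Rightarrow> bool" where
  "H10 \<Omega> u Du \<longleftrightarrow> L2_on \<Omega> u \<and> L2_on \<Omega> Du \<and>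
     (\<exists>\<phi> D\<phi>. (\<forall>n::nat. C1_compact_support \<Omega> (\<phi> n) (D\<phi> n)) \<and>
        (\<lambda>n. \<integral>x. (\<phi> n x - u x)\<^sup>2 \<partial>lebesgue_on \<Omega>) \<longlonglongrightarrow> 0 \<and>
        (\<lambda>n. \<integral>x. (norm (D\<phi> n x - Du x))\<^sup>2 \<partial>lebesgue_on \<Omega>) \<longlonglongrightarrow> 0)"

text \<open>\<open>dirichlet_laplacian \<Omega> u f\<close>: the function \<open>u\<close> is in the domain of the Dirichlet Laplacian
  and \<open>-\<Delta>u = f\<close>. This is (the graph of) the self-adjoint operator in \<open>L\<^sup>2(\<Omega>)\<close> associated with the
  closed quadratic form \<open>\<integral>|\<nabla>u|\<^sup>2\<close> with form domain \<open>H\<^sub>0\<^sup>1(\<Omega>)\<close>.\<close>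

definition dirichlet_laplacian ::
    "'a::euclidean_space set \<Rightarrow> ('a \<Rightarrow> real) \<Rightarrow> ('a \<Rightarrow> real) \<Rightarrow> bool" where
  "dirichlet_laplacian \<Omega> u f \<longleftrightarrow> L2_on \<Omega> f \<and>
     (\<exists>Du. H10 \<Omega> u Du \<and>
        (\<forall>v Dv. H10 \<Omega> v Dv \<longrightarrow>
           (\<integral>x. Du x \<bullet> Dv x \<partial>lebesgue_on \<Omega>) = (\<integral>x. f x * v x \<partial>lebesgue_on \<Omega>)))"

definition dirichlet_eigenspace :: "'a::euclidean_space set \<Rightarrow> real \<Rightarrow> ('a \<Rightarrow> real) set" where
  "dirichlet_eigenspace \<Omega> \<mu> = {u. dirichlet_laplacian \<Omega> u (\<lambda>x. \<mu> * u x)}"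

text \<open>The dimension of the eigenspace as a subspace of \<open>L\<^sup>2(\<Omega>)\<close>, hence linear independence is
  understood modulo equality almost everywhere. The number \<open>\<mu>\<close> is an eigenvalue if and only if
  its multiplicity is positive.\<close>

definition dirichlet_mult :: "'a::euclidean_space set \<Rightarrow> real \<Rightarrow> enat" where
  "dirichlet_mult \<Omega> \<mu> = Sup {enat k | k.
     \<exists>u :: nat \<Rightarrow> 'a \<Rightarrow> real. (\<forall>i<k. u i \<in> dirichlet_eigenspace \<Omega> \<mu>) \<and>
       (\<forall>c :: nat \<Rightarrow> real. (AE x in lebesgue_on \<Omega>. (\<Sum>i<k. c i * u i x) = 0) \<longrightarrow> (\<forall>i<k. c i = 0))}"

definition enat_card :: "'b set \<Rightarrow> enat" where
  "enat_card A = (if finite A then enat (card A) else \<infinity>)"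

text \<open>The number of eigenvalues \<open>\<mu> \<le> \<lambda>\<^sup>2\<close> counted with multiplicity: an eigenvalue \<open>\<mu>\<close> of
  multiplicity \<open>m\<close> contributes the \<open>m\<close> indices \<open>(\<mu>, 0), \<dots>, (\<mu>, m - 1)\<close>. The lemma below identifies it
  with the number of \<open>n \<ge> 1\<close> such that \<open>\<lambda>\<^sub>n \<le> \<lambda>\<^sup>2\<close>, for any enumeration \<open>\<lambda>\<^sub>1, \<lambda>\<^sub>2, \<dots>\<close> of the eigenvalues
  with multiplicity.\<close>

definition dirichlet_count :: "'a::euclidean_space set \<Rightarrow> real \<Rightarrow> enat" where
  "dirichlet_count \<Omega> l = enat_card {(\<mu>, i). \<mu> \<le> l\<^sup>2 \<and> enat i < dirichlet_mult \<Omega> \<mu>}"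

lemma dirichlet_count_enumeration:
  fixes ev :: "nat \<Rightarrow> real"
  assumes "\<And>\<mu>. enat_card {n. n \<ge> 1 \<and> ev n = \<mu>} = dirichlet_mult \<Omega> \<mu>"
  shows "dirichlet_count \<Omega> l = enat_card {n. n \<ge> 1 \<and> ev n \<le> l\<^sup>2}"
proof -
  have "\<exists>h. bij_betw h {n. n \<ge> 1 \<and> ev n = \<mu>} {i. enat i < dirichlet_mult \<Omega> \<mu>}" for \<mu>
  proof (cases "finite {n. n \<ge> 1 \<and> ev n = \<mu>}")
    case True
    then have "dirichlet_mult \<Omega> \<mu> = enat (card {n. n \<ge> 1 \<and> ev n = \<mu>})"
      using assms[of \<mu>] by (simp add: enat_card_def)
    then have "{i. enat i < dirichlet_mult \<Omega> \<mu>} = {0..<card {n. n \<ge> 1 \<and> ev n = \<mu>}}"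
      by auto
    then show ?thesis using ex_bij_betw_finite_nat[OF True] by auto
  next
    case False
    then have "dirichlet_mult \<Omega> \<mu> = \<infinity>"
      using assms[of \<mu>] by (simp add: enat_card_def)
    then have "{i. enat i < dirichlet_mult \<Omega> \<mu>} = UNIV" by auto
    then show ?thesis using to_nat_on_infinite[OF _ False] by auto
  qed
  then obtain h where h: "\<And>\<mu>. bij_betw (h \<mu>) {n. n \<ge> 1 \<and> ev n = \<mu>} {i. enat i < dirichlet_mult \<Omega> \<mu>}"
    by metis
  let ?A = "{n. n \<ge> 1 \<and> ev n \<le> l\<^sup>2}" and ?B = "{(\<mu>, i). \<mu> \<le> l\<^sup>2 \<and> enat i < dirichlet_mult \<Omega> \<mu>}"
  have "bij_betw (\<lambda>n. (ev n, h (ev n) n)) ?A ?B"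
    unfolding bij_betw_def
  proof (intro conjI equalityI subsetI)
    show "inj_on (\<lambda>n. (ev n, h (ev n) n)) ?A"
    proof (rule inj_onI)
      fix m n assume mn: "m \<in> ?A" "n \<in> ?A" "(ev m, h (ev m) m) = (ev n, h (ev n) n)"
      have "inj_on (h (ev m)) {k. k \<ge> 1 \<and> ev k = ev m}"
        using h bij_betw_imp_inj_on by blast
      with mn show "m = n" by (auto dest: inj_onD)
    qed
  next
    fix p assume "p \<in> (\<lambda>n. (ev n, h (ev n) n)) ` ?A"
    then obtain n where n: "n \<ge> 1" "ev n \<le> l\<^sup>2" "p = (ev n, h (ev n) n)" by auto
    then show "p \<in> ?B" using bij_betwE[OF h[of "ev n"]] by auto
  next
    fix p assume "p \<in> ?B"
    then obtain \<mu> i where p: "p = (\<mu>, i)" "\<mu> \<le> l\<^sup>2" "i \<in> {i. enat i < dirichlet_mult \<Omega> \<mu>}" by auto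
    then have "i \<in> h \<mu> ` {n. n \<ge> 1 \<and> ev n = \<mu>}"
      using bij_betw_imp_surj_on[OF h[of \<mu>]] by blast
    with p show "p \<in> (\<lambda>n. (ev n, h (ev n) n)) ` ?A" by auto
  qed
  then show ?thesis
    unfolding dirichlet_count_def enat_card_def
    using bij_betw_finite bij_betw_same_card by fastforce
qed

definition omega0 :: real where
  "omega0 = sqrt 3 / (2 * pi) - 1 / 6"

end

theory Submission
  imports Defs "HOL-Complex_Analysis.Complex_Analysis" "HOL-Real_Asymp.Real_Asymp"
begin

text \<open>Testing the eigenvalue equation with \<open>(1 - |x|\<^sup>2) p(x)\<close>, \<open>p\<close> a polynomial, gives a two-term recursion
  for the moments of an eigenfunction in each angular mode \<open>m\<close>. It leaves one free constant, and that
  constant can be nonzero only if \<open>J\<^sub>m(\<surd>\<mu>) = 0\<close>. Hence the counting function is at most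
  the number of pairs (mode \<open>m\<close>, zero of \<open>J\<^bsub>|m|\<^esub>\<close> in \<open>(0, \<lambda>]\<close>).

  The \<open>k\<close>-th zero \<open>x\<close> of \<open>J\<^sub>m\<close> satisfies \<open>\<phi>\<^sub>m(x) \<ge> (k - 1/4) \<pi>\<close>, where
  \<open>\<phi>\<^sub>m(x) = \<surd>(x\<^sup>2 - m\<^sup>2) - m arccos (m/x)\<close>: by Sturm comparison consecutive zeros are less than \<open>\<pi>\<close>
  apart in the variable \<open>\<phi>\<^sub>m\<close>, so a zero that comes too early makes all later zeros come early, and
  this contradicts Jensen's inequality and the bound \<open>J\<^sub>m(z) = O(|z|\<^bsup>-1/2\<^esup> e\<^bsup>|Im z|\<^esup>)\<close>.

  It remains to count the lattice points \<open>(m, k)\<close> with \<open>\<phi>\<^bsub>|m|\<^esub>(\<lambda>) \<ge> (k - 1/4) \<pi>\<close>. The curve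
  \<open>y = \<phi>\<^sub>z(\<lambda>) / \<pi>\<close> is convex with \<open>dz/dy \<le> -2\<close>, so the layer \<open>k - 1 \<le> y \<le> k\<close> has
  area at least \<open>z(k - 1/2) \<ge> z(k - 1/4) + 1/2\<close>, which is half of the bound \<open>2 z(k - 1/4) + 1\<close> for its lattice
  points; below the height \<open>\<omega>\<^sub>0 \<lambda>\<close> the slope is at most \<open>-3\<close>, and each layer gains \<open>1/2\<close>.\<close>

section \<open>Bessel functions of integer order\<close>

text \<open>An eigenfunction is given only by the weak equation, so Bessel's equation cannot be
  applied to it pointwise. Its integrals against \<open>mon a b\<close> can be computed from the
  weak form, and they determine it almost everywhere: with more eigenfunctions than modes, some
  nontrivial combination has all moments zero. The constant 1/4 is what the logarithms in Jensen's
  inequality leave over. On circles of radius R tending to infinity the linear terms cancel; after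
  Stirling's formula and the decay of order -1/2 are taken into account, ln R has the coefficient 2
  (k - 1/4 - \<phi>/\<pi>), which therefore cannot be positive. At the point z = l cos \<beta> of
  the curve the slope dz/dy is -\<pi>/\<beta>. It is at most -2 for \<beta> up to \<pi>/2, so
  raising y by 1/4 lowers z by at least 1/2. It is at most -3 for \<beta> up to \<pi>/3, and the
  height of the curve there is exactly \<open>omega0 * l\<close>. In that range the drop is 3/4; the
  surplus 1/4, doubled by the two signs of m, is the gain 1/2 per layer.\<close>

definition bessel_coeff :: "nat \<Rightarrow> nat \<Rightarrow> real" where
  "bessel_coeff m i = (- 1 / 4) ^ i * fact m / (fact i * fact (i + m))"

text \<open>J_m(z) is (z/2)^m / m! times \<open>bessel_series m (z^2)\<close>. The normalisation
  gives the value 1 at 0, which is the value that enters Jensen's inequality; with z^2 as the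
  argument an eigenvalue of either sign can be inserted directly.\<close>

definition bessel_series :: "nat \<Rightarrow> 'a::{real_normed_field, banach} \<Rightarrow> 'a" where
  "bessel_series m w = (\<Sum>i. of_real (bessel_coeff m i) * w ^ i)"

lemma summable_bessel_series:
  fixes w :: "'a::{real_normed_field, banach}"
  shows "summable (\<lambda>i. of_real (bessel_coeff m i) * w ^ i)"
proof (rule summable_comparison_test)
  show "summable (\<lambda>i. norm w ^ i /\<^sub>R fact i)"
    using summable_exp_generic[of "norm w"] by simp
  have "norm (of_real (bessel_coeff m i) * w ^ i) \<le> norm w ^ i /\<^sub>R fact i" for i
  proof -
    have "fact m \<le> (fact (i + m) :: real)" by (intro fact_mono) simp
    moreover have "(1 / 4) ^ i \<le> (1::real)" by (simp add: power_le_one)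
    ultimately have "(1 / 4) ^ i * fact m \<le> 1 * (fact (i + m) :: real)"
      by (intro mult_mono) auto
    then have "\<bar>bessel_coeff m i\<bar> \<le> 1 / fact i"
      unfolding bessel_coeff_def by (simp add: abs_mult power_abs field_simps)
    then have "\<bar>bessel_coeff m i\<bar> * norm w ^ i \<le> 1 / fact i * norm w ^ i"
      by (intro mult_right_mono) auto
    then show ?thesis by (simp add: norm_mult norm_power field_simps)
  qed
  then show "\<exists>N. \<forall>n\<ge>N. norm (of_real (bessel_coeff m n) * w ^ n) \<le> norm w ^ n /\<^sub>R fact n"
    by blast
qed

lemma bessel_series_0 [simp]: "bessel_series m 0 = 1"
proof -
  have "bessel_series m (0::'a) = (\<Sum>i\<in>{0}. of_real (bessel_coeff m i) * 0 ^ i)"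
    unfolding bessel_series_def by (rule suminf_finite) auto
  then show ?thesis by (simp add: bessel_coeff_def)
qed

lemma bessel_series_of_real:
  "bessel_series m (of_real x :: 'a::{real_normed_field, banach}) = of_real (bessel_series m x)"
proof -
  have "(\<lambda>i. of_real (bessel_coeff m i * x ^ i) :: 'a) sums of_real (bessel_series m x)"
    unfolding sums_of_real_iff bessel_series_def
    using summable_sums[OF summable_bessel_series[of m x]] by simp
  then show ?thesis
    unfolding bessel_series_def by (simp add: sums_iff)
qed

lemma bessel_coeff_Suc_index:
  "real (Suc i) * bessel_coeff m (Suc i) = - bessel_coeff (Suc m) i / (4 * (m + 1))"
  unfolding bessel_coeff_def by (simp add: divide_simps)

lemma bessel_series_deriv:
  fixes w :: "'a::{real_normed_field, banach}"
  shows "(bessel_series m has_field_derivative - bessel_series (Suc m) w / (4 * (of_nat m + 1))) (at w)"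
proof -
  have "((\<lambda>w. \<Sum>i. of_real (bessel_coeff m i) * w ^ i) has_field_derivative
      (\<Sum>i. diffs (\<lambda>i. of_real (bessel_coeff m i)) i * w ^ i)) (at w)"
    by (rule termdiffs_strong_converges_everywhere) (rule summable_bessel_series)
  moreover have "(\<Sum>i. diffs (\<lambda>i. of_real (bessel_coeff m i)) i * w ^ i)
     = - bessel_series (Suc m) w / (4 * (of_nat m + 1))"
  proof -
    have "diffs (\<lambda>i. of_real (bessel_coeff m i)) i * w ^ i
      = (- 1 / (4 * (of_nat m + 1))) * (of_real (bessel_coeff (Suc m) i) * w ^ i)" for i
    proof -
      have "diffs (\<lambda>i. of_real (bessel_coeff m i)) i = (of_real (real (Suc i) * bessel_coeff m (Suc i)) :: 'a)"
        by (simp add: diffs_def)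
      then show ?thesis unfolding bessel_coeff_Suc_index by simp
    qed
    then have "(\<Sum>i. diffs (\<lambda>i. of_real (bessel_coeff m i)) i * w ^ i)
      = (- 1 / (4 * (of_nat m + 1))) * (\<Sum>i. of_real (bessel_coeff (Suc m) i) * w ^ i)"
      by (simp only: suminf_mult[OF summable_bessel_series])
    then show ?thesis by (simp add: bessel_series_def)
  qed
  ultimately show ?thesis by (simp add: bessel_series_def[abs_def])
qed

text \<open>The relation J_m + J_(m+2) = (2 (m+1) / z) J_(m+1) in the normalised form.
  Differentiating twice produces the orders m, m+1 and m+2; this relation reduces them to Bessel's
  equation.\<close>

lemma bessel_series_recurrence:
  fixes w :: "'a::{real_normed_field, banach}"
  shows "bessel_series m w = bessel_series (Suc m) w
    - w * bessel_series (Suc (Suc m)) w / (4 * (of_nat m + 1) * (of_nat m + 2))"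
proof -
  let ?c = "\<lambda>m i. of_real (bessel_coeff m i) * w ^ i"
  define K :: 'a where "K = - 1 / (4 * (of_nat m + 1) * (of_nat m + 2))"
  have c: "?c m (Suc i) - ?c (Suc m) (Suc i) = K * w * ?c (Suc (Suc m)) i" for i
  proof -
    have "bessel_coeff m (Suc i) - bessel_coeff (Suc m) (Suc i)
      = - 1 / (4 * (real m + 1) * (real m + 2)) * bessel_coeff (Suc (Suc m)) i"
      unfolding bessel_coeff_def by (simp add: divide_simps) (simp add: algebra_simps)
    then have "of_real (bessel_coeff m (Suc i)) - of_real (bessel_coeff (Suc m) (Suc i))
      = K * of_real (bessel_coeff (Suc (Suc m)) i)"
      unfolding K_def of_real_diff[symmetric] by simp
    then have "(of_real (bessel_coeff m (Suc i)) - of_real (bessel_coeff (Suc m) (Suc i))) * (w ^ i * w)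
      = K * of_real (bessel_coeff (Suc (Suc m)) i) * (w ^ i * w)" by (simp only:)
    then show ?thesis by (simp add: algebra_simps)
  qed
  have s: "summable (\<lambda>i. ?c m i - ?c (Suc m) i)"
    by (intro summable_diff summable_bessel_series)
  have "bessel_series m w - bessel_series (Suc m) w = (\<Sum>i. ?c m i - ?c (Suc m) i)"
    unfolding bessel_series_def by (intro suminf_diff summable_bessel_series)
  also have "\<dots> = (\<Sum>i. ?c m (Suc i) - ?c (Suc m) (Suc i))"
    using suminf_split_head[OF s] by (simp add: bessel_coeff_def)
  also have "\<dots> = (\<Sum>i. K * w * ?c (Suc (Suc m)) i)" by (simp only: c)
  also have "\<dots> = K * w * bessel_series (Suc (Suc m)) w"
    unfolding bessel_series_def by (intro suminf_mult summable_bessel_series)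
  finally show ?thesis by (simp add: K_def algebra_simps)
qed

text \<open>This is 2^m m! J_m(z).\<close>

definition bessel_fun :: "nat \<Rightarrow> 'a::{real_normed_field, banach} \<Rightarrow> 'a" where
  "bessel_fun m z = z ^ m * bessel_series m (z\<^sup>2)"

text \<open>The Euler derivative z d/dz of F = \<open>bessel_fun m\<close>, written out so that it
  is continuous at 0. With E for this function, Bessel's equation is the system z F' = E, z E' =
  (m^2 - z^2) F.\<close>

definition bessel_euler :: "nat \<Rightarrow> 'a::{real_normed_field, banach} \<Rightarrow> 'a" where
  "bessel_euler m z = z ^ m * (of_nat m * bessel_series m (z\<^sup>2)
     - z\<^sup>2 * bessel_series (Suc m) (z\<^sup>2) / (2 * (of_nat m + 1)))"

lemma bessel_fun_deriv:
  fixes z :: "'a::{real_normed_field, banach}"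
  assumes "z \<noteq> 0"
  shows "(bessel_fun m has_field_derivative bessel_euler m z / z) (at z)"
proof -
  note [derivative_intros] = DERIV_chain2[OF bessel_series_deriv]
  define n :: 'a where "n = of_nat m + 1"
  have "n \<noteq> 0" unfolding n_def using of_nat_neq_0[of m, where 'a='a] by (simp add: add.commute)
  then have n: "n \<noteq> 0" "of_nat m = n - 1" by (auto simp: n_def)
  have p: "of_nat m * z ^ (m - Suc 0) = of_nat m * z ^ m / z"
    using assms by (cases m) auto
  have "(bessel_fun m has_field_derivative of_nat m * z ^ (m - Suc 0) * bessel_series m (z\<^sup>2)
    + - bessel_series (Suc m) (z\<^sup>2) / (4 * (of_nat m + 1)) * (2 * z) * z ^ m) (at z)"
    unfolding bessel_fun_def[abs_def]
    by (rule derivative_eq_intros refl)+ simp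
  also have "of_nat m * z ^ (m - Suc 0) * bessel_series m (z\<^sup>2)
    + - bessel_series (Suc m) (z\<^sup>2) / (4 * (of_nat m + 1)) * (2 * z) * z ^ m = bessel_euler m z / z"
    unfolding bessel_euler_def p unfolding n using assms n(1)
    by (simp add: divide_simps) (simp add: algebra_simps power2_eq_square)
  finally show ?thesis .
qed

lemma bessel_euler_deriv:
  fixes z :: "'a::{real_normed_field, banach}"
  assumes "z \<noteq> 0"
  shows "(bessel_euler m has_field_derivative ((of_nat m)\<^sup>2 - z\<^sup>2) * bessel_fun m z / z) (at z)"
proof -
  note [derivative_intros] = DERIV_chain2[OF bessel_series_deriv]
  define n :: 'a where "n = of_nat m + 1"
  have "n \<noteq> 0" unfolding n_def using of_nat_neq_0[of m, where 'a='a] by (simp add: add.commute)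
  moreover have "n + 1 \<noteq> 0" unfolding n_def
    using of_nat_neq_0[of "Suc m", where 'a='a] by (simp add: add_ac)
  ultimately have n: "n \<noteq> 0" "n + 1 \<noteq> 0" "of_nat m = n - 1" "of_nat (Suc m) = n" by (auto simp: n_def)
  have n5: "4 + n * 4 \<noteq> 0"
  proof -
    have "4 + n * 4 = 4 * (n + 1)" by (simp add: algebra_simps)
    then show ?thesis using n(2) by (simp only: mult_eq_0_iff) simp
  qed
  have p: "of_nat m * z ^ (m - Suc 0) = of_nat m * z ^ m / z"
    using assms by (cases m) auto
  define S1 S2 where "S1 = bessel_series (Suc m) (z\<^sup>2)" and "S2 = bessel_series (Suc (Suc m)) (z\<^sup>2)"
  have S0: "bessel_series m (z\<^sup>2) = S1 - z\<^sup>2 * S2 / (4 * n * (n + 1))"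
    unfolding bessel_series_recurrence[of m] S1_def S2_def by (simp add: n_def algebra_simps)
  define K where "K = 1 / (2 * n)"
  have "((\<lambda>z. z ^ m * (of_nat m * bessel_series m (z\<^sup>2) - z\<^sup>2 * bessel_series (Suc m) (z\<^sup>2) * K))
    has_field_derivative
    of_nat m * z ^ (m - Suc 0) * (of_nat m * bessel_series m (z\<^sup>2) - z\<^sup>2 * S1 * K)
    + (- S1 / (4 * n) * (2 * z) * of_nat m
       - (2 * z * S1 + - S2 / (4 * (of_nat (Suc m) + 1)) * (2 * z) * z\<^sup>2) * K) * z ^ m) (at z)"
    unfolding n_def S1_def S2_def
    by (rule derivative_eq_intros refl)+ simp
  also have "(\<lambda>z. z ^ m * (of_nat m * bessel_series m (z\<^sup>2) - z\<^sup>2 * bessel_series (Suc m) (z\<^sup>2) * K))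
    = bessel_euler m"
    by (simp add: bessel_euler_def[abs_def] K_def n_def)
  also have "of_nat m * z ^ (m - Suc 0) * (of_nat m * bessel_series m (z\<^sup>2) - z\<^sup>2 * S1 * K)
    + (- S1 / (4 * n) * (2 * z) * of_nat m
       - (2 * z * S1 + - S2 / (4 * (of_nat (Suc m) + 1)) * (2 * z) * z\<^sup>2) * K) * z ^ m
    = ((of_nat m)\<^sup>2 - z\<^sup>2) * bessel_fun m z / z"
    unfolding p bessel_fun_def S0 n(4) K_def unfolding n(3) using assms n(1,2) n5
    apply (simp add: divide_simps)
    apply (simp add: algebra_simps power2_eq_square)
    done
  finally show ?thesis .
qed

lemma continuous_on_bessel_series: "continuous_on A (bessel_series m)"
  using bessel_series_deriv by (meson DERIV_isCont continuous_at_imp_continuous_on)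

lemma continuous_on_bessel_series_compose [continuous_intros]:
  "continuous_on A f \<Longrightarrow> continuous_on A (\<lambda>x. bessel_series m (f x))"
  by (rule continuous_on_compose2[OF continuous_on_bessel_series[of UNIV]]) auto

lemma continuous_on_bessel_fun: "continuous_on A (bessel_fun m)"
  unfolding bessel_fun_def[abs_def] by (intro continuous_intros)

lemma continuous_on_bessel_euler:
  fixes A :: "'a::{real_normed_field, banach} set"
  shows "continuous_on A (bessel_euler m)"
proof -
  have "continuous_on A (\<lambda>z::'a. z ^ m * (of_nat m * bessel_series m (z\<^sup>2)
     - z\<^sup>2 * bessel_series (Suc m) (z\<^sup>2) * (1 / (2 * (of_nat m + 1)))))"
    by (intro continuous_intros)
  then show ?thesis by (simp add: bessel_euler_def[abs_def])
qed

section \<open>Sturm comparison for the zeros\<close>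

text \<open>Below the turning point \<open>x = m\<close> the product \<open>x J J'\<close> is increasing.\<close>

lemma bessel_series_nonzero_below_order:
  fixes x :: real
  assumes "0 < x" "x \<le> m"
  shows "bessel_series m (x\<^sup>2) \<noteq> 0"
proof
  assume zero: "bessel_series m (x\<^sup>2) = 0"
  define V where "V = (\<lambda>t::real. bessel_euler m t * bessel_fun m t)"
  have V': "(V has_real_derivative (((real m)\<^sup>2 - t\<^sup>2) * (bessel_fun m t)\<^sup>2 + (bessel_euler m t)\<^sup>2) / t) (at t)"
    if "t > 0" for t
    unfolding V_def
    by (rule DERIV_cong[OF DERIV_mult[OF bessel_euler_deriv bessel_fun_deriv]])
       (use that in \<open>auto simp: field_simps power2_eq_square\<close>)
  have cont: "continuous_on A V" for A
    unfolding V_def by (intro continuous_intros continuous_on_bessel_euler continuous_on_bessel_fun)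
  have mono: "V s \<le> V t" if "0 \<le> s" "s \<le> t" "t \<le> x" for s t
  proof (rule DERIV_nonneg_imp_increasing_open[OF \<open>s \<le> t\<close>])
    fix y assume y: "s < y" "y < t"
    then have "y\<^sup>2 \<le> (real m)\<^sup>2" "y > 0" using that assms by (auto intro: power_mono)
    then show "\<exists>z. (V has_real_derivative z) (at y) \<and> 0 \<le> z"
      using V'[of y] by (intro exI conjI) auto
  qed (rule cont)
  have "m > 0" using assms by auto
  then have V0: "V 0 = 0" "V x = 0" using zero by (auto simp: V_def bessel_fun_def)
  \<comment> \<open>The monotone V vanishes at both ends of [0, x], hence throughout, and so does
    its derivative. Both terms of the derivative are nonnegative, so the series would vanish on (0,
    x), against its value 1 at 0.\<close>
  have Vzero: "V t = 0" if "0 \<le> t" "t \<le> x" for t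
    using mono[of 0 t] mono[of t x] that V0 by auto
  have "bessel_series m (t\<^sup>2) = 0" if "t \<in> {0<..<x}" for t
  proof -
    have "(V has_real_derivative 0) (at t)"
      by (rule has_field_derivative_transform_within_open[of "\<lambda>_. 0" _ _ "{0<..<x}"])
         (use that Vzero in auto)
    with V'[of t] that have "((real m)\<^sup>2 - t\<^sup>2) * (bessel_fun m t)\<^sup>2 + (bessel_euler m t)\<^sup>2 = 0"
      using DERIV_unique by fastforce
    moreover have pos: "(real m)\<^sup>2 - t\<^sup>2 > 0" using that assms by (auto intro: power_strict_mono)
    then have "0 \<le> ((real m)\<^sup>2 - t\<^sup>2) * (bessel_fun m t)\<^sup>2" by (intro mult_nonneg_nonneg) auto
    ultimately have "((real m)\<^sup>2 - t\<^sup>2) * (bessel_fun m t)\<^sup>2 = 0"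
      using zero_le_power2[of "bessel_euler m t"] by linarith
    then have "(bessel_fun m t)\<^sup>2 = 0" using pos by simp
    then show ?thesis using that by (auto simp: bessel_fun_def)
  qed
  moreover have "continuous_on {0..x} (\<lambda>t. bessel_series m (t\<^sup>2))"
    by (intro continuous_intros)
  ultimately have "bessel_series m (0\<^sup>2) = (0::real)"
    using continuous_constant_on_closure[of "{0<..<x}" "\<lambda>t. bessel_series m (t\<^sup>2)" 0 0] assms by auto
  then show False by simp
qed

text \<open>For x >= m this is the integral of sqrt (t^2 - m^2) / t from m to x. In the variable ln
  x Bessel's equation reads F'' = (m^2 - x^2) F, so sqrt (x^2 - m^2) is the local frequency.\<close>

definition bessel_phase :: "nat \<Rightarrow> real \<Rightarrow> real" where
  "bessel_phase m x = sqrt (x\<^sup>2 - (real m)\<^sup>2) - m * arccos (m / x)"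

lemma bessel_phase_deriv:
  assumes "real m < x"
  shows "(bessel_phase m has_real_derivative sqrt (x\<^sup>2 - (real m)\<^sup>2) / x) (at x)"
proof -
  define s where "s = sqrt (x\<^sup>2 - (real m)\<^sup>2)"
  have x: "x > 0" using assms by linarith
  have "(real m)\<^sup>2 < x\<^sup>2" using assms by (intro power_strict_mono) auto
  then have s: "s > 0" "s\<^sup>2 = x\<^sup>2 - (real m)\<^sup>2" by (auto simp: s_def)
  have q: "- 1 < real m / x" "real m / x < 1" using assms x by (auto simp: field_simps)
  have sq: "sqrt (1 - (real m / x)\<^sup>2) = s / x"
  proof -
    have "1 - (real m / x)\<^sup>2 = (s / x)\<^sup>2" using s x by (simp add: field_simps)
    then show ?thesis using s x by simp
  qed
  have "((\<lambda>x. sqrt (x\<^sup>2 - (real m)\<^sup>2)) has_real_derivative x / s) (at x)"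
    using \<open>(real m)\<^sup>2 < x\<^sup>2\<close> by (auto intro!: derivative_eq_intros simp: s_def field_simps)
  moreover have "((\<lambda>x. arccos (m / x)) has_real_derivative m / (x * s)) (at x)"
  proof (rule DERIV_cong[OF DERIV_chain2[where f = arccos and g = "\<lambda>x. real m / x", OF DERIV_arccos[OF q]]])
    show "((\<lambda>x. real m / x) has_real_derivative - (real m / x\<^sup>2)) (at x)"
      using x by (auto intro!: derivative_eq_intros simp: power2_eq_square)
    show "inverse (- sqrt (1 - (real m / x)\<^sup>2)) * - (real m / x\<^sup>2) = real m / (x * s)"
      unfolding sq using x s by (simp add: field_simps power2_eq_square)
  qed
  ultimately have "((\<lambda>x. sqrt (x\<^sup>2 - (real m)\<^sup>2) - m * arccos (m / x)) has_real_derivative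
      x / s - m * (m / (x * s))) (at x)"
    by (intro DERIV_diff DERIV_cmult)
  also have "x / s - m * (m / (x * s)) = (x\<^sup>2 - (real m)\<^sup>2) / (x * s)"
    using x s(1) by (simp add: field_simps power2_eq_square)
  also have "\<dots> = s / x" unfolding s(2)[symmetric] using x s(1) by (simp add: power2_eq_square)
  finally show ?thesis by (simp add: bessel_phase_def[abs_def] s_def)
qed

lemma bessel_phase_strict_mono:
  assumes "real m < x" "x < y"
  shows "bessel_phase m x < bessel_phase m y"
proof (rule DERIV_pos_imp_increasing[OF assms(2)])
  fix t assume "x \<le> t" "t \<le> y"
  then have "real m < t" using assms by linarith
  moreover from this have "(real m)\<^sup>2 < t\<^sup>2" by (intro power_strict_mono) auto
  ultimately show "\<exists>d. (bessel_phase m has_real_derivative d) (at t) \<and> d > 0"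
    using bessel_phase_deriv[of m t] by (intro exI conjI) auto
qed

text \<open>Two estimates whose errors cancel: sqrt (x^2 - m^2) >= x - m^2/x, and arccos q <=
  \<pi>/2 - q with q = m/x. The bound turns information on the phase of a zero into an upper bound
  for the zero.\<close>

lemma bessel_phase_lower:
  assumes "real m < x"
  shows "x - m * pi / 2 \<le> bessel_phase m x"
proof -
  define s where "s = sqrt (x\<^sup>2 - (real m)\<^sup>2)"
  have x: "x > 0" using assms by linarith
  have "(real m)\<^sup>2 < x\<^sup>2" using assms by (intro power_strict_mono) auto
  then have s: "s > 0" "s\<^sup>2 = x\<^sup>2 - (real m)\<^sup>2" by (auto simp: s_def)
  have "(x - s) * x \<le> (x - s) * (x + s)"
  proof (rule mult_left_mono)
    have "s\<^sup>2 \<le> x\<^sup>2" unfolding s(2) by simp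
    then have "s \<le> x" by (rule power2_le_imp_le) (use x in simp)
    then show "0 \<le> x - s" by simp
  qed (use s in simp)
  also have "\<dots> = (real m)\<^sup>2" using s by (simp add: algebra_simps power2_eq_square)
  finally have "x - s \<le> m * (m / x)" using x by (simp add: field_simps power2_eq_square)
  also have "m / x \<le> arcsin (m / x)"
  proof -
    have "sin (arcsin (m / x)) \<le> arcsin (m / x)"
      using assms x by (intro sin_x_le_x) (auto intro!: arcsin_nonneg simp: field_simps)
    then show ?thesis using assms x by (subst (asm) sin_arcsin) (auto simp: field_simps)
  qed
  then have "m * (m / x) \<le> m * arcsin (m / x)" by (intro mult_left_mono) auto
  also have "arcsin (m / x) = pi / 2 - arccos (m / x)"
    using assms x by (subst arcsin_arccos_eq) (auto simp: field_simps)
  finally show ?thesis by (simp add: bessel_phase_def s_def[symmetric] algebra_simps)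
qed


text \<open>Sturm comparison with the Liouville--Green approximation
  \<open>(x\<^sup>2 - m\<^sup>2)\<^bsup>-1/4\<^esup> sin (\<phi>(x) - \<phi>(x\<^sub>1))\<close>.\<close>

lemma bessel_fun_zero_between:
  assumes mx: "real m < x1" and phase: "bessel_phase m x2 = bessel_phase m x1 + pi" "x1 < x2"
  shows "\<exists>\<xi>. x1 < \<xi> \<and> \<xi> < x2 \<and> bessel_fun m \<xi> = 0"
proof (rule ccontr)
  assume "\<not> ?thesis"
  then have nz: "bessel_fun m t \<noteq> 0" if "x1 < t" "t < x2" for t using that by auto
  define \<sigma> where "\<sigma> = sgn (bessel_fun m ((x1 + x2) / 2))"
  have mid: "x1 < (x1 + x2) / 2" "(x1 + x2) / 2 < x2" using phase by auto
  have \<sigma>: "\<sigma> \<noteq> 0" "\<sigma> * bessel_fun m ((x1 + x2) / 2) > 0"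
    unfolding \<sigma>_def using nz[OF mid] by (auto simp: sgn_if)
  have cont: "continuous_on A (\<lambda>t. \<sigma> * bessel_fun m t)" for A :: "real set"
    by (intro continuous_intros continuous_on_bessel_fun)
  have nonneg: "0 \<le> \<sigma> * bessel_fun m t" if t: "x1 \<le> t" "t \<le> x2" for t
  proof (rule ccontr)
    assume neg: "\<not> 0 \<le> \<sigma> * bessel_fun m t"
    have "\<exists>s. x1 < s \<and> s < x2 \<and> \<sigma> * bessel_fun m s = 0"
    proof (cases "t \<le> (x1 + x2) / 2")
      case True
      from IVT'[of "\<lambda>t. \<sigma> * bessel_fun m t" t 0 "(x1 + x2) / 2"] neg \<sigma>(2) cont True
      obtain s where s: "t \<le> s" "s \<le> (x1 + x2) / 2" "\<sigma> * bessel_fun m s = 0" by auto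
      moreover have "s \<noteq> t" using s neg by auto
      ultimately show ?thesis using t mid by (intro exI[of _ s]) auto
    next
      case False
      from IVT2'[of "\<lambda>t. \<sigma> * bessel_fun m t" t 0 "(x1 + x2) / 2"] neg \<sigma>(2) cont False
      obtain s where s: "(x1 + x2) / 2 \<le> s" "s \<le> t" "\<sigma> * bessel_fun m s = 0" by auto
      moreover have "s \<noteq> t" using s neg by auto
      ultimately show ?thesis using t mid by (intro exI[of _ s]) auto
    qed
    then show False using nz \<sigma>(1) by auto
  qed
  have pos: "0 < \<sigma> * bessel_fun m t" if "x1 < t" "t < x2" for t
    using nonneg[of t] nz[OF that] that \<sigma>(1) by (simp add: order_le_less)
  define s where "s = (\<lambda>x. sqrt (x\<^sup>2 - (real m)\<^sup>2))"
  define a where "a = (\<lambda>x. 1 / sqrt (s x))"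
  define \<theta> where "\<theta> = (\<lambda>x. bessel_phase m x - bessel_phase m x1)"
  \<comment> \<open>\<open>v\<close> is the approximation and \<open>v1\<close> is x v'. They
    satisfy x v1' = (R + m^2 - x^2) v with R > 0, so \<open>v\<close> oscillates more slowly than
    J_m, which is the direction the comparison needs. \<open>W\<close> is the Wronskian in the
    variable ln x, and x W' = R F v.\<close>
  define v where "v = (\<lambda>x. a x * sin (\<theta> x))"
  define v1 where "v1 = (\<lambda>x. a x * (s x * cos (\<theta> x) - x\<^sup>2 / (2 * (s x)\<^sup>2) * sin (\<theta> x)))"
  define W where "W = (\<lambda>x. bessel_fun m x * v1 x - bessel_euler m x * v x)"
  define R where "R = (\<lambda>x. ((real m)\<^sup>2 * x\<^sup>2 + x ^ 4 / 4) / (s x) ^ 4)"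
  have W': "(W has_real_derivative R x * bessel_fun m x * v x / x) (at x)" if x: "x1 \<le> x" for x
  proof -
    have x0: "x > 0" "real m < x" using x mx by linarith+
    have "(real m)\<^sup>2 < x\<^sup>2" using x0 by (intro power_strict_mono) auto
    then have s0: "s x > 0" "(real m)\<^sup>2 = x\<^sup>2 - (s x)\<^sup>2" by (auto simp: s_def)
    have a0: "a x > 0" using s0 by (simp add: a_def)
    have [derivative_intros]: "(s has_real_derivative x / s x) (at x)"
      unfolding s_def using \<open>(real m)\<^sup>2 < x\<^sup>2\<close>
      by (auto intro!: derivative_eq_intros simp: field_simps)
    have [derivative_intros]: "(a has_real_derivative - (x * a x) / (2 * (s x)\<^sup>2)) (at x)"
      unfolding a_def using s0 x0
      by (auto intro!: derivative_eq_intros simp: field_simps power2_eq_square)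
    have [derivative_intros]: "(\<theta> has_real_derivative s x / x) (at x)"
      unfolding \<theta>_def using bessel_phase_deriv[OF x0(2)] x0
      by (auto intro!: derivative_eq_intros simp: s_def)
    have v': "(v has_real_derivative v1 x / x) (at x)"
      unfolding v_def v1_def using s0 x0
      by (auto intro!: derivative_eq_intros simp: field_simps power2_eq_square)
    have v1': "(v1 has_real_derivative (R x - (s x)\<^sup>2) * v x / x) (at x)"
      unfolding v1_def
      apply (rule derivative_eq_intros refl | use s0 in force)+
      unfolding R_def v_def s0(2) using s0(1) x0
      apply (simp add: divide_simps)
      apply (simp add: algebra_simps eval_nat_numeral)
      done
    show ?thesis
      unfolding W_def
      by (rule DERIV_cong[OF DERIV_diff[OF DERIV_mult[OF bessel_fun_deriv v1']
            DERIV_mult[OF bessel_euler_deriv v']]])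
         (use x0 s0(1) in \<open>auto simp: s0(2) field_simps\<close>)
  qed
  have "\<sigma> * W x1 < \<sigma> * W x2"
  proof (rule DERIV_pos_imp_increasing_open[OF phase(2)])
    fix x assume x: "x1 < x" "x < x2"
    then have x0: "x > 0" "real m < x" using mx by linarith+
    have "(real m)\<^sup>2 < x\<^sup>2" using x0 by (intro power_strict_mono) auto
    then have s0: "s x > 0" by (auto simp: s_def)
    have "\<theta> x > 0" "\<theta> x < pi"
      using bessel_phase_strict_mono[OF mx x(1)] bessel_phase_strict_mono[OF x0(2) x(2)] phase(1)
      by (auto simp: \<theta>_def)
    then have "v x > 0" using s0 by (simp add: v_def a_def sin_gt_zero)
    moreover have "R x > 0" using s0 x0
      unfolding R_def by (intro divide_pos_pos add_nonneg_pos) auto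
    ultimately have "R x * (\<sigma> * bessel_fun m x) * v x / x > 0" using pos[OF x] x0 by simp
    moreover have "((\<lambda>x. \<sigma> * W x) has_real_derivative \<sigma> * (R x * bessel_fun m x * v x / x)) (at x)"
      using W'[of x] x by (intro DERIV_cmult) auto
    ultimately show "\<exists>y. ((\<lambda>x. \<sigma> * W x) has_real_derivative y) (at x) \<and> 0 < y"
      by (intro exI[of _ "\<sigma> * (R x * bessel_fun m x * v x / x)"]) (simp add: mult_ac)
  next
    have "continuous_on {x1..x2} W"
      by (intro continuous_at_imp_continuous_on ballI DERIV_isCont[OF W']) auto
    then show "continuous_on {x1..x2} (\<lambda>x. \<sigma> * W x)" by (intro continuous_intros)
  qed
  moreover have sx: "s x > 0" "a x > 0" if "x \<ge> x1" for x
  proof -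
    have "(real m)\<^sup>2 < x\<^sup>2" using that mx by (intro power_strict_mono) auto
    then show "s x > 0" by (auto simp: s_def)
    then show "a x > 0" by (simp add: a_def)
  qed
  \<comment> \<open>At both ends the sine vanishes, and the cosine is 1 at \<open>x1\<close> and -1
    at \<open>x2\<close>. Hence \<open>W\<close> is a positive multiple of J_m at the left end and a
    negative one at the right end, against the strict growth of \<open>\<sigma> * W\<close>.\<close>
  have "\<sigma> * W x1 \<ge> 0"
  proof -
    have *: "\<sigma> * W x1 = (\<sigma> * bessel_fun m x1) * (a x1 * s x1)"
      by (simp add: W_def v_def v1_def \<theta>_def)
    have "0 \<le> (\<sigma> * bessel_fun m x1) * (a x1 * s x1)"
      using sx[of x1] nonneg[of x1] phase(2) by (intro mult_nonneg_nonneg[OF _ mult_nonneg_nonneg]) auto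
    then show ?thesis by (simp only: *)
  qed
  moreover have "\<sigma> * W x2 \<le> 0"
  proof -
    have *: "\<sigma> * W x2 = - ((\<sigma> * bessel_fun m x2) * (a x2 * s x2))"
      by (simp add: W_def v_def v1_def \<theta>_def phase(1))
    have "0 \<le> (\<sigma> * bessel_fun m x2) * (a x2 * s x2)"
      using sx[of x2] nonneg[of x2] phase(2) by (intro mult_nonneg_nonneg[OF _ mult_nonneg_nonneg]) auto
    then show ?thesis by (simp only: *)
  qed
  ultimately show False by linarith
qed

text \<open>\<open>X n\<close> is the point beyond \<open>l\<close> where the phase has grown by n
  \<pi>. Sturm comparison puts a zero strictly between \<open>X n\<close> and
  \<open>X (Suc n)\<close>, and \<open>bessel_phase_lower\<close> bounds
  \<open>X (Suc n)\<close>.\<close>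

lemma bessel_zero_sequence:
  assumes "real m < l"
  obtains z :: "nat \<Rightarrow> real" where "\<And>n. bessel_series m ((z n)\<^sup>2) = 0" "\<And>n. l < z n" "inj z"
    "\<And>n. z n \<le> bessel_phase m l + (n + 1) * pi + m * pi / 2"
proof -
  have "\<exists>x\<ge>l. bessel_phase m x = bessel_phase m l + real n * pi" for n
  proof -
    define b where "b = max l (bessel_phase m l + real n * pi + m * pi / 2)"
    have "\<exists>x. l \<le> x \<and> x \<le> b \<and> bessel_phase m x = bessel_phase m l + real n * pi"
    proof (rule IVT')
      show "bessel_phase m l \<le> bessel_phase m l + real n * pi" by simp
      have "bessel_phase m b \<ge> b - m * pi / 2"
        by (rule bessel_phase_lower) (use assms in \<open>auto simp: b_def\<close>)
      then show "bessel_phase m l + real n * pi \<le> bessel_phase m b"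
        unfolding b_def by linarith
      show "l \<le> b" by (simp add: b_def)
      show "continuous_on {l..b} (bessel_phase m)"
        by (intro continuous_at_imp_continuous_on ballI DERIV_isCont[OF bessel_phase_deriv])
           (use assms in auto)
    qed
    then show ?thesis by auto
  qed
  then obtain X where X: "\<And>n. X n \<ge> l" "\<And>n. bessel_phase m (X n) = bessel_phase m l + real n * pi"
    by metis
  have mX: "real m < X n" for n using X(1)[of n] assms by linarith
  have less: "x < y" if "bessel_phase m x < bessel_phase m y" "real m < y" for x y
    using bessel_phase_strict_mono[OF that(2), of x] that(1) by (cases x y rule: linorder_cases) auto
  have "X n < X (Suc n)" for n
    by (rule less) (use X mX in \<open>auto simp: algebra_simps\<close>)
  then have "\<exists>\<xi>. X n < \<xi> \<and> \<xi> < X (Suc n) \<and> bessel_fun m \<xi> = 0" for n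
    by (intro bessel_fun_zero_between mX) (simp_all add: X(2) algebra_simps)
  then obtain z where z: "\<And>n. X n < z n" "\<And>n. z n < X (Suc n)" "\<And>n. bessel_fun m (z n) = 0"
    by metis
  have mz: "real m < z n" for n using mX[of n] z(1)[of n] by linarith
  show thesis
  proof (rule that)
    show "bessel_series m ((z n)\<^sup>2) = 0" for n
      using z(3)[of n] mz[of n] by (auto simp: bessel_fun_def)
    show "l < z n" for n using X(1)[of n] z(1)[of n] by linarith
    have "z n < z (Suc n)" for n using z(1)[of "Suc n"] z(2)[of n] by linarith
    then have "strict_mono z" by (rule strict_mono_Suc_iff[THEN iffD2, rule_format])
    then show "inj z" by (rule strict_mono_imp_inj_on)
    show "z n \<le> bessel_phase m l + (n + 1) * pi + m * pi / 2" for n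
      using bessel_phase_lower[OF mX[of "Suc n"]] z(2)[of n] X(2)[of "Suc n"] by (simp add: algebra_simps)
  qed
qed

section \<open>Growth in the complex plane\<close>

lemma inner_mult_self_complex: "inner a (c * a) = Re c * (norm a)\<^sup>2" for a c :: complex
  by (simp add: inner_complex_def cmod_power2) (simp add: algebra_simps power2_eq_square)

text \<open>Along each ray the squared amplitude \<open>|A|\<^sup>2 + |B|\<^sup>2\<close> of the two components behaving like
  \<open>e\<^bsup>iz\<^esup> z\<^bsup>1/2\<^esup>\<close> and \<open>e\<^bsup>-iz\<^esup> z\<^bsup>1/2\<^esup>\<close> obeys a Gronwall inequality.\<close>

lemma bessel_fun_growth:
  obtains C where "C > 0"
    "\<And>z::complex. 1 \<le> norm z \<Longrightarrow> norm (bessel_fun m z) * sqrt (norm z) \<le> C * exp \<bar>Im z\<bar>"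
proof -
  \<comment> \<open>The 1/2 accounts for the factor z^(1/2): z A' = (1/2 + iz) A + \<kappa> F with
    \<kappa> = m^2 - 1/4, and likewise for \<open>B\<close> with -iz. Since A - B = 2iz F, the
    coupling term \<kappa> F is smaller than A and B by a factor of order 1/|z|.\<close>
  define A where "A = (\<lambda>z. bessel_euler m z + (1/2 + \<i> * z) * bessel_fun m z)"
  define B where "B = (\<lambda>z. bessel_euler m z + (1/2 - \<i> * z) * bessel_fun m z)"
  define \<kappa> where "\<kappa> = (real m)\<^sup>2 - 1/4"
  define N where "N = (\<lambda>z. (norm (A z))\<^sup>2 + (norm (B z))\<^sup>2)"
  have A': "(A has_field_derivative ((1/2 + \<i> * z) * A z + of_real \<kappa> * bessel_fun m z) / z) (at z)"
    if "z \<noteq> 0" for z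
    unfolding A_def using that
    by (auto intro!: derivative_eq_intros bessel_fun_deriv bessel_euler_deriv simp: \<kappa>_def field_simps power2_eq_square)
  have B': "(B has_field_derivative ((1/2 - \<i> * z) * B z + of_real \<kappa> * bessel_fun m z) / z) (at z)"
    if "z \<noteq> 0" for z
    unfolding B_def using that
    by (auto intro!: derivative_eq_intros bessel_fun_deriv bessel_euler_deriv simp: \<kappa>_def field_simps power2_eq_square)
  have AB: "norm (bessel_fun m z) * (2 * norm z) \<le> norm (A z) + norm (B z)" for z
  proof -
    have "bessel_fun m z * (2 * \<i> * z) = A z - B z" by (simp add: A_def B_def algebra_simps)
    then have "norm (bessel_fun m z * (2 * \<i> * z)) \<le> norm (A z) + norm (B z)"
      by (simp only: norm_triangle_ineq4)
    then show ?thesis by (simp add: norm_mult)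
  qed
  have sq: "(norm (A z) + norm (B z))\<^sup>2 \<le> 2 * N z" for z
    using sum_squares_ge_zero[of "norm (A z) - norm (B z)" 0]
    by (simp add: N_def power2_eq_square algebra_simps)
  have contN: "continuous_on X N" for X
    unfolding N_def A_def B_def
    by (intro continuous_intros continuous_on_bessel_fun continuous_on_bessel_euler)
  obtain M where M: "\<And>z. norm z = 1 \<Longrightarrow> N z \<le> M"
  proof -
    have "compact (N ` sphere 0 1)" by (intro compact_continuous_image contN) auto
    then have "bdd_above (N ` sphere 0 1)" by (intro bounded_imp_bdd_above compact_imp_bounded)
    then obtain M where "\<And>y. y \<in> N ` sphere 0 1 \<Longrightarrow> y \<le> M" unfolding bdd_above_def by blast
    then show thesis by (intro that[of M]) (auto simp: dist_norm)
  qed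
  have ray: "N (of_real t * e) \<le> t * exp (2 * t * \<bar>Im e\<bar>) * (M * exp (2 * \<bar>\<kappa>\<bar>))"
    if e: "norm e = 1" and t: "1 \<le> t" for e t
  proof -
    \<comment> \<open>The integrating factor: W'/W = -(1/r + 2 |Im e| + 2 |\<kappa>| / r^2). The
      last term comes from the coupling and is integrable at infinity, so it costs only the constant
      exp (2 |\<kappa>|).\<close>
    define W where "W = (\<lambda>t::real. inverse t * exp (- 2 * t * \<bar>Im e\<bar>) * exp (2 * \<bar>\<kappa>\<bar> * inverse t))"
    define h where "h = (\<lambda>t::real. N (of_real t * e) * W t)"
    have "h t \<le> h 1"
    proof (rule DERIV_nonpos_imp_nonincreasing[OF t])
      fix r :: real assume "1 \<le> r" "r \<le> t"
      define z where "z = of_real r * e"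
      have r: "r > 0" and z0: "z \<noteq> 0" and nz: "norm z = r"
        using \<open>1 \<le> r\<close> e by (auto simp: z_def norm_mult)
      let ?q = "1 / r + 2 * \<bar>Im e\<bar> + 2 * \<bar>\<kappa>\<bar> / r\<^sup>2"
      have e0: "e \<noteq> 0" using e by auto
      have vec: "((\<lambda>r. F (of_real r * e)) has_vector_derivative (D / of_real r)) (at r)"
        if "(F has_field_derivative D / z) (at z)" for F D
      proof -
        have "((\<lambda>r. of_real r * e) has_vector_derivative e) (at r)"
          by (auto intro!: derivative_eq_intros simp: scaleR_conv_of_real has_vector_derivative_def)
        from field_vector_diff_chain_at[OF this that[unfolded z_def]]
        have "((\<lambda>r. F (of_real r * e)) has_vector_derivative e * (D / (of_real r * e))) (at r)"
          by (simp add: o_def)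
        also have "e * (D / (of_real r * e)) = D / of_real r" using e0 r by simp
        finally show ?thesis .
      qed
      have normsq: "((\<lambda>r. (norm (F (of_real r * e)))\<^sup>2) has_real_derivative
          2 * ((Re c) * (norm (F z))\<^sup>2 + \<kappa> * inner (F z) (bessel_fun m z)) / r) (at r)"
        if "(F has_field_derivative (c * F z + of_real \<kappa> * bessel_fun m z) / z) (at z)" for F c
      proof -
        have "((\<lambda>r. inner (F (of_real r * e)) (F (of_real r * e))) has_vector_derivative
          inner (F z) ((c * F z + of_real \<kappa> * bessel_fun m z) / of_real r)
          + inner ((c * F z + of_real \<kappa> * bessel_fun m z) / of_real r) (F z)) (at r)"
          unfolding z_def
          by (rule bounded_bilinear.has_vector_derivative[OF bounded_bilinear_inner])
             (use vec[OF that] in \<open>simp_all add: z_def\<close>)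
        moreover have "inner (F z) ((c * F z + of_real \<kappa> * bessel_fun m z) / of_real r)
          = ((Re c) * (norm (F z))\<^sup>2 + \<kappa> * inner (F z) (bessel_fun m z)) / r"
        proof -
          have "(c * F z + of_real \<kappa> * bessel_fun m z) / of_real r
            = (1 / r) *\<^sub>R (c * F z + \<kappa> *\<^sub>R bessel_fun m z)"
            by (simp add: scaleR_conv_of_real)
          then show ?thesis by (simp add: inner_add_right inner_mult_self_complex)
        qed
        ultimately show ?thesis
          by (simp add: has_real_derivative_iff_has_vector_derivative power2_norm_eq_inner inner_commute)
      qed
      define gg where "gg = bessel_fun m z"
      define E' where "E' = 2 * ((Re (1/2 + \<i> * z)) * (norm (A z))\<^sup>2 + \<kappa> * inner (A z) gg) / r
         + 2 * ((Re (1/2 - \<i> * z)) * (norm (B z))\<^sup>2 + \<kappa> * inner (B z) gg) / r"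
      have dN: "((\<lambda>r. N (of_real r * e)) has_real_derivative E') (at r)"
        unfolding N_def E'_def gg_def by (intro DERIV_add normsq A' B' z0)
      have W': "(W has_real_derivative - W r * ?q) (at r)"
        unfolding W_def using r
        by (auto intro!: derivative_eq_intros simp: field_simps power2_eq_square)
      have "E' \<le> N z * ?q"
      proof -
        have imz: "Im z = r * Im e" by (simp add: z_def)
        have 1: "Re (1/2 + \<i> * z) \<le> 1/2 + r * \<bar>Im e\<bar>" "Re (1/2 - \<i> * z) \<le> 1/2 + r * \<bar>Im e\<bar>"
          using mult_left_mono[of "Im e" "\<bar>Im e\<bar>" r] mult_left_mono[of "- Im e" "\<bar>Im e\<bar>" r] r
          by (auto simp: imz)
        have 2: "\<kappa> * inner x gg \<le> \<bar>\<kappa>\<bar> * (norm x * norm gg)" for x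
        proof -
          have "\<kappa> * inner x gg \<le> \<bar>\<kappa>\<bar> * \<bar>inner x gg\<bar>" by (metis abs_ge_self abs_mult)
          also have "\<dots> \<le> \<bar>\<kappa>\<bar> * (norm x * norm gg)"
            by (intro mult_left_mono Cauchy_Schwarz_ineq2) auto
          finally show ?thesis .
        qed
        have 3: "(norm (A z) + norm (B z)) * norm gg \<le> N z / r"
        proof -
          have "(norm (A z) + norm (B z)) * (norm gg * (2 * r)) \<le> (norm (A z) + norm (B z))\<^sup>2"
            using mult_left_mono[OF AB[of z], of "norm (A z) + norm (B z)"]
            by (simp add: power2_eq_square nz gg_def)
          also note sq
          finally show ?thesis using r by (simp add: field_simps)
        qed
        have "E' * r / 2 = (Re (1/2 + \<i> * z)) * (norm (A z))\<^sup>2 + (Re (1/2 - \<i> * z)) * (norm (B z))\<^sup>2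
           + \<kappa> * inner (A z) gg + \<kappa> * inner (B z) gg"
          unfolding E'_def using r by (simp add: field_simps)
        also have "\<dots> \<le> (1/2 + r * \<bar>Im e\<bar>) * (norm (A z))\<^sup>2 + (1/2 + r * \<bar>Im e\<bar>) * (norm (B z))\<^sup>2
           + \<bar>\<kappa>\<bar> * (norm (A z) * norm gg) + \<bar>\<kappa>\<bar> * (norm (B z) * norm gg)"
          by (intro add_mono mult_right_mono 1 2) auto
        also have "\<dots> = (1/2 + r * \<bar>Im e\<bar>) * N z + \<bar>\<kappa>\<bar> * ((norm (A z) + norm (B z)) * norm gg)"
          by (simp add: N_def algebra_simps)
        also have "\<dots> \<le> (1/2 + r * \<bar>Im e\<bar>) * N z + \<bar>\<kappa>\<bar> * (N z / r)"
          by (intro add_left_mono mult_left_mono 3) auto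
        also have "\<dots> = N z * ?q * r / 2"
          using r by (simp add: field_simps power2_eq_square)
        finally show ?thesis using r by (simp add: mult_le_cancel_right)
      qed
      moreover have "W r > 0" using r by (simp add: W_def)
      ultimately have "E' * W r \<le> N z * ?q * W r"
        by (intro mult_right_mono) auto
      then have "E' * W r + - W r * ?q * N (of_real r * e) \<le> 0"
        by (simp add: z_def algebra_simps)
      moreover have "(h has_real_derivative (E' * W r + - W r * ?q * N (of_real r * e))) (at r)"
        unfolding h_def by (rule DERIV_mult[OF dN W'])
      ultimately show "\<exists>y. (h has_real_derivative y) (at r) \<and> y \<le> 0" by blast
    qed
    also have "h 1 \<le> M * (1 * exp (2 * \<bar>\<kappa>\<bar>))"
      unfolding h_def W_def
      by (intro mult_mono) (use M[of e] e in \<open>auto simp: N_def intro: order_trans[OF _ M[of e]]\<close>)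
    finally have "N (of_real t * e) * W t \<le> M * exp (2 * \<bar>\<kappa>\<bar>)" by (simp add: h_def)
    moreover have "W t \<ge> inverse (t * exp (2 * t * \<bar>Im e\<bar>))"
    proof -
      have "exp (2 * \<bar>\<kappa>\<bar> * inverse t) \<ge> 1" using t by simp
      then have "inverse t * exp (- 2 * t * \<bar>Im e\<bar>) * exp (2 * \<bar>\<kappa>\<bar> * inverse t) \<ge> inverse t * exp (- 2 * t * \<bar>Im e\<bar>) * 1"
        using t by (intro mult_left_mono) auto
      then show ?thesis by (simp add: W_def exp_minus)
    qed
    then have "N (of_real t * e) * inverse (t * exp (2 * t * \<bar>Im e\<bar>)) \<le> N (of_real t * e) * W t"
      by (intro mult_left_mono) (auto simp: N_def)
    ultimately have "N (of_real t * e) * inverse (t * exp (2 * t * \<bar>Im e\<bar>)) \<le> M * exp (2 * \<bar>\<kappa>\<bar>)"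
      by (rule order_trans[rotated])
    then show ?thesis
      using t by (simp add: divide_inverse[symmetric] pos_divide_le_eq mult.commute del: inverse_mult_distrib)
  qed
  define K where "K = M * exp (2 * \<bar>\<kappa>\<bar>)"
  have "0 \<le> N 1" by (simp add: N_def)
  also have "\<dots> \<le> M" by (rule M) simp
  finally have "M \<ge> 0" .
  then have "K \<ge> 0" by (simp add: K_def)
  show thesis
  proof (rule that[of "sqrt K + 1"])
    show "sqrt K + 1 > 0" using \<open>K \<ge> 0\<close> by (simp add: add_nonneg_pos)
    fix z :: complex assume z: "1 \<le> norm z"
    define t where "t = norm z"
    define e where "e = z / of_real t"
    have t: "t \<ge> 1" "t > 0" using z by (auto simp: t_def)
    have e: "norm e = 1" "z = of_real t * e" using t by (auto simp: e_def t_def norm_divide)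
    have im: "t * \<bar>Im e\<bar> = \<bar>Im z\<bar>" using e(2) t by (simp add: abs_mult)
    have "(norm (bessel_fun m z) * (2 * t))\<^sup>2 \<le> (norm (A z) + norm (B z))\<^sup>2"
      using AB[of z] t by (intro power_mono) (auto simp: t_def)
    also have "\<dots> \<le> 2 * N z" by (rule sq)
    also have "\<dots> \<le> 2 * (t * exp (2 * t * \<bar>Im e\<bar>) * K)"
      using ray[OF e(1) t(1)] by (simp add: e(2)[symmetric] K_def)
    also have "2 * t * \<bar>Im e\<bar> = 2 * \<bar>Im z\<bar>" using im by simp
    finally have "(norm (bessel_fun m z))\<^sup>2 * t \<le> exp (2 * \<bar>Im z\<bar>) * K / 2"
      using t by (simp add: power2_eq_square field_simps)
    also have "\<dots> \<le> exp (2 * \<bar>Im z\<bar>) * K" using \<open>K \<ge> 0\<close> by simp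
    also have "\<dots> = (sqrt K * exp \<bar>Im z\<bar>)\<^sup>2"
      using \<open>K \<ge> 0\<close> by (simp add: power_mult_distrib exp_double)
    finally have "(norm (bessel_fun m z) * sqrt t)\<^sup>2 \<le> (sqrt K * exp \<bar>Im z\<bar>)\<^sup>2"
      using t by (simp add: power_mult_distrib)
    then have "norm (bessel_fun m z) * sqrt t \<le> sqrt K * exp \<bar>Im z\<bar>"
      by (rule power2_le_imp_le) (use \<open>K \<ge> 0\<close> in auto)
    also have "\<dots> \<le> (sqrt K + 1) * exp \<bar>Im z\<bar>" by (simp add: algebra_simps)
    finally show "norm (bessel_fun m z) * sqrt (norm z) \<le> (sqrt K + 1) * exp \<bar>Im z\<bar>"
      by (simp add: t_def)
  qed
qed

section \<open>A Jensen inequality\<close>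

text \<open>The sum has period \<pi>/p in \<theta>, so \<theta> can be moved into [0, \<pi>/p],
  where no sine is negative. Multiplying by 2 sin \<alpha> with \<alpha> = \<pi>/(2p) makes the sum
  telescope into cosines, with total 2 cos (\<theta> - \<alpha>).\<close>

lemma sum_abs_sin_equidistant_le:
  fixes \<theta> :: real and p :: nat
  assumes "p > 0"
  shows "(\<Sum>l<p. \<bar>sin (\<theta> + pi * l / p)\<bar>) \<le> 1 / sin (pi / (2 * p))"
proof -
  define S where "S = (\<lambda>\<theta>. \<Sum>l<p. \<bar>sin (\<theta> + pi * l / p)\<bar>)"
  have step: "S (\<theta> + pi / p) = S \<theta>" for \<theta>
  proof -
    define f where "f = (\<lambda>l. \<bar>sin (\<theta> + pi * real l / p)\<bar>)"
    have "S (\<theta> + pi / p) = (\<Sum>l<p. f (Suc l))"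
      unfolding S_def f_def by (intro sum.cong refl) (simp add: field_simps)
    also have "f 0 + \<dots> = (\<Sum>l<p. f l) + f p"
      by (metis sum.lessThan_Suc sum.lessThan_Suc_shift)
    also have "f p = f 0" using assms by (simp add: f_def sin_add)
    finally show ?thesis by (simp add: S_def f_def)
  qed
  have steps: "S (\<theta> + real n * (pi / p)) = S \<theta>" for n \<theta>
  proof (induction n)
    case (Suc n)
    then show ?case using step[of "\<theta> + real n * (pi / p)"] by (simp add: algebra_simps add_divide_distrib)
  qed simp
  define k where "k = \<lfloor>\<theta> * p / pi\<rfloor>"
  define \<theta>' where "\<theta>' = \<theta> - of_int k * (pi / p)"
  have "S \<theta> = S \<theta>'"
  proof (cases "k \<ge> 0")
    case True
    then show ?thesis using steps[of \<theta>' "nat k"] by (simp add: \<theta>'_def)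
  next
    case False
    then show ?thesis using steps[of \<theta> "nat (- k)"] by (simp add: \<theta>'_def)
  qed
  have \<theta>': "0 \<le> \<theta>'" "\<theta>' \<le> pi / p"
  proof -
    have "of_int k \<le> \<theta> * p / pi" "\<theta> * p / pi \<le> of_int k + 1" unfolding k_def by linarith+
    then have "of_int k * pi \<le> \<theta> * p" "\<theta> * p \<le> of_int k * pi + pi" by (simp_all add: field_simps)
    then have "of_int k * pi / p \<le> \<theta>" "\<theta> \<le> (of_int k * pi + pi) / p"
      using assms by (simp_all add: pos_le_divide_eq pos_divide_le_eq)
    then show "0 \<le> \<theta>'" "\<theta>' \<le> pi / p" by (simp_all add: \<theta>'_def add_divide_distrib)
  qed
  define \<alpha> where "\<alpha> = pi / (2 * p)"
  have \<alpha>: "sin \<alpha> > 0"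
    unfolding \<alpha>_def using assms by (intro sin_gt_zero) (auto simp: field_simps)
  define c where "c = (\<lambda>l. cos (\<theta>' + 2 * \<alpha> * real l - \<alpha>))"
  have "S \<theta>' = (\<Sum>l<p. sin (\<theta>' + 2 * \<alpha> * real l))"
    unfolding S_def
  proof (rule sum.cong[OF refl])
    fix l assume "l \<in> {..<p}"
    then have "pi * real (l + 1) \<le> pi * p" by (intro mult_left_mono) auto
    then have "pi * real (l + 1) / p \<le> pi" using assms by (simp add: pos_divide_le_eq)
    then have "\<theta>' + pi * l / p \<le> pi" using \<theta>'(2) by (simp add: distrib_left add_divide_distrib)
    moreover have "0 \<le> \<theta>' + pi * l / p" using \<theta>'(1) by simp
    ultimately show "\<bar>sin (\<theta>' + pi * l / p)\<bar> = sin (\<theta>' + 2 * \<alpha> * real l)"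
      by (simp add: sin_ge_zero \<alpha>_def)
  qed
  also have "\<dots> * (2 * sin \<alpha>) = (\<Sum>l<p. c l - c (Suc l))"
    unfolding sum_distrib_right
  proof (rule sum.cong[OF refl])
    fix l
    have "\<theta>' + 2 * \<alpha> * real (Suc l) - \<alpha> = (\<theta>' + 2 * \<alpha> * real l) + \<alpha>"
      by (simp add: algebra_simps)
    then show "sin (\<theta>' + 2 * \<alpha> * real l) * (2 * sin \<alpha>) = c l - c (Suc l)"
      unfolding c_def by (simp add: cos_diff cos_add)
  qed
  also have "\<dots> = c 0 - c p" by (rule sum_lessThan_telescope')
  also have "c p = - c 0"
  proof -
    have "\<theta>' + 2 * \<alpha> * real p - \<alpha> = (\<theta>' - \<alpha>) + pi" using assms by (simp add: \<alpha>_def)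
    then have "c p = - cos (\<theta>' - \<alpha>)" by (simp only: c_def cos_periodic_pi)
    then show ?thesis by (simp add: c_def)
  qed
  also have "c 0 - - c 0 \<le> 2" unfolding c_def by simp
  finally have "S \<theta>' * sin \<alpha> \<le> 1" by simp
  then show ?thesis using \<open>S \<theta> = S \<theta>'\<close> \<alpha> by (simp add: S_def \<alpha>_def field_simps)
qed

text \<open>For each zero a, the factor z - a is replaced by (R^2 - cnj a z) / R. The two have the
  same modulus on the circle |z| = R, while at 0 the modulus changes by R / |a|.\<close>

lemma blaschke_replacement:
  fixes f :: "complex \<Rightarrow> complex"
  assumes "finite S" "f holomorphic_on UNIV" "R > 0" "\<And>a. a \<in> S \<Longrightarrow> f a = 0 \<and> a \<noteq> 0"
  shows "\<exists>F. F holomorphic_on UNIV \<and> (\<forall>z. norm z = R \<longrightarrow> norm (F z) = norm (f z))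
    \<and> norm (F 0) = norm (f 0) * (\<Prod>a\<in>S. R / norm a)"
  using assms(1,2,4)
proof (induction S arbitrary: f rule: finite_induct)
  case empty
  then show ?case by (intro exI[of _ f]) auto
next
  case (insert a S)
  have a: "f a = 0" "a \<noteq> 0" using insert.prems by auto
  define f1 where "f1 = (\<lambda>z. if z = a then deriv f a else f z / (z - a))"
  define f2 where "f2 = (\<lambda>z. f1 z * ((of_real R)\<^sup>2 - cnj a * z) / of_real R)"
  have "f1 holomorphic_on UNIV"
    using pole_lemma_open[OF insert.prems(1), of a] a by (simp add: f1_def cong: if_cong)
  then have "f2 holomorphic_on UNIV" unfolding f2_def using \<open>R > 0\<close> by (intro holomorphic_intros) auto
  moreover have "f2 b = 0 \<and> b \<noteq> 0" if "b \<in> S" for b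
    using insert.prems(2)[of b] that insert.hyps by (auto simp: f2_def f1_def)
  ultimately obtain F where F: "F holomorphic_on UNIV" "\<And>z. norm z = R \<Longrightarrow> norm (F z) = norm (f2 z)"
    "norm (F 0) = norm (f2 0) * (\<Prod>a\<in>S. R / norm a)" using insert.IH[of f2] by auto
  have "norm (f2 z) = norm (f z)" if z: "norm z = R" for z
  proof (cases "z = a")
    case True
    then have "(of_real R)\<^sup>2 = cnj a * z"
      using z complex_norm_square[of z] by (simp add: mult.commute)
    then show ?thesis using True a by (simp add: f2_def)
  next
    case False
    have "(of_real R)\<^sup>2 - cnj a * z = z * cnj (z - a)"
      using z complex_norm_square[of z] by (simp add: algebra_simps)
    then have "norm ((of_real R)\<^sup>2 - cnj a * z) = R * norm (z - a)"
      by (simp only: norm_mult complex_mod_cnj z)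
    then show ?thesis using False \<open>R > 0\<close> by (simp add: f2_def f1_def norm_mult norm_divide)
  qed
  moreover have "norm (f2 0) = norm (f 0) * (R / norm a)"
    using a \<open>R > 0\<close> by (simp add: f2_def f1_def norm_mult norm_divide power2_eq_square)
  ultimately show ?case using F insert.hyps by (intro exI[of _ F]) (auto simp: mult.assoc)
qed

text \<open>Instead of the mean value of the logarithm over the circle, average over \<open>2p\<close> equidistant
  rotations by multiplying, apply the maximum principle, and let \<open>p \<rightarrow> \<infinity>\<close>.\<close>

lemma entire_norm_0_le_exp_mean:
  fixes F :: "complex \<Rightarrow> complex"
  assumes hol: "F holomorphic_on UNIV" and R: "R > 0"
    and bd: "\<And>z. norm z = R \<Longrightarrow> norm (F z) \<le> M * exp \<bar>Im z\<bar>"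
  shows "norm (F 0) \<le> M * exp (2 * R / pi)"
proof -
  have M: "M \<ge> 0"
  proof -
    have "0 \<le> norm (F (of_real R))" by simp
    also have "\<dots> \<le> M" using bd[of "of_real R"] R by simp
    finally show ?thesis .
  qed
  have bound: "norm (F 0) \<le> M * exp (R / (p * sin (pi / (2 * p))))" if p: "p > 0" for p :: nat
  proof -
    let ?B = "M * exp (R / (p * sin (pi / (2 * p))))"
    define w where "w = (\<lambda>l. cis (pi * real l / p))"
    \<comment> \<open>Opposite points share the bound because |Im| is even, so the 2p factors lead
      to a sum over p angles in a half turn.\<close>
    define G where "G = (\<lambda>z. \<Prod>l<p. F (z * w l) * F (- (z * w l)))"
    have Fg: "(\<lambda>z. F (g z)) holomorphic_on UNIV" if "g holomorphic_on UNIV" for g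
      using holomorphic_on_compose_gen[OF that hol] by (auto simp: o_def)
    have "G holomorphic_on UNIV" unfolding G_def by (intro holomorphic_intros Fg)
    then have G: "G holomorphic_on X" for X using holomorphic_on_subset by blast
    have "norm (G 0) \<le> ?B ^ (2 * p)"
    proof (rule maximum_modulus_frontier[of G "ball 0 R"])
      fix z :: complex assume "z \<in> frontier (ball 0 R)"
      then have z: "norm z = R" using R by simp
      have zw: "norm (z * w l) = R" for l using z by (simp add: w_def norm_mult)
      have im: "Im (z * w l) = R * sin (Arg z + pi * real l / p)" for l
      proof -
        have "z = of_real R * cis (Arg z)" using z by (metis rcis_cmod_Arg rcis_def)
        then have "z * w l = of_real R * (cis (Arg z) * cis (pi * real l / p))" by (simp add: w_def)
        then show ?thesis by (simp add: cis_mult)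
      qed
      have "norm (G z) = (\<Prod>l<p. norm (F (z * w l)) * norm (F (- (z * w l))))"
        unfolding G_def by (simp add: norm_mult flip: prod_norm)
      also have "\<dots> \<le> (\<Prod>l<p. (M * exp \<bar>Im (z * w l)\<bar>) * (M * exp \<bar>Im (z * w l)\<bar>))"
      proof (intro prod_mono conjI mult_mono mult_nonneg_nonneg norm_ge_zero)
        show "norm (F (z * w l)) \<le> M * exp \<bar>Im (z * w l)\<bar>" for l by (rule bd[OF zw])
        have "norm (- (z * w l)) = R" for l by (simp only: norm_minus_cancel zw)
        from bd[OF this] show "norm (F (- (z * w l))) \<le> M * exp \<bar>Im (z * w l)\<bar>" for l
          by (simp only: uminus_complex.sel abs_minus_cancel)
      qed (use M in simp_all)
      also have "\<dots> = (\<Prod>l<p. M\<^sup>2 * exp (2 * R * \<bar>sin (Arg z + pi * real l / p)\<bar>))"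
      proof (rule prod.cong[OF refl])
        fix l
        have "\<bar>Im (z * w l)\<bar> = R * \<bar>sin (Arg z + pi * real l / p)\<bar>"
          unfolding im using R by (simp add: abs_mult)
        moreover have "M * exp x * (M * exp x) = M\<^sup>2 * exp (2 * x)" for x :: real
          by (simp add: exp_double power2_eq_square)
        ultimately show "M * exp \<bar>Im (z * w l)\<bar> * (M * exp \<bar>Im (z * w l)\<bar>)
          = M\<^sup>2 * exp (2 * R * \<bar>sin (Arg z + pi * real l / p)\<bar>)"
          by (simp only: mult.assoc)
      qed
      also have "\<dots> = M ^ (2 * p) * exp (2 * R * (\<Sum>l<p. \<bar>sin (Arg z + pi * real l / p)\<bar>))"
        by (simp add: prod.distrib exp_sum sum_distrib_left power_mult)
      also have "\<dots> \<le> M ^ (2 * p) * exp (2 * R * (1 / sin (pi / (2 * p))))"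
      proof -
        have "2 * R * (\<Sum>l<p. \<bar>sin (Arg z + pi * real l / p)\<bar>) \<le> 2 * R * (1 / sin (pi / (2 * p)))"
          using R sum_abs_sin_equidistant_le[OF p, of "Arg z"] by (intro mult_left_mono) auto
        then show ?thesis using M by (intro mult_left_mono) (simp_all only: exp_le_cancel_iff zero_le_power)
      qed
      also have "\<dots> = ?B ^ (2 * p)"
        using p by (simp add: power_mult_distrib flip: exp_of_nat_mult)
      finally show "norm (G z) \<le> ?B ^ (2 * p)" .
    qed (use G R holomorphic_on_imp_continuous_on in auto)
    moreover have "norm (G 0) = norm (F 0) ^ (2 * p)"
      unfolding G_def by (simp add: norm_mult norm_power power_mult power2_eq_square)
    ultimately show ?thesis
      using p M power_mono_iff[of "norm (F 0)" ?B "2 * p"] by simp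
  qed
  \<comment> \<open>The limit 2/\<pi> of 1 / (p sin (\<pi>/(2p))) is the mean of |sin|.\<close>
  have "(\<lambda>p::nat. M * exp (R / (p * sin (pi / (2 * p))))) \<longlonglongrightarrow> M * exp (R / (pi / 2))"
  proof (intro tendsto_intros)
    show "(\<lambda>p::nat. p * sin (pi / (2 * p))) \<longlonglongrightarrow> pi / 2" by real_asymp
  qed auto
  then have "norm (F 0) \<le> M * exp (R / (pi / 2))"
    by (rule tendsto_lowerbound) (use bound in \<open>auto simp: eventually_at_top_linorder intro!: exI[of _ 1]\<close>)
  then show ?thesis by (simp add: mult.commute)
qed

text \<open>2R/\<pi> is the mean of |Im z| over the circle |z| = R; the Blaschke factors transfer
  the zeros to the value at 0.\<close>

lemma jensen_inequality_sine_type: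
  fixes f :: "complex \<Rightarrow> complex"
  assumes "finite S" "f holomorphic_on UNIV" "R > 0" "\<And>a. a \<in> S \<Longrightarrow> f a = 0 \<and> a \<noteq> 0"
    and "\<And>z. norm z = R \<Longrightarrow> norm (f z) \<le> M * exp \<bar>Im z\<bar>"
  shows "norm (f 0) * (\<Prod>a\<in>S. R / norm a) \<le> M * exp (2 * R / pi)"
proof -
  obtain F where F: "F holomorphic_on UNIV" "\<And>z. norm z = R \<Longrightarrow> norm (F z) = norm (f z)"
    "norm (F 0) = norm (f 0) * (\<Prod>a\<in>S. R / norm a)"
    using blaschke_replacement[OF assms(1-4)] by auto
  show ?thesis
    unfolding F(3)[symmetric] by (rule entire_norm_0_le_exp_mean[OF F(1) assms(3)]) (simp add: F(2) assms(5))
qed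

section \<open>Phase bound for the zeros\<close>

text \<open>A Stirling bound; the induction step is 1 <= (x + 1/2) (ln (x + 1) - ln x). The 1/2 in
  the coefficient of the logarithm has to be sharp, because it enters the constant 1/4 of the phase
  bound.\<close>

lemma sum_ln_le:
  fixes y :: real and N :: nat
  assumes "y > 0"
  shows "(\<Sum>n<N. ln (y + n + 1)) \<le> (y + N + 1/2) * ln (y + N) - N - (y + 1/2) * ln y"
proof (induction N)
  case (Suc N)
  define x where "x = y + N"
  have x: "x > 0" using assms by (simp add: x_def)
  have "2 * (x + 1 - x) / (x + (x + 1)) \<le> ln (x + 1) - ln x"
    by (rule ln_inverse_approx_ge) (use x in auto)
  then have "1 \<le> (x + 1/2) * (ln (x + 1) - ln x)" using x by (simp add: field_simps)
  then have "ln (x + 1) \<le> (x + 1 + 1/2) * ln (x + 1) - 1 - (x + 1/2) * ln x"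
    by (simp add: algebra_simps)
  then show ?case using Suc by (simp add: x_def algebra_simps)
qed simp

text \<open>If the phase at \<open>l\<close> were too small, the zeros beyond \<open>l\<close> produced by Sturm comparison would
  be so dense that Jensen's inequality contradicts the growth of \<open>J\<^sub>m\<close>.\<close>

lemma bessel_zeros_phase:
  fixes l :: real
  assumes S: "finite S" "S \<noteq> {}" and zeros: "\<And>x. x \<in> S \<Longrightarrow> 0 < x \<and> x \<le> l \<and> bessel_series m (x\<^sup>2) = 0"
  shows "real m < l \<and> (real (card S) - 1 / 4) * pi \<le> bessel_phase m l"
proof -
  define k where "k = card S"
  have ml: "real m < l"
  proof -
    obtain x where x: "x \<in> S" using S by auto
    have "\<not> x \<le> m" using bessel_series_nonzero_below_order[of x m] zeros[OF x] by auto
    then show ?thesis using zeros[OF x] by linarith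
  qed
  then have l0: "l > 0" by linarith
  have "(real k - 1 / 4) * pi \<le> bessel_phase m l"
  proof (rule ccontr)
    assume neg: "\<not> ?thesis"
    define \<phi> where "\<phi> = bessel_phase m l / pi"
    define c where "c = \<phi> - k + m / 2"
    define y where "y = k + c"
    have "\<phi> < real k - 1 / 4" using neg by (simp add: \<phi>_def field_simps)
    \<comment> \<open>With \<phi> the phase divided by \<pi>, this number is 2 (k - 1/4 - \<phi>),
      positive by the assumption to be refuted. It becomes the coefficient of
      \<open>ln (y + N)\<close> below, which is unbounded in N.\<close>
    then have c: "0 < real m - 1 / 2 - 2 * c" unfolding c_def by (simp add: algebra_simps)
    have ypi: "y * pi = bessel_phase m l + m * pi / 2" by (simp add: y_def c_def \<phi>_def field_simps)
    then have ly: "l \<le> y * pi" using bessel_phase_lower[OF ml] by simp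
    then have "0 < y * pi" using l0 by linarith
    then have y: "y > 0" by (simp add: zero_less_mult_iff)
    obtain z :: "nat \<Rightarrow> real" where z: "\<And>n. bessel_series m ((z n)\<^sup>2) = 0" "\<And>n. l < z n" "inj z"
      "\<And>n. z n \<le> bessel_phase m l + (n + 1) * pi + m * pi / 2"
      by (rule bessel_zero_sequence[OF ml]) (rule that)
    have z': "z n \<le> (y + n + 1) * pi" for n using z(4)[of n] ypi by (simp add: algebra_simps)
    obtain C where C: "C > 0"
      "\<And>w::complex. 1 \<le> norm w \<Longrightarrow> norm (bessel_fun m w) * sqrt (norm w) \<le> C * exp \<bar>Im w\<bar>"
      by (rule bessel_fun_growth) (rule that)
    have key: "(m - 1/2 - 2 * c) * ln (y + N) \<le> ln C - (m + 1/2) * ln pi + 2 * k * ln y - (2 * y + 1) * ln y + 2 * y"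
      if N: "N \<ge> 1" for N :: nat
    proof -
      define x where "x = y + N"
      \<comment> \<open>The zero \<open>z n\<close> is at most (y + n + 1) \<pi>, so this circle
        reaches the first N of them. Also 2R/\<pi> = 2x, which cancels the linear term 2N of
        Stirling's formula up to a constant.\<close>
      define R where "R = x * pi"
      have x: "x > 1" "x > 0" using y N by (auto simp: x_def)
      have R: "R > 0" "R \<ge> 1" using x pi_gt3 mult_mono[of 1 x 1 pi] by (auto simp: R_def)
      define T where "T = S \<union> z ` {..<N}"
      have disj: "S \<inter> z ` {..<N} = {}" 
      proof (rule equals0I)
        fix x assume "x \<in> S \<inter> z ` {..<N}"
        then obtain n where "z n \<in> S" by auto
        then show False using zeros[of "z n"] z(2)[of n] by linarith
      qed
      have T: "finite T" "\<And>t. t \<in> T \<Longrightarrow> t > 0 \<and> bessel_series m (t\<^sup>2) = 0"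
      proof -
        show "finite T" using S by (simp add: T_def)
        fix t assume "t \<in> T"
        then consider "t \<in> S" | n where "t = z n" by (auto simp: T_def)
        then show "t > 0 \<and> bessel_series m (t\<^sup>2) = 0"
        proof cases
          case (2 n)
          then show ?thesis using z(1)[of n] z(2)[of n] l0 by simp
        qed (use zeros in auto)
      qed
      have absT: "\<bar>t\<bar> = t" if "t \<in> T" for t using T(2)[OF that] by simp
      \<comment> \<open>The function w |-> \<open>bessel_series m (w^2)\<close> is even, so every
        positive zero counts twice.\<close>
      define T' where "T' = (of_real ` T :: complex set) \<union> (\<lambda>t. - of_real t) ` T"
      define M where "M = C / (R ^ m * sqrt R)"
      have "norm ((\<lambda>w. bessel_series m (w\<^sup>2)) (0::complex)) * (\<Prod>a\<in>T'. R / norm a) \<le> M * exp (2 * R / pi)"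
      proof (rule jensen_inequality_sine_type)
        show "finite T'" using T by (simp add: T'_def)
        have "((\<lambda>w. bessel_series m (w\<^sup>2)) has_field_derivative
            - bessel_series (Suc m) (w\<^sup>2) / (4 * (of_nat m + 1)) * (2 * w)) (at w)" for w :: complex
          by (rule DERIV_chain2[OF bessel_series_deriv]) (auto intro!: derivative_eq_intros)
        then show "(\<lambda>w. bessel_series m (w\<^sup>2)) holomorphic_on (UNIV :: complex set)"
          unfolding holomorphic_on_open[OF open_UNIV] by blast
        show "R > 0" by fact
        have "bessel_series m ((of_real t)\<^sup>2) = (0::complex)" if "t \<in> T" for t
          using T(2)[OF that] bessel_series_of_real[of m "t\<^sup>2", where 'a=complex] by simp
        then show "bessel_series m (a\<^sup>2) = 0 \<and> a \<noteq> 0" if "a \<in> T'" for a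
          using that T(2)[of 0] by (auto simp: T'_def)
        fix w :: complex assume w: "norm w = R"
        have "norm (bessel_series m (w\<^sup>2)) * (R ^ m * sqrt R) = norm (bessel_fun m w) * sqrt (norm w)"
          by (simp add: bessel_fun_def norm_mult norm_power w)
        also have "\<dots> \<le> C * exp \<bar>Im w\<bar>" using C(2)[of w] w R by simp
        finally show "norm (bessel_series m (w\<^sup>2)) \<le> M * exp \<bar>Im w\<bar>"
          using R by (simp add: M_def field_simps)
      qed
      also have "(\<Prod>a\<in>T'. R / norm a) = (\<Prod>t\<in>T. R / t)\<^sup>2"
      proof -
        have "(\<Prod>a\<in>T'. R / norm a) = (\<Prod>a\<in>of_real ` T. R / norm (a::complex)) * (\<Prod>a\<in>(\<lambda>t. - of_real t) ` T. R / norm (a::complex))"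
          unfolding T'_def
        proof (rule prod.union_disjoint)
          show "of_real ` T \<inter> (\<lambda>t. - of_real t :: complex) ` T = {}"
          proof (rule ccontr)
            assume "of_real ` T \<inter> (\<lambda>t. - of_real t :: complex) ` T \<noteq> {}"
            then obtain a :: complex where "a \<in> of_real ` T" and a: "a \<in> (\<lambda>t. - of_real t) ` T" by blast
            then obtain s where st: "s \<in> T" "a = of_real s" by blast
            from a obtain t where t: "t \<in> T" "a = - of_real t" by blast
            have "s = - t" using arg_cong[OF st(2), of Re] arg_cong[OF t(2), of Re] by simp
            then show False using T(2)[OF st(1)] T(2)[OF t(1)] by simp
          qed
        qed (use T in auto)
        also have "(\<Prod>a\<in>of_real ` T. R / norm (a::complex)) = (\<Prod>t\<in>T. R / t)"
          by (subst prod.reindex) (auto simp: inj_on_def absT intro!: prod.cong)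
        also have "(\<Prod>a\<in>(\<lambda>t. - of_real t) ` T. R / norm (a::complex)) = (\<Prod>t\<in>T. R / t)"
          by (subst prod.reindex) (auto simp: inj_on_def absT intro!: prod.cong)
        finally show ?thesis by (simp add: power2_eq_square)
      qed
      also have "2 * R / pi = 2 * x" by (simp add: R_def)
      finally have J: "(\<Prod>t\<in>T. R / t)\<^sup>2 \<le> M * exp (2 * x)" by simp
      \<comment> \<open>Each zero is replaced by an upper bound: y \<pi> for the k zeros in
        \<open>S\<close>, which are at most l, and (y + n + 1) \<pi> for \<open>z n\<close>.\<close>
      define Q where "Q = (x / y) ^ k * (\<Prod>n<N. x / (y + n + 1))"
      have Q: "Q > 0" unfolding Q_def using x y by (intro mult_pos_pos prod_pos) auto
      have "Q \<le> (\<Prod>t\<in>S. R / t) * (\<Prod>n<N. R / z n)"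
        unfolding Q_def
      proof (rule mult_mono)
        have "(x / y) ^ k = (\<Prod>t\<in>S. x / y)" by (simp add: k_def)
        also have "\<dots> \<le> (\<Prod>t\<in>S. R / t)"
        proof (intro prod_mono conjI)
          fix t assume "t \<in> S"
          then have "0 < t" "t \<le> y * pi" using zeros ly order_trans by auto
          then have "R / (y * pi) \<le> R / t" using R by (intro divide_left_mono) auto
          then show "x / y \<le> R / t" by (simp add: R_def)
        qed (use x y in auto)
        finally show "(x / y) ^ k \<le> (\<Prod>t\<in>S. R / t)" .
        show "(\<Prod>n<N. x / (y + n + 1)) \<le> (\<Prod>n<N. R / z n)"
        proof (intro prod_mono conjI)
          fix n
          have "0 < z n" using z(2)[of n] l0 by linarith
          then have "R / ((y + n + 1) * pi) \<le> R / z n" using R z'[of n] y by (intro divide_left_mono) auto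
          then show "x / (y + n + 1) \<le> R / z n" by (simp add: R_def)
        qed (use x y in auto)
        show "0 \<le> (\<Prod>t\<in>S. R / t)" using zeros R by (intro prod_nonneg) (auto simp: less_imp_le)
        show "0 \<le> (\<Prod>n<N. x / (y + n + 1))" using x y by (intro prod_nonneg) auto
      qed
      also have "\<dots> = (\<Prod>t\<in>T. R / t)"
        unfolding T_def using S disj z(3)
        by (subst prod.union_disjoint) (auto simp: prod.reindex inj_on_def)
      finally have "Q\<^sup>2 \<le> (\<Prod>t\<in>T. R / t)\<^sup>2" using Q by (intro power_mono) auto
      also note J
      finally have "ln (Q\<^sup>2) \<le> ln (M * exp (2 * x))"
        using Q by (intro ln_mono) auto
      also have "\<dots> = ln M + 2 * x" using C R by (subst ln_mult) (auto simp: M_def)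
      also have "ln M = ln C - (m * ln R + ln R / 2)"
        unfolding M_def using C R by (simp add: ln_div ln_mult ln_realpow ln_sqrt)
      also have "ln R = ln x + ln pi" unfolding R_def using x by (simp add: ln_mult)
      also have "ln (Q\<^sup>2) = 2 * ln Q" using Q by (simp add: ln_realpow)
      also have "ln Q = k * (ln x - ln y) + (\<Sum>n<N. ln x - ln (y + n + 1))"
      proof -
        have "(\<Prod>n<N. x / (y + n + 1)) > 0" using x y by (intro prod_pos) auto
        moreover have "ln (\<Prod>n<N. x / (y + n + 1)) = (\<Sum>n<N. ln (x / (y + n + 1)))"
          using x y by (intro ln_prod) auto
        moreover have "\<dots> = (\<Sum>n<N. ln x - ln (y + n + 1))"
          using x y by (intro sum.cong refl) (simp add: ln_div add_pos_nonneg)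
        ultimately show ?thesis unfolding Q_def using x y by (simp add: ln_mult ln_realpow ln_div)
      qed
      also have "(\<Sum>n<N. ln x - ln (y + n + 1)) = N * ln x - (\<Sum>n<N. ln (y + n + 1))"
        by (simp add: sum_subtractf)
      finally have "2 * (k * (ln x - ln y) + (N * ln x - (\<Sum>n<N. ln (y + n + 1))))
        \<le> ln C - (m * (ln x + ln pi) + (ln x + ln pi) / 2) + 2 * x" .
      moreover have "(\<Sum>n<N. ln (y + n + 1)) \<le> (x + 1/2) * ln x - N - (y + 1/2) * ln y"
        using sum_ln_le[OF y, of N] by (simp add: x_def)
      ultimately have "2 * (k * (ln x - ln y) + (N * ln x - ((x + 1/2) * ln x - N - (y + 1/2) * ln y)))
        \<le> ln C - (m * (ln x + ln pi) + (ln x + ln pi) / 2) + 2 * x" by argo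
      moreover have Nx: "real N = x - y" by (simp add: x_def)
      moreover have ck: "c = y - k" by (simp add: y_def)
      \<comment> \<open>With N = x - y the terms linear in x cancel. The coefficient of ln x is 2 (k
        - y) - 1 on the left and -(m + 1/2) on the right, and k - y = -c.\<close>
      ultimately show ?thesis
        unfolding x_def[symmetric] ck by (simp add: algebra_simps add_divide_distrib)
    qed
    define B where "B = ln C - (m + 1/2) * ln pi + 2 * k * ln y - (2 * y + 1) * ln y + 2 * y"
    obtain N :: nat where N: "exp (B / (m - 1/2 - 2 * c) + 1) < N" using reals_Archimedean2 by blast
    then have N1: "N \<ge> 1" using less_trans[OF exp_gt_zero N] by simp
    have "B / (m - 1/2 - 2 * c) + 1 = ln (exp (B / (m - 1/2 - 2 * c) + 1))" by simp
    also have "\<dots> \<le> ln (y + N)" using N y by (intro ln_mono) (auto intro: add_pos_nonneg)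
    finally have "B / (m - 1/2 - 2 * c) < ln (y + N)" by simp
    then have "B < (m - 1/2 - 2 * c) * ln (y + N)" using c by (simp add: pos_divide_less_eq mult.commute)
    with key[OF N1] show False by (simp add: B_def)
  qed
  with ml show ?thesis by (simp add: k_def)
qed

section \<open>Lattice points under the phase curve\<close>

locale disk_lattice =
  fixes l :: real
  assumes l_pos: "l > 0"
begin

text \<open>The curve \<open>y = \<phi>\<^sub>z(l) / \<pi>\<close>, \<open>0 \<le> z \<le> l\<close>, parametrised by \<open>z = l cos \<beta>\<close>, with \<open>area\<close> the integral
  of \<open>z dy\<close>.\<close>

definition zc :: "real \<Rightarrow> real" where "zc \<beta> = l * cos \<beta>"
definition yc :: "real \<Rightarrow> real" where "yc \<beta> = l / pi * (sin \<beta> - \<beta> * cos \<beta>)"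
definition area :: "real \<Rightarrow> real" where
  "area \<beta> = l\<^sup>2 / pi * (sin \<beta> * cos \<beta> / 4 - \<beta> * ((cos \<beta>)\<^sup>2 - (sin \<beta>)\<^sup>2) / 4)"

lemma yc_deriv: "(yc has_real_derivative l / pi * (\<beta> * sin \<beta>)) (at \<beta> within A)"
  unfolding yc_def by (auto intro!: derivative_eq_intros)

lemma zc_deriv: "(zc has_real_derivative - (l * sin \<beta>)) (at \<beta> within A)"
  unfolding zc_def by (auto intro!: derivative_eq_intros)

lemma area_deriv: "(area has_real_derivative zc \<beta> * (l / pi * (\<beta> * sin \<beta>))) (at \<beta> within A)"
proof -
  have 1: "(area has_real_derivative l\<^sup>2 / pi * (((cos \<beta>)\<^sup>2 - (sin \<beta>)\<^sup>2) / 4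
     - (((cos \<beta>)\<^sup>2 - (sin \<beta>)\<^sup>2) / 4 - \<beta> * sin \<beta> * cos \<beta>))) (at \<beta> within A)"
    unfolding area_def by (auto intro!: derivative_eq_intros simp: power2_eq_square field_simps)
  then show ?thesis by (rule DERIV_cong) (simp add: zc_def power2_eq_square)
qed

lemma yc_continuous: "continuous_on A yc"
  unfolding yc_def by (intro continuous_intros)

text \<open>The total area l^2/8 for m >= 0 becomes the leading term l^2/4 once both signs of m are
  counted.\<close>

lemma yc_0 [simp]: "yc 0 = 0" and yc_pi_half [simp]: "yc (pi / 2) = l / pi"
  and area_0 [simp]: "area 0 = 0" and area_pi_half [simp]: "area (pi / 2) = l\<^sup>2 / 8"
  and zc_pi_half [simp]: "zc (pi / 2) = 0"
  by (simp_all add: yc_def area_def zc_def)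

lemma yc_strict_mono:
  assumes "0 \<le> a" "a < b" "b \<le> pi / 2"
  shows "yc a < yc b"
proof (rule DERIV_pos_imp_increasing_open[OF assms(2)])
  fix x assume x: "a < x" "x < b"
  then have "sin x > 0" using assms by (intro sin_gt_zero) (use pi_gt_zero in linarith)+
  then have "l / pi * (x * sin x) > 0" using l_pos x assms by simp
  then show "\<exists>d. (yc has_real_derivative d) (at x) \<and> d > 0" using yc_deriv by blast
qed (rule yc_continuous)

lemma yc_mono: "0 \<le> a \<Longrightarrow> a \<le> b \<Longrightarrow> b \<le> pi / 2 \<Longrightarrow> yc a \<le> yc b"
  using yc_strict_mono[of a b] by (cases "a = b") auto

lemma yc_le_imp_le:
  assumes "yc a \<le> yc b" "0 \<le> b" "a \<le> pi / 2"
  shows "a \<le> b"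
  using yc_strict_mono[of b a] assms by (cases "a \<le> b") auto

definition angle :: "real \<Rightarrow> real" where
  "angle y = (SOME \<beta>. 0 \<le> \<beta> \<and> \<beta> \<le> pi / 2 \<and> yc \<beta> = y)"

lemma angle:
  assumes "0 \<le> y" "y \<le> l / pi"
  shows "0 \<le> angle y" "angle y \<le> pi / 2" "yc (angle y) = y"
proof -
  have "\<exists>\<beta>. 0 \<le> \<beta> \<and> \<beta> \<le> pi / 2 \<and> yc \<beta> = y"
    by (rule IVT') (use assms yc_continuous in auto)
  then have "0 \<le> angle y \<and> angle y \<le> pi / 2 \<and> yc (angle y) = y"
    unfolding angle_def by (rule someI_ex)
  then show "0 \<le> angle y" "angle y \<le> pi / 2" "yc (angle y) = y" by auto
qed

lemma angle_yc:
  assumes "0 \<le> \<beta>" "\<beta> \<le> pi / 2"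
  shows "angle (yc \<beta>) = \<beta>"
proof -
  have y: "0 \<le> yc \<beta>" "yc \<beta> \<le> l / pi"
    using yc_mono[of 0 \<beta>] yc_mono[of \<beta> "pi / 2"] assms by simp_all
  show ?thesis
    using yc_le_imp_le[of "angle (yc \<beta>)" \<beta>] yc_le_imp_le[of \<beta> "angle (yc \<beta>)"] angle[OF y] assms by auto
qed

text \<open>The curve \<open>(zc \<beta>, yc \<beta>)\<close> is convex with slope \<open>dz/dy = - pi / \<beta>\<close>.\<close>

lemma above_tangent_deriv:
  "((\<lambda>\<beta>. zc \<beta> + pi / \<beta>\<^sub>0 * (yc \<beta> - c)) has_real_derivative l * sin \<beta> * (\<beta> / \<beta>\<^sub>0 - 1)) (at \<beta> within A)"
  by (rule derivative_eq_intros zc_deriv yc_deriv refl)+ (simp add: algebra_simps)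

text \<open>The derivative l sin \<beta> (\<beta>/\<beta>0 - 1) of the right-hand side changes sign
  from minus to plus at the point of tangency.\<close>

lemma above_tangent:
  assumes "0 \<le> \<beta>" "\<beta> \<le> pi / 2" "0 < \<beta>\<^sub>0" "\<beta>\<^sub>0 \<le> pi / 2" "\<beta> \<noteq> \<beta>\<^sub>0"
  shows "zc \<beta>\<^sub>0 < zc \<beta> + pi / \<beta>\<^sub>0 * (yc \<beta> - yc \<beta>\<^sub>0)"
proof -
  let ?E = "\<lambda>\<beta>. zc \<beta> + pi / \<beta>\<^sub>0 * (yc \<beta> - yc \<beta>\<^sub>0)"
  have cont: "continuous_on A ?E" for A
    unfolding zc_def by (intro continuous_intros yc_continuous)
  have sin: "sin x > 0" if "0 < x" "x < pi / 2" for x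
    using that pi_gt_zero by (intro sin_gt_zero) linarith+
  show ?thesis
  proof (cases "\<beta> < \<beta>\<^sub>0")
    case True
    have "?E \<beta>\<^sub>0 < ?E \<beta>"
    proof (rule DERIV_neg_imp_decreasing_open[OF True])
      fix x assume x: "\<beta> < x" "x < \<beta>\<^sub>0"
      then have "l * sin x * (x / \<beta>\<^sub>0 - 1) < 0"
        using sin[of x] assms l_pos by (intro mult_pos_neg mult_pos_pos) (auto simp: field_simps)
      then show "\<exists>y. (?E has_real_derivative y) (at x) \<and> y < 0"
        using above_tangent_deriv by blast
    qed (rule cont)
    then show ?thesis by simp
  next
    case False
    then have "\<beta>\<^sub>0 < \<beta>" using assms by simp
    then have "?E \<beta>\<^sub>0 < ?E \<beta>"
    proof (rule DERIV_pos_imp_increasing_open)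
      fix x assume x: "\<beta>\<^sub>0 < x" "x < \<beta>"
      then have "l * sin x * (x / \<beta>\<^sub>0 - 1) > 0"
        using sin[of x] assms l_pos by (intro mult_pos_pos) (auto simp: field_simps)
      then show "\<exists>y. (?E has_real_derivative y) (at x) \<and> y > 0"
        using above_tangent_deriv by blast
    qed (rule cont)
    then show ?thesis by simp
  qed
qed

text \<open>\<open>D\<close> is the area under the curve minus the area under its tangent at
  \<open>\<beta>\<^sub>0\<close>; its derivative is yc' times the height of the curve above the
  tangent.\<close>

lemma area_tangent:
  assumes "0 \<le> a" "a \<le> b" "b \<le> pi / 2" "0 < \<beta>\<^sub>0" "\<beta>\<^sub>0 \<le> pi / 2"
  defines "D \<equiv> \<lambda>\<beta>. area \<beta> - zc \<beta>\<^sub>0 * (yc \<beta> - yc \<beta>\<^sub>0) + pi / (2 * \<beta>\<^sub>0) * (yc \<beta> - yc \<beta>\<^sub>0)\<^sup>2"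
  shows "D a \<le> D b"
proof (rule DERIV_nonneg_imp_nondecreasing[OF assms(2)])
  fix x assume x: "a \<le> x" "x \<le> b"
  have "(D has_real_derivative (l / pi * (x * sin x)) * (zc x + pi / \<beta>\<^sub>0 * (yc x - yc \<beta>\<^sub>0) - zc \<beta>\<^sub>0)) (at x)"
    unfolding D_def
    apply (rule derivative_eq_intros area_deriv yc_deriv refl)+
    using assms(4) pi_gt_zero by (simp add: divide_simps) (simp add: algebra_simps)
  moreover have "zc x + pi / \<beta>\<^sub>0 * (yc x - yc \<beta>\<^sub>0) - zc \<beta>\<^sub>0 \<ge> 0"
    using above_tangent[of x \<beta>\<^sub>0] x assms by (cases "x = \<beta>\<^sub>0") auto
  moreover have "sin x \<ge> 0" using x assms pi_gt_zero by (intro sin_ge_zero) linarith+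
  then have "l / pi * (x * sin x) \<ge> 0" using l_pos x assms by simp
  ultimately show "\<exists>y. (D has_real_derivative y) (at x) \<and> 0 \<le> y"
    using mult_nonneg_nonneg by blast
qed

lemma angle_pos: "0 < y \<Longrightarrow> y \<le> l / pi \<Longrightarrow> 0 < angle y"
  using angle[of y] by (cases "angle y = 0") auto

text \<open>The tangent at the upper end y + 1/4 is used: there the curve is flattest on the
  interval, with |dz/dy| = \<pi>/b'. A quarter of 2 is 1/2, and a quarter of 3 is 3/4.\<close>

lemma zc_angle_gap:
  assumes "0 < y" "y + 1 / 4 \<le> l / pi"
  shows "zc (angle (y + 1 / 4)) + 1 / 2 < zc (angle y)"
    and "y + 1 / 4 \<le> omega0 * l \<Longrightarrow> zc (angle (y + 1 / 4)) + 3 / 4 < zc (angle y)"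
proof -
  define b b' where "b = angle y" and "b' = angle (y + 1 / 4)"
  have b: "0 \<le> b" "b \<le> pi / 2" "yc b = y" unfolding b_def using angle[of y] assms by auto
  have b': "0 < b'" "b' \<le> pi / 2" "yc b' = y + 1 / 4" unfolding b'_def
    using angle[of "y + 1/4"] angle_pos[of "y + 1/4"] assms by auto
  have gap: "zc b' < zc b + pi / b' * (y - (y + 1 / 4))"
    using above_tangent[of b b'] b b' by force
  have "pi / b' \<ge> 2" using b' by (simp add: field_simps)
  with gap show "zc (angle (y + 1 / 4)) + 1 / 2 < zc (angle y)" by (simp add: b_def b'_def)
  assume "y + 1 / 4 \<le> omega0 * l"
  \<comment> \<open>The origin of \<open>omega0\<close>: l/\<pi> (sin \<beta> - \<beta> cos \<beta>)
    at \<beta> = \<pi>/3, where the slope is -3.\<close>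
  also have "omega0 * l = yc (pi / 3)"
    by (simp add: yc_def omega0_def sin_60 cos_60 field_simps)
  finally have "b' \<le> pi / 3" using yc_le_imp_le[of b' "pi / 3"] b' by simp
  then have "pi / b' \<ge> 3" using b' by (simp add: field_simps)
  with gap show "zc (angle (y + 1 / 4)) + 3 / 4 < zc (angle y)" by (simp add: b_def b'_def)
qed

text \<open>For a full layer this is the midpoint inequality for a convex curve. The delicate case
  is the top layer, which may end at l/\<pi> before reaching k.\<close>

lemma zc_angle_le_area:
  assumes "1 \<le> k" "k - 1 / 4 \<le> l / pi"
  shows "zc (angle (k - 1 / 2)) \<le> area (angle (min k (l / pi))) - area (angle (k - 1))"
proof -
  define b where "b = angle (k - 1 / 2)"
  have b: "0 < b" "b \<le> pi / 2" "yc b = k - 1 / 2" unfolding b_def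
    using angle[of "k - 1 / 2"] angle_pos[of "k - 1 / 2"] assms by auto
  define e e' where "e = angle (k - 1)" and "e' = angle (min k (l / pi))"
  have e: "0 \<le> e" "e \<le> pi / 2" "yc e = k - 1" unfolding e_def
    using angle[of "k - 1"] assms by auto
  have e': "0 \<le> e'" "e' \<le> pi / 2" "yc e' = min k (l / pi)" unfolding e'_def
    using angle[of "min k (l / pi)"] assms l_pos by auto
  define q where "q = pi / (2 * b)"
  have "e \<le> e'" by (rule yc_le_imp_le) (use e e' assms in auto)
  from area_tangent[OF e(1) this e'(2) b(1,2)]
  have main: "area e + zc b / 2 + q / 4 \<le> area e' - zc b * (min k (l / pi) - (k - 1 / 2))
      + q * (min k (l / pi) - (k - 1 / 2))\<^sup>2"
    unfolding e(3) e'(3) b(3) q_def by (simp add: power2_eq_square field_simps)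
  show ?thesis
  proof (cases "k \<le> l / pi")
    case True
    then show ?thesis using main by (simp add: e_def e'_def b_def min_def power2_eq_square field_simps)
  next
    case False
    \<comment> \<open>The top layer extends by \<delta> above its midpoint. The curve reaches z = 0
      at its end, where the tangent at \<open>b\<close> is therefore at most 0: this gives
      \<open>zc b <= 2 * q * \<delta>\<close>, so the tangent is steep enough below the midpoint to
      make up for the missing strip. What remains is (\<delta> + 1/2)^2 - 2\<delta> = (\<delta> -
      1/2)^2 >= 0.\<close>
    define \<delta> where "\<delta> = l / pi - (k - 1 / 2)"
    have \<delta>: "\<delta> \<ge> 1 / 4" "\<delta> < 1 / 2" unfolding \<delta>_def using assms False by linarith+
    have "zc b \<le> 2 * q * \<delta>"
    proof (cases "b = pi / 2")
      case True
      then have "zc b = 0" by (simp only: zc_pi_half)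
      moreover have "0 \<le> q" using b by (simp add: q_def)
      ultimately show ?thesis using \<delta> by simp
    next
      case False
      then show ?thesis using above_tangent[of "pi / 2" b] b by (auto simp: q_def \<delta>_def)
    qed
    then have "zc b * (1 / 4 - \<delta>\<^sup>2) \<le> 2 * q * \<delta> * (1 / 4 - \<delta>\<^sup>2)"
      using \<delta> power_mono[of \<delta> "1/2" 2] by (intro mult_right_mono) (auto simp: power2_eq_square)
    moreover have "area e' - area e \<ge> zc b * (\<delta> + 1 / 2) + q * (1 / 4 - \<delta>\<^sup>2)"
    proof -
      have "min k (l / pi) - (k - 1 / 2) = \<delta>" using False by (simp add: \<delta>_def)
      then show ?thesis using main by (simp add: algebra_simps)
    qed
    then have "(area e' - area e) * (2 * \<delta>) \<ge> (zc b * (\<delta> + 1 / 2) + q * (1 / 4 - \<delta>\<^sup>2)) * (2 * \<delta>)"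
      using \<delta> by (intro mult_right_mono) auto
    moreover have "(zc b * (\<delta> + 1 / 2) + q * (1 / 4 - \<delta>\<^sup>2)) * (2 * \<delta>) =
       zc b * (2 * \<delta>) * (\<delta> + 1 / 2) + 2 * q * \<delta> * (1 / 4 - \<delta>\<^sup>2)"
      by (simp add: algebra_simps)
    moreover have "zc b * (2 * \<delta>) * (\<delta> + 1 / 2) + zc b * (1 / 4 - \<delta>\<^sup>2) = zc b * (2 * \<delta>) + zc b * (\<delta> - 1 / 2)\<^sup>2"
      by (simp add: algebra_simps power2_eq_square)
    moreover have "zc b \<ge> 0" unfolding zc_def using b l_pos by (simp add: cos_ge_zero)
    then have "zc b * (\<delta> - 1 / 2)\<^sup>2 \<ge> 0" by simp
    ultimately have "zc b * (2 * \<delta>) \<le> (area e' - area e) * (2 * \<delta>)" by linarith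
    then show ?thesis using \<delta> by (simp add: e_def e'_def b_def)
  qed
qed

lemma area_sum:
  assumes "real K - 1 / 4 \<le> l / pi"
  shows "(\<Sum>k\<in>{1..K}. zc (angle (real k - 1 / 2))) \<le> area (angle (min (real K) (l / pi)))"
  using assms
proof (induction K)
  case 0
  have "angle 0 = 0" using angle_yc[of 0] by simp
  then show ?case using l_pos by simp
next
  case (Suc K)
  \<comment> \<open>Only the last layer can be truncated: K + 1 - 1/4 <= l/\<pi> forces K <=
    l/\<pi>.\<close>
  then have "min (real K) (l / pi) = real K" by simp
  with Suc have "(\<Sum>k\<in>{1..K}. zc (angle (real k - 1 / 2))) \<le> area (angle (real K))" by simp
  then show ?case using zc_angle_le_area[of "real (Suc K)"] Suc.prems by simp
qed

lemma area_angle_le: "0 \<le> y \<Longrightarrow> y \<le> l / pi \<Longrightarrow> area (angle y) \<le> l\<^sup>2 / 8"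
proof -
  assume y: "0 \<le> y" "y \<le> l / pi"
  have "area (angle y) \<le> area (pi / 2)"
  proof (rule DERIV_nonneg_imp_nondecreasing[OF angle(2)[OF y]])
    fix x assume x: "angle y \<le> x" "x \<le> pi / 2"
    have "0 \<le> x" using angle(1)[OF y] x by simp
    then have "sin x \<ge> 0" "cos x \<ge> 0" using x pi_gt_zero by (auto intro!: sin_ge_zero cos_ge_zero)
    then have "zc x * (l / pi * (x * sin x)) \<ge> 0" using l_pos \<open>0 \<le> x\<close> by (simp add: zc_def)
    then show "\<exists>d. (area has_real_derivative d) (at x) \<and> 0 \<le> d" using area_deriv by blast
  qed
  then show ?thesis by simp
qed

section \<open>From the phase function to lattice points in horizontal layers\<close>

lemma bessel_phase_eq_yc:
  assumes "real m < l"
  shows "bessel_phase m l = pi * yc (arccos (m / l))" "zc (arccos (m / l)) = m"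
proof -
  have q: "- 1 \<le> m / l" "m / l \<le> 1" using assms l_pos by (auto simp: field_simps)
  have c: "cos (arccos (m / l)) = m / l" by (rule cos_arccos[OF q])
  have "sin (arccos (m / l)) = sqrt (1 - (m / l)\<^sup>2)" by (rule sin_arccos[OF q])
  also have "1 - (m / l)\<^sup>2 = (l\<^sup>2 - (real m)\<^sup>2) / l\<^sup>2" using l_pos by (simp add: field_simps)
  also have "sqrt \<dots> = sqrt (l\<^sup>2 - (real m)\<^sup>2) / l" using l_pos by (simp add: real_sqrt_divide)
  finally have s: "sin (arccos (m / l)) = sqrt (l\<^sup>2 - (real m)\<^sup>2) / l" .
  show "bessel_phase m l = pi * yc (arccos (m / l))"
    unfolding yc_def s c bessel_phase_def using l_pos by (simp add: field_simps)
  show "zc (arccos (m / l)) = m" unfolding zc_def c using l_pos by simp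
qed

definition lattice :: "(int \<times> nat) set" where
  "lattice = {(m, k). 1 \<le> k \<and> \<bar>m\<bar> < l \<and> (real k - 1 / 4) * pi \<le> bessel_phase (nat \<bar>m\<bar>) l}"

text \<open>With |m| = l cos \<beta> the phase condition says \<open>yc \<beta> >= k - 1/4\<close>,
  and since z decreases along the curve this bounds |m| by the abscissa at height k - 1/4.
  \<open>K\<close> is the last k for which that height is still on the curve.\<close>

lemma lattice_layers:
  defines "K \<equiv> nat \<lfloor>l / pi + 1 / 4\<rfloor>"
  shows "lattice \<subseteq> (\<lambda>(k, m). (m, k)) ` (SIGMA k:{1..K}. {- \<lfloor>zc (angle (real k - 1 / 4))\<rfloor>..\<lfloor>zc (angle (real k - 1 / 4))\<rfloor>})" (is "_ \<subseteq> ?S")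
proof clarify
  fix m k assume "(m, k) \<in> lattice"
  then have k: "1 \<le> k" and m: "\<bar>m\<bar> < l" and ph: "(real k - 1 / 4) * pi \<le> bessel_phase (nat \<bar>m\<bar>) l"
    by (auto simp: lattice_def)
  define \<beta> where "\<beta> = arccos (real (nat \<bar>m\<bar>) / l)"
  have rm: "real (nat \<bar>m\<bar>) = \<bar>of_int m\<bar>" by simp
  have "real (nat \<bar>m\<bar>) < l" using m by simp
  note b = bessel_phase_eq_yc[OF this, folded \<beta>_def]
  have \<beta>: "0 \<le> \<beta>" "\<beta> \<le> pi / 2"
  proof -
    have "0 \<le> real (nat \<bar>m\<bar>) / l" "real (nat \<bar>m\<bar>) / l \<le> 1" using m l_pos by auto
    then show "0 \<le> \<beta>" "\<beta> \<le> pi / 2"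
      unfolding \<beta>_def by (intro arccos_lbound arccos_le_pi2; linarith)+
  qed
  have y: "real k - 1 / 4 \<le> yc \<beta>" using ph pi_gt_zero unfolding b(1) mult.commute[of pi] by (simp only: mult_le_cancel_right_pos)
  also have "yc \<beta> \<le> l / pi" using yc_mono[of \<beta> "pi / 2"] \<beta> by simp
  finally have y': "real k - 1 / 4 \<le> l / pi" .
  then have "k \<le> K" unfolding K_def by (simp add: le_nat_iff le_floor_iff)
  let ?a = "angle (real k - 1 / 4)"
  have a: "0 \<le> ?a" "?a \<le> pi / 2" "yc (?a) = real k - 1 / 4"
    using angle[of "real k - 1 / 4"] y' k by auto
  have "?a \<le> \<beta>" by (rule yc_le_imp_le) (use a y \<beta> in auto)
  then have "zc \<beta> \<le> zc (?a)"
    unfolding zc_def using \<beta> a l_pos pi_gt_zero by (intro mult_left_mono cos_monotone_0_pi_le) auto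
  then have "\<bar>of_int m\<bar> \<le> zc (?a)" using b(2) rm by simp
  then have "m \<in> {- \<lfloor>zc (?a)\<rfloor>..\<lfloor>zc (?a)\<rfloor>}"
    by (auto simp: le_floor_iff minus_le_iff abs_le_iff)
  with \<open>k \<le> K\<close> k show "(m, k) \<in> ?S"
    by (intro image_eqI[of _ _ "(k, m)"]) auto
qed

lemma finite_lattice: "finite lattice"
  by (rule finite_subset[OF lattice_layers]) auto

text \<open>\<open>omega0 * l\<close> and l/\<pi> are the heights of the curve at \<beta> = \<pi>/3
  and \<beta> = \<pi>/2.\<close>

lemma omega0_pos: "omega0 > 0"
  and omega0_le: "omega0 * l \<le> l / pi"
proof -
  have y: "omega0 * l = yc (pi / 3)"
    by (simp add: yc_def omega0_def sin_60 cos_60 field_simps)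
  have "yc 0 < yc (pi / 3)" by (rule yc_strict_mono) auto
  then have "0 < omega0 * l" using y by simp
  then show "omega0 > 0" using l_pos by (simp add: zero_less_mult_iff)
  have "yc (pi / 3) < yc (pi / 2)" by (rule yc_strict_mono) auto
  then show "omega0 * l \<le> l / pi" using y by simp
qed

lemma card_lattice: "real (card lattice) < l\<^sup>2 / 4 - of_int \<lfloor>omega0 * l\<rfloor> / 2"
proof -
  define K where "K = nat \<lfloor>l / pi + 1 / 4\<rfloor>"
  define J where "J = nat \<lfloor>omega0 * l\<rfloor>"
  have K: "real K - 1 / 4 \<le> l / pi"
    unfolding K_def using l_pos by (simp add: of_nat_nat) linarith
  have J: "real J = of_int \<lfloor>omega0 * l\<rfloor>"
    unfolding J_def using l_pos omega0_pos by (simp add: of_nat_nat)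
  have "\<lfloor>omega0 * l\<rfloor> \<le> \<lfloor>l / pi + 1 / 4\<rfloor>" using omega0_le by (intro floor_mono) simp
  then have JK: "J \<le> K" unfolding J_def K_def by (rule nat_mono)
  let ?n = "\<lambda>k. \<lfloor>zc (angle (real k - 1 / 4))\<rfloor>"
  have nonneg: "zc (angle (real k - 1 / 4)) \<ge> 0" if "k \<in> {1..K}" for k
  proof -
    have "0 \<le> angle (real k - 1 / 4)" "angle (real k - 1 / 4) \<le> pi / 2"
      using angle[of "real k - 1 / 4"] that K by auto
    then show ?thesis
      unfolding zc_def using l_pos pi_gt_zero by (intro mult_nonneg_nonneg cos_ge_zero) linarith+
  qed
  have "card lattice \<le> card ((\<lambda>(k, m). (m, k)) ` (SIGMA k:{1..K}. {- ?n k..?n k}))"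
    by (rule card_mono[OF _ lattice_layers[folded K_def]]) auto
  also have "\<dots> \<le> card (SIGMA k:{1..K}. {- ?n k..?n k})" by (rule card_image_le) auto
  also have "\<dots> = (\<Sum>k\<in>{1..K}. card {- ?n k..?n k})" by (rule card_SigmaI) auto
  finally have "real (card lattice) \<le> real (\<Sum>k\<in>{1..K}. card {- ?n k..?n k})"
    by (simp only: of_nat_le_iff)
  also have "\<dots> = (\<Sum>k\<in>{1..K}. real (card {- ?n k..?n k}))" by (rule of_nat_sum)
  also have "\<dots> \<le> (\<Sum>k\<in>{1..K}. 2 * zc (angle (real k - 1 / 4)) + 1)"
  proof (rule sum_mono)
    fix k assume "k \<in> {1..K}"
    then have "real (card {- ?n k..?n k}) = 2 * of_int (?n k) + 1"
      using nonneg[of k] by (simp add: of_nat_nat)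
    also have "\<dots> \<le> 2 * zc (angle (real k - 1 / 4)) + 1" by simp
    finally show "real (card {- ?n k..?n k}) \<le> 2 * zc (angle (real k - 1 / 4)) + 1" .
  qed
  finally have 1: "real (card lattice) \<le> (\<Sum>k\<in>{1..K}. 2 * zc (angle (real k - 1 / 4)) + 1)" .
  \<comment> \<open>Twice the gap 1/2 absorbs the extra 1 in the count 2z + 1; for k <=
    \<open>J\<close> twice the gap 3/4 leaves another 1/2.\<close>
  have 2: "2 * zc (angle (real k - 1 / 4)) + 1 < 2 * zc (angle (real k - 1 / 2)) - (if k \<le> J then 1 / 2 else 0)"
    if k: "k \<in> {1..K}" for k
  proof -
    have y: "0 < real k - 1 / 2" "(real k - 1 / 2) + 1 / 4 \<le> l / pi" using k K by auto
    have e: "(real k - 1 / 2) + 1 / 4 = real k - 1 / 4" by simp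
    show ?thesis
    proof (cases "k \<le> J")
      case True
      then have "real k \<le> real J" by simp
      also have "\<dots> \<le> omega0 * l" unfolding J by simp
      finally show ?thesis using zc_angle_gap(2)[OF y] True unfolding e by simp
    next
      case False
      then show ?thesis using zc_angle_gap(1)[OF y] unfolding e by simp
    qed
  qed
  show ?thesis
  proof (cases "K = 0")
    \<comment> \<open>Without layers the strict inequality comes from l^2 > 0, and J <= K makes the
      floor zero. Otherwise every layer contributes a strict gap.\<close>
    case True
    then show ?thesis using 1 l_pos JK by (simp flip: J)
  next
    case False
    have "(\<Sum>k\<in>{1..K}. 2 * zc (angle (real k - 1 / 4)) + 1)
      < (\<Sum>k\<in>{1..K}. 2 * zc (angle (real k - 1 / 2)) - (if k \<le> J then 1 / 2 else 0))"
      by (rule sum_strict_mono) (use 2 False in auto)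
    also have "\<dots> = 2 * (\<Sum>k\<in>{1..K}. zc (angle (real k - 1 / 2))) - (\<Sum>k\<in>{1..K}. if k \<le> J then 1 / 2 else 0)"
      by (simp add: sum_subtractf sum_distrib_left)
    also have "(\<Sum>k\<in>{1..K}. if k \<le> J then 1 / 2 else (0::real)) = (\<Sum>k\<in>{1..J}. 1 / 2)"
      by (rule sum.mono_neutral_cong_right) (use JK in auto)
    also have "(\<Sum>k\<in>{1..J}. 1 / 2 :: real) = real J / 2" by simp
    also have "(\<Sum>k\<in>{1..K}. zc (angle (real k - 1 / 2))) \<le> l\<^sup>2 / 8"
      using area_sum[OF K] area_angle_le[of "min (real K) (l / pi)"] l_pos by simp
    finally show ?thesis using 1 J by simp
  qed
qed

end

section \<open>Integration by parts in the Sobolev space\<close>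

lemma integrable_compact_support:
  fixes f :: "'a::euclidean_space \<Rightarrow> real"
  assumes "compact K" "continuous_on UNIV f" "\<And>x. x \<notin> K \<Longrightarrow> f x = 0"
  shows "integrable lborel f"
proof -
  have "integrable lborel (\<lambda>x. indicator K x *\<^sub>R f x)"
    using assms(1,2) continuous_on_subset by (intro borel_integrable_compact) auto
  also have "(\<lambda>x. indicator K x *\<^sub>R f x) = f" using assms(3) by (auto simp: fun_eq_iff indicator_def)
  finally show ?thesis .
qed

text \<open>By translation invariance every difference quotient has integral 0. The mean value
  theorem bounds the quotients by a constant on a fixed ball, and dominated convergence passes to
  the derivative.\<close>

lemma integral_directional_derivative_eq_0:
  fixes F :: "'a::euclidean_space \<Rightarrow> real"
  assumes der: "\<And>x. (F has_derivative F' x) (at x)" and cont: "continuous_on UNIV (\<lambda>x. F' x e)"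
    and K: "compact K" "\<And>x. x \<notin> K \<Longrightarrow> F x = 0"
  shows "integrable lborel (\<lambda>x. F' x e)" "(\<integral>x. F' x e \<partial>lborel) = 0"
proof -
  have Fcont: "continuous_on UNIV F"
    using der by (meson continuous_at_imp_continuous_on has_derivative_continuous)
  have zero: "F' x e = 0" if "x \<notin> K" for x
  proof -
    have "open (- K)" using K(1) by (simp add: compact_imp_closed open_Compl)
    then have "((\<lambda>_. 0) has_derivative F' x) (at x)"
      by (rule has_derivative_transform_within_open[OF der[of x]]) (use that K(2) in auto)
    then have "F' x = (\<lambda>_. 0)" by (rule has_derivative_unique) (rule has_derivative_const)
    then show ?thesis by simp
  qed
  note int = integrable_compact_support[OF K(1)]
  show "integrable lborel (\<lambda>x. F' x e)" by (rule int[OF cont zero])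
  obtain B where B: "\<And>x. \<bar>F' x e\<bar> \<le> B" "B \<ge> 0"
  proof -
    have "bounded ((\<lambda>x. F' x e) ` K)"
      using K(1) cont by (intro compact_imp_bounded compact_continuous_image continuous_on_subset[OF cont]) auto
    then obtain b where b: "\<And>x. x \<in> K \<Longrightarrow> \<bar>F' x e\<bar> \<le> b" by (auto simp: bounded_iff)
    show thesis
    proof (rule that[of "max b 0"])
      show "\<bar>F' x e\<bar> \<le> max b 0" for x using b[of x] zero[of x] by (cases "x \<in> K") auto
    qed auto
  qed
  obtain r where r: "\<And>x. x \<in> K \<Longrightarrow> norm x \<le> r" using compact_imp_bounded[OF K(1)] by (auto simp: bounded_iff)
  define q where "q = (\<lambda>n x. (F (x + (1 / real (Suc n)) *\<^sub>R e) - F x) * real (Suc n))"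
  have q_lim: "(\<lambda>n. q n x) \<longlonglongrightarrow> F' x e" for x
  proof -
    have "((\<lambda>t. F (x + t *\<^sub>R e)) has_real_derivative F' x e) (at 0)"
    proof -
      have "((\<lambda>t. F (x + t *\<^sub>R e)) has_derivative (\<lambda>t. F' x (t *\<^sub>R e))) (at 0)"
        by (rule has_derivative_compose[where g = F and f = "\<lambda>t. x + t *\<^sub>R e"])
           (use der[of x] in \<open>auto intro!: derivative_eq_intros\<close>)
      moreover have "F' x (t *\<^sub>R e) = F' x e * t" for t
        using linear_scale[OF has_derivative_linear[OF der[of x]]] by simp
      ultimately show ?thesis by (simp add: has_field_derivative_def mult_commute_abs)
    qed
    then have "((\<lambda>h. (F (x + h *\<^sub>R e) - F x) / h) \<longlongrightarrow> F' x e) (at 0)"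
      by (simp add: DERIV_def)
    moreover have "filterlim (\<lambda>n. 1 / real (Suc n)) (at 0) sequentially"
      using LIMSEQ_Suc[OF lim_1_over_n] by (auto simp: filterlim_at intro!: always_eventually)
    ultimately have "((\<lambda>n. (F (x + (1 / real (Suc n)) *\<^sub>R e) - F x) / (1 / real (Suc n))) \<longlongrightarrow> F' x e) sequentially"
      by (rule filterlim_compose)
    then show ?thesis by (simp add: q_def field_simps)
  qed
  have q_bound: "\<bar>q n x\<bar> \<le> B * indicator (cball 0 (r + norm e)) x" for n x
  proof -
    define h where "h = 1 / real (Suc n)"
    have h: "0 < h" "h \<le> 1" by (auto simp: h_def)
    have "\<exists>t. 0 < t \<and> t < h \<and> F (x + h *\<^sub>R e) - F (x + 0 *\<^sub>R e) = (h - 0) * F' (x + t *\<^sub>R e) e"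
    proof (rule MVT2[OF h(1)])
      fix t :: real
      have "((\<lambda>t. F (x + t *\<^sub>R e)) has_derivative (\<lambda>s. F' (x + t *\<^sub>R e) (s *\<^sub>R e))) (at t)"
        by (rule has_derivative_compose[where g = F and f = "\<lambda>t. x + t *\<^sub>R e"])
           (use der[of "x + t *\<^sub>R e"] in \<open>auto intro!: derivative_eq_intros\<close>)
      moreover have "F' (x + t *\<^sub>R e) (s *\<^sub>R e) = F' (x + t *\<^sub>R e) e * s" for s
        using linear_scale[OF has_derivative_linear[OF der[of "x + t *\<^sub>R e"]]] by simp
      ultimately show "DERIV (\<lambda>t. F (x + t *\<^sub>R e)) t :> F' (x + t *\<^sub>R e) e"
        by (simp add: has_field_derivative_def mult_commute_abs)
    qed
    then obtain t where "F (x + h *\<^sub>R e) - F x = h * F' (x + t *\<^sub>R e) e" by auto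
    then have "q n x = F' (x + t *\<^sub>R e) e" unfolding q_def h_def[symmetric] by (simp add: h_def)
    then have 1: "\<bar>q n x\<bar> \<le> B" using B by simp
    have "q n x = 0" if "x \<notin> cball 0 (r + norm e)"
    proof -
      have "norm x > r + norm e" using that by simp
      moreover have "norm (h *\<^sub>R e) \<le> norm e" using h by (simp add: mult_left_le_one_le)
      moreover have "norm x \<le> norm (x + h *\<^sub>R e) + norm (h *\<^sub>R e)"
        by (metis add_diff_cancel norm_triangle_ineq4)
      ultimately have "norm (x + h *\<^sub>R e) > r" by linarith
      then have "x + h *\<^sub>R e \<notin> K" using r by (meson linorder_not_le)
      moreover have "norm x > r" using \<open>norm x > r + norm e\<close> norm_ge_zero[of e] by linarith
      then have "x \<notin> K" using r by (meson linorder_not_le)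
      ultimately show ?thesis using K(2) by (simp add: q_def h_def)
    qed
    with 1 B(2) show ?thesis by (cases "x \<in> cball 0 (r + norm e)") (auto simp: indicator_def)
  qed
  have intF: "integrable lborel F" by (rule int[OF Fcont K(2)])
  have Fm: "F \<in> borel_measurable borel" by (rule borel_measurable_continuous_onI[OF Fcont])
  have shift: "integrable lborel (\<lambda>x. F (x + y))" "(\<integral>x. F (x + y) \<partial>lborel) = (\<integral>x. F x \<partial>lborel)" for y
  proof -
    have y: "(+) y \<in> measurable lborel borel" by simp
    show "(\<integral>x. F (x + y) \<partial>lborel) = (\<integral>x. F x \<partial>lborel)"
      using integral_distr[OF y Fm] by (simp add: lborel_distr_plus add.commute)
    show "integrable lborel (\<lambda>x. F (x + y))"
      using integrable_distr_eq[OF y Fm] intF by (simp add: lborel_distr_plus add.commute)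
  qed
  have q0: "(\<integral>x. q n x \<partial>lborel) = 0" for n
    unfolding q_def using shift intF by (simp add: Bochner_Integration.integral_diff)
  have "(\<lambda>n. \<integral>x. q n x \<partial>lborel) \<longlonglongrightarrow> (\<integral>x. F' x e \<partial>lborel)"
  proof (rule integral_dominated_convergence)
    show "integrable lborel (\<lambda>x. B * indicator (cball 0 (r + norm e)) x)"
      by (intro integrable_mult_right integrable_real_indicator) (use emeasure_bounded_finite[OF bounded_cball] in \<open>auto simp: less_top\<close>)
    show "(\<lambda>x. F' x e) \<in> borel_measurable lborel"
      using borel_measurable_continuous_onI[OF cont] by simp
    show "q n \<in> borel_measurable lborel" for n
      unfolding q_def using Fm by measurable
  qed (use q_lim q_bound in auto)
  then show "(\<integral>x. F' x e \<partial>lborel) = 0" unfolding q0 using LIMSEQ_unique tendsto_const by blast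
qed

lemma C1_compact_support_gradient_outside:
  assumes "\<And>x. GDERIV \<phi> x :> D\<phi> x" "compact K" "\<And>x. x \<notin> K \<Longrightarrow> \<phi> x = 0" "x \<notin> K"
  shows "D\<phi> x = 0"
proof -
  have "open (- K)" using assms(2) by (simp add: compact_imp_closed open_Compl)
  then have "((\<lambda>_. 0) has_derivative (\<lambda>h. inner h (D\<phi> x))) (at x)"
    by (rule has_derivative_transform_within_open[OF assms(1)[unfolded gderiv_def]]) (use assms(3,4) in auto)
  then have "(\<lambda>h. inner h (D\<phi> x)) = (\<lambda>_. 0)" by (rule has_derivative_unique) (rule has_derivative_const)
  then have "inner (D\<phi> x) (D\<phi> x) = 0" by metis
  then show ?thesis by simp
qed

lemma integral_lebesgue_on_eq_lborel:
  fixes f :: "'a::euclidean_space \<Rightarrow> real"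
  assumes "\<Omega> \<in> sets lebesgue" "f \<in> borel_measurable borel" "\<And>x. x \<notin> \<Omega> \<Longrightarrow> f x = 0"
  shows "(\<integral>x. f x \<partial>lebesgue_on \<Omega>) = (\<integral>x. f x \<partial>lborel)"
proof -
  have "(\<integral>x. f x \<partial>lebesgue_on \<Omega>) = (\<integral>x. indicator \<Omega> x *\<^sub>R f x \<partial>lebesgue)"
    by (rule integral_restrict_space) (use assms in simp)
  also have "(\<lambda>x. indicator \<Omega> x *\<^sub>R f x) = f" using assms(3) by (auto simp: fun_eq_iff indicator_def)
  also have "(\<integral>x. f x \<partial>lebesgue) = (\<integral>x. f x \<partial>lborel)"
    by (rule integral_completion) (use assms(2) in simp)
  finally show ?thesis .
qed

text \<open>The divergence theorem for the compactly supported field \<phi> V, applied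
  componentwise; the sum over \<open>Basis\<close> is div V.\<close>

lemma green_C1_compact_support:
  fixes \<phi> :: "'a::euclidean_space \<Rightarrow> real"
  assumes \<phi>: "C1_compact_support \<Omega> \<phi> D\<phi>" and \<Omega>: "\<Omega> \<in> sets lebesgue"
    and V: "\<And>x. (V has_derivative H x) (at x)" "\<And>e. e \<in> Basis \<Longrightarrow> continuous_on UNIV (\<lambda>x. H x e)"
  shows "(\<integral>x. D\<phi> x \<bullet> V x \<partial>lebesgue_on \<Omega>) = - (\<integral>x. \<phi> x * (\<Sum>e\<in>Basis. H x e \<bullet> e) \<partial>lebesgue_on \<Omega>)"
proof -
  obtain K where K: "compact K" "K \<subseteq> \<Omega>" "\<And>x. x \<notin> K \<Longrightarrow> \<phi> x = 0"
    and der: "\<And>x. GDERIV \<phi> x :> D\<phi> x" and contD: "continuous_on UNIV D\<phi>"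
    using \<phi> unfolding C1_compact_support_def by auto
  have D0: "D\<phi> x = 0" if "x \<notin> K" for x
    by (rule C1_compact_support_gradient_outside[OF der K(1,3) that])
  have cont\<phi>: "continuous_on UNIV \<phi>"
    using der unfolding gderiv_def by (meson continuous_at_imp_continuous_on has_derivative_continuous)
  have contV: "continuous_on UNIV V"
    using V(1) by (meson continuous_at_imp_continuous_on has_derivative_continuous)
  define F' where "F' = (\<lambda>e x h. \<phi> x * (H x h \<bullet> e) + (h \<bullet> D\<phi> x) * (V x \<bullet> e))"
  have F': "((\<lambda>x. \<phi> x * (V x \<bullet> e)) has_derivative F' e x) (at x)" for e x
    unfolding F'_def using der[of x] V(1)[of x] unfolding gderiv_def
    by (auto intro!: derivative_eq_intros)
  have contF': "continuous_on UNIV (\<lambda>x. F' e x e)" if "e \<in> Basis" for e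
    unfolding F'_def by (intro continuous_intros cont\<phi> contV contD V(2) that)
  have *: "integrable lborel (\<lambda>x. F' e x e)" "(\<integral>x. F' e x e \<partial>lborel) = 0" if "e \<in> Basis" for e
    by (rule integral_directional_derivative_eq_0[OF F' contF'[OF that] K(1)]; use K(3) in simp)+
  have eq: "(\<Sum>e\<in>Basis. F' e x e) = D\<phi> x \<bullet> V x + \<phi> x * (\<Sum>e\<in>Basis. H x e \<bullet> e)" for x
    unfolding F'_def by (simp add: sum.distrib sum_distrib_left euclidean_inner[of "D\<phi> x" "V x"] inner_commute)
  have cont1: "continuous_on UNIV (\<lambda>x. D\<phi> x \<bullet> V x)" by (intro continuous_intros contD contV)
  have cont2: "continuous_on UNIV (\<lambda>x. \<phi> x * (\<Sum>e\<in>Basis. H x e \<bullet> e))"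
    by (intro continuous_intros cont\<phi> V(2))
  note int = integrable_compact_support[OF K(1)]
  have "(\<integral>x. (\<Sum>e\<in>Basis. F' e x e) \<partial>lborel) = 0"
    using * by (simp add: Bochner_Integration.integral_sum)
  then have "(\<integral>x. D\<phi> x \<bullet> V x \<partial>lborel) + (\<integral>x. \<phi> x * (\<Sum>e\<in>Basis. H x e \<bullet> e) \<partial>lborel) = 0"
    unfolding eq using int[OF cont1] int[OF cont2] D0 K(3)
    by (subst (asm) Bochner_Integration.integral_add) auto
  moreover have "x \<notin> K" if "x \<notin> \<Omega>" for x using that K(2) by auto
  ultimately show ?thesis
    using D0 K(3) cont1 cont2 \<Omega>
    by (subst (1 2) integral_lebesgue_on_eq_lborel) (auto intro: borel_measurable_continuous_onI)
qed

text \<open>Weighted arithmetic-geometric mean: |h| <= d/2 + h^2/(2d), with d the L2 norm of h. The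
  summand 1/(n+1) in \<open>d\<close> keeps the divisor positive when that norm is 0.\<close>

lemma (in finite_measure) L2_tendsto_0_imp_L1:
  fixes h :: "nat \<Rightarrow> 'a \<Rightarrow> real"
  assumes m: "\<And>n. h n \<in> borel_measurable M" and i: "\<And>n. integrable M (\<lambda>x. (h n x)\<^sup>2)"
    and lim: "(\<lambda>n. \<integral>x. (h n x)\<^sup>2 \<partial>M) \<longlonglongrightarrow> 0"
  shows "(\<lambda>n. \<integral>x. \<bar>h n x\<bar> \<partial>M) \<longlonglongrightarrow> 0"
proof (rule tendsto_sandwich[where f = "\<lambda>_. 0"])
  define s where "s = (\<lambda>n. \<integral>x. (h n x)\<^sup>2 \<partial>M)"
  define d where "d = (\<lambda>n. sqrt (s n) + 1 / real (Suc n))"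
  have s0: "s n \<ge> 0" for n unfolding s_def by simp
  have d0: "d n > 0" for n unfolding d_def using s0[of n] by (simp add: add_nonneg_pos)
  have "(\<integral>x. \<bar>h n x\<bar> \<partial>M) \<le> d n * ((measure M (space M) + 1) / 2)" for n
  proof -
    have int: "integrable M (\<lambda>x. d n / 2 + (h n x)\<^sup>2 / (2 * d n))" using i[of n] by simp
    have "(\<integral>x. \<bar>h n x\<bar> \<partial>M) \<le> (\<integral>x. d n / 2 + (h n x)\<^sup>2 / (2 * d n) \<partial>M)"
    proof (rule Bochner_Integration.integral_mono')
      fix x
      have "0 \<le> (\<bar>h n x\<bar> - d n)\<^sup>2" by simp
      then show "\<bar>h n x\<bar> \<le> d n / 2 + (h n x)\<^sup>2 / (2 * d n)"
        using d0[of n] by (simp add: field_simps power2_eq_square)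
    qed (use int d0[of n] in \<open>auto simp: less_imp_le\<close>)
    also have "\<dots> = d n / 2 * measure M (space M) + s n / (2 * d n)"
      using i[of n] by (simp add: s_def)
    also have "s n \<le> (d n)\<^sup>2"
    proof -
      have "s n = (sqrt (s n))\<^sup>2" using s0[of n] by simp
      also have "\<dots> \<le> (d n)\<^sup>2" unfolding d_def by (intro power_mono) (use s0 in auto)
      finally show ?thesis .
    qed
    then have "s n / (2 * d n) \<le> d n / 2" using d0[of n] by (simp add: field_simps power2_eq_square)
    finally show ?thesis by (simp add: algebra_simps add_divide_distrib)
  qed
  then show "\<forall>\<^sub>F n in sequentially. (\<integral>x. \<bar>h n x\<bar> \<partial>M) \<le> d n * ((measure M (space M) + 1) / 2)" by simp
  have "d \<longlonglongrightarrow> sqrt 0 + 0"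
    unfolding d_def using lim LIMSEQ_Suc[OF lim_1_over_n] by (intro tendsto_intros) (auto simp: s_def)
  then have "(\<lambda>n. d n * ((measure M (space M) + 1) / 2)) \<longlonglongrightarrow> 0 * ((measure M (space M) + 1) / 2)"
    by (intro tendsto_intros) simp
  then show "(\<lambda>n. d n * ((measure M (space M) + 1) / 2)) \<longlonglongrightarrow> 0" by simp
qed auto

lemma continuous_bounded_on:
  fixes f :: "'a::euclidean_space \<Rightarrow> 'b::real_normed_vector"
  assumes "continuous_on UNIV f" "bounded \<Omega>"
  obtains B where "\<And>x. x \<in> \<Omega> \<Longrightarrow> norm (f x) \<le> B"
proof -
  have "compact (f ` closure \<Omega>)"
    using assms by (intro compact_continuous_image) (auto intro: continuous_on_subset simp: compact_closure)
  then have "bounded (f ` closure \<Omega>)" by (rule compact_imp_bounded)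
  then obtain B where "\<forall>y\<in>f ` closure \<Omega>. norm y \<le> B" unfolding bounded_iff by blast
  then show thesis using closure_subset by (intro that) blast
qed

lemma L2_on_continuous:
  fixes f :: "'a::euclidean_space \<Rightarrow> 'b::euclidean_space"
  assumes "continuous_on UNIV f" "bounded \<Omega>" "\<Omega> \<in> lmeasurable"
  shows "L2_on \<Omega> f"
proof -
  interpret finite_measure "lebesgue_on \<Omega>" by (rule finite_measure_lebesgue_on[OF assms(3)])
  have m: "f \<in> borel_measurable (lebesgue_on \<Omega>)"
    using assms continuous_on_subset by (intro continuous_imp_measurable_on_sets_lebesgue) (auto dest: fmeasurableD)
  obtain B where B: "\<And>x. x \<in> \<Omega> \<Longrightarrow> norm (f x) \<le> B"
    by (rule continuous_bounded_on[OF assms(1,2)]) (rule that)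
  have "integrable (lebesgue_on \<Omega>) (\<lambda>x. (norm (f x))\<^sup>2)"
  proof (rule integrable_const_bound[where B = "B\<^sup>2"])
    show "AE x in lebesgue_on \<Omega>. norm ((norm (f x))\<^sup>2) \<le> B\<^sup>2"
      using B by (intro AE_I2) (auto intro!: power_mono)
    show "(\<lambda>x. (norm (f x))\<^sup>2) \<in> borel_measurable (lebesgue_on \<Omega>)" using m by measurable
  qed
  with m show ?thesis by (simp add: L2_on_def)
qed

lemma L2_on_diff_norm:
  assumes "L2_on \<Omega> f" "L2_on \<Omega> g"
  shows "(\<lambda>x. norm (f x - g x)) \<in> borel_measurable (lebesgue_on \<Omega>)"
    "integrable (lebesgue_on \<Omega>) (\<lambda>x. (norm (f x - g x))\<^sup>2)"
proof -
  let ?M = "lebesgue_on \<Omega>"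
  have m: "f \<in> borel_measurable (?M)" "g \<in> borel_measurable (?M)"
    using assms by (auto simp: L2_on_def)
  then show m': "(\<lambda>x. norm (f x - g x)) \<in> borel_measurable (?M)" by measurable
  show "integrable (?M) (\<lambda>x. (norm (f x - g x))\<^sup>2)"
  proof (rule Bochner_Integration.integrable_bound)
    show "integrable (?M) (\<lambda>x. 2 * (norm (f x))\<^sup>2 + 2 * (norm (g x))\<^sup>2)"
      using assms by (simp add: L2_on_def)
    have "(norm (f x - g x))\<^sup>2 \<le> 2 * (norm (f x))\<^sup>2 + 2 * (norm (g x))\<^sup>2" for x
    proof -
      have "(norm (f x - g x))\<^sup>2 \<le> (norm (f x) + norm (g x))\<^sup>2"
        by (intro power_mono norm_triangle_ineq4) auto
      also have "\<dots> \<le> 2 * (norm (f x))\<^sup>2 + 2 * (norm (g x))\<^sup>2"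
        using sum_squares_ge_zero[of "norm (f x) - norm (g x)" 0]
        by (simp add: power2_eq_square algebra_simps)
      finally show ?thesis .
    qed
    then show "AE x in ?M. norm ((norm (f x - g x))\<^sup>2) \<le> norm (2 * (norm (f x))\<^sup>2 + 2 * (norm (g x))\<^sup>2)"
      by (intro AE_I2) simp
  qed (use m' in measurable)
qed

lemma L2_on_integrable_mult_bounded:
  fixes f :: "'a::euclidean_space \<Rightarrow> 'b::euclidean_space" and g :: "'a \<Rightarrow> 'b"
  assumes f: "L2_on \<Omega> f" and \<Omega>: "\<Omega> \<in> lmeasurable"
    and g: "g \<in> borel_measurable (lebesgue_on \<Omega>)" "\<And>x. x \<in> \<Omega> \<Longrightarrow> norm (g x) \<le> B"
  shows "integrable (lebesgue_on \<Omega>) (\<lambda>x. f x \<bullet> g x)"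
proof (rule Bochner_Integration.integrable_bound)
  interpret finite_measure "lebesgue_on \<Omega>" by (rule finite_measure_lebesgue_on[OF \<Omega>])
  show "integrable (lebesgue_on \<Omega>) (\<lambda>x. (norm (f x))\<^sup>2 + B\<^sup>2)" using f by (simp add: L2_on_def)
  have "norm (f x \<bullet> g x) \<le> norm ((norm (f x))\<^sup>2 + B\<^sup>2)" if "x \<in> \<Omega>" for x
  proof -
    have "norm (f x \<bullet> g x) \<le> norm (f x) * norm (g x)" using Cauchy_Schwarz_ineq2 by simp
    also have "\<dots> \<le> norm (f x) * B" using g(2)[OF that] by (intro mult_left_mono) auto
    also have "0 \<le> (norm (f x) - B)\<^sup>2 + (norm (f x))\<^sup>2 + B\<^sup>2" by simp
    then have "norm (f x) * B \<le> (norm (f x))\<^sup>2 + B\<^sup>2" by (simp add: power2_eq_square algebra_simps)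
    finally show ?thesis by simp
  qed
  then show "AE x in lebesgue_on \<Omega>. norm (f x \<bullet> g x) \<le> norm ((norm (f x))\<^sup>2 + B\<^sup>2)"
    by (intro AE_I2) simp
  show "(\<lambda>x. f x \<bullet> g x) \<in> borel_measurable (lebesgue_on \<Omega>)"
    using f g(1) by (intro borel_measurable_inner) (auto simp: L2_on_def)
qed

lemma L2_limit_inner_bounded:
  fixes f :: "nat \<Rightarrow> 'a::euclidean_space \<Rightarrow> 'b::euclidean_space"
  assumes f: "\<And>n. L2_on \<Omega> (f n)" "L2_on \<Omega> F" and \<Omega>: "\<Omega> \<in> lmeasurable"
    and g: "g \<in> borel_measurable (lebesgue_on \<Omega>)" "\<And>x. x \<in> \<Omega> \<Longrightarrow> norm (g x) \<le> B"
    and lim: "(\<lambda>n. \<integral>x. (norm (f n x - F x))\<^sup>2 \<partial>lebesgue_on \<Omega>) \<longlonglongrightarrow> 0"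
  shows "(\<lambda>n. \<integral>x. f n x \<bullet> g x \<partial>lebesgue_on \<Omega>) \<longlonglongrightarrow> (\<integral>x. F x \<bullet> g x \<partial>lebesgue_on \<Omega>)"
proof -
  let ?M = "lebesgue_on \<Omega>"
  interpret finite_measure "?M" by (rule finite_measure_lebesgue_on[OF \<Omega>])
  define h where "h = (\<lambda>n x. norm (f n x - F x))"
  have h: "h n \<in> borel_measurable (?M)" "integrable (?M) (\<lambda>x. (h n x)\<^sup>2)" for n
    unfolding h_def by (rule L2_on_diff_norm[OF f(1) f(2)])+
  have hint: "integrable (?M) (\<lambda>x. \<bar>h n x\<bar>)" for n
  proof (rule Bochner_Integration.integrable_bound)
    show "integrable (?M) (\<lambda>x. (h n x)\<^sup>2 + 1)" using h(2)[of n] by simp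
    have "\<bar>t\<bar> \<le> t\<^sup>2 + 1" for t :: real
      using sum_squares_ge_zero[of "\<bar>t\<bar> - 1" 0] zero_le_power2[of t]
      by (auto simp: power2_eq_square algebra_simps abs_if split: if_splits)
    then show "AE x in ?M. norm \<bar>h n x\<bar> \<le> norm ((h n x)\<^sup>2 + 1)"
      by (intro AE_I2) simp
  qed (use h(1)[of n] in measurable)
  have B: "B \<ge> 0" if "x \<in> \<Omega>" for x using g(2)[OF that] norm_ge_zero order_trans by blast
  have bnd: "\<bar>(\<integral>x. f n x \<bullet> g x \<partial>?M) - (\<integral>x. F x \<bullet> g x \<partial>?M)\<bar>
    \<le> B * (\<integral>x. \<bar>h n x\<bar> \<partial>?M)" for n
  proof -
    have i: "integrable (?M) (\<lambda>x. f n x \<bullet> g x)" "integrable (?M) (\<lambda>x. F x \<bullet> g x)"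
      using L2_on_integrable_mult_bounded[OF f(1) \<Omega> g] L2_on_integrable_mult_bounded[OF f(2) \<Omega> g] by auto
    have "(\<integral>x. f n x \<bullet> g x \<partial>?M) - (\<integral>x. F x \<bullet> g x \<partial>?M)
      = (\<integral>x. f n x \<bullet> g x - F x \<bullet> g x \<partial>?M)"
      using i by simp
    also have "norm \<dots> \<le> (\<integral>x. B * \<bar>h n x\<bar> \<partial>?M)"
    proof (rule Bochner_Integration.integral_norm_bound_integral)
      show "integrable (?M) (\<lambda>x. f n x \<bullet> g x - F x \<bullet> g x)" using i by simp
      show "integrable (?M) (\<lambda>x. B * \<bar>h n x\<bar>)" using hint by simp
      fix x assume "x \<in> space (?M)"
      then have x: "x \<in> \<Omega>" by simp
      have "norm (f n x \<bullet> g x - F x \<bullet> g x) \<le> norm (f n x - F x) * norm (g x)"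
        using Cauchy_Schwarz_ineq2[of "f n x - F x" "g x"] by (simp add: inner_diff_left)
      also have "\<dots> \<le> norm (f n x - F x) * B" using g(2)[OF x] by (intro mult_left_mono) auto
      finally show "norm (f n x \<bullet> g x - F x \<bullet> g x) \<le> B * \<bar>h n x\<bar>" by (simp add: h_def mult.commute)
    qed
    finally show ?thesis by simp
  qed
  have lim0: "(\<lambda>n. B * (\<integral>x. \<bar>h n x\<bar> \<partial>?M)) \<longlonglongrightarrow> B * 0"
    using lim by (intro tendsto_intros L2_tendsto_0_imp_L1 h) (simp add: h_def)
  have "(\<lambda>n. (\<integral>x. f n x \<bullet> g x \<partial>?M) - (\<integral>x. F x \<bullet> g x \<partial>?M)) \<longlonglongrightarrow> 0"
  proof (rule Lim_null_comparison)
    show "\<forall>\<^sub>F n in sequentially. norm ((\<integral>x. f n x \<bullet> g x \<partial>?M) - (\<integral>x. F x \<bullet> g x \<partial>?M))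
        \<le> B * (\<integral>x. \<bar>h n x\<bar> \<partial>?M)"
      unfolding real_norm_def by (intro always_eventually allI bnd)
    show "(\<lambda>n. B * (\<integral>x. \<bar>h n x\<bar> \<partial>?M)) \<longlonglongrightarrow> 0" using lim0 by simp
  qed
  then show ?thesis by (rule LIM_zero_cancel)
qed

lemma C1_compact_support_L2:
  assumes "C1_compact_support \<Omega> \<phi> D\<phi>" "bounded \<Omega>" "\<Omega> \<in> lmeasurable"
  shows "L2_on \<Omega> \<phi>" "L2_on \<Omega> D\<phi>"
proof -
  have "continuous_on UNIV D\<phi>" "\<And>x. GDERIV \<phi> x :> D\<phi> x"
    using assms by (auto simp: C1_compact_support_def)
  moreover from this have "continuous_on UNIV \<phi>"
    unfolding gderiv_def by (meson continuous_at_imp_continuous_on has_derivative_continuous)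
  ultimately show "L2_on \<Omega> \<phi>" "L2_on \<Omega> D\<phi>" using assms L2_on_continuous by blast+
qed

text \<open>\<open>V\<close> is free to be nonzero at the boundary: the boundary term is absent
  because u is a limit of compactly supported functions.\<close>

lemma green_H10:
  fixes u :: "'a::euclidean_space \<Rightarrow> real"
  assumes u: "H10 \<Omega> u Du" and \<Omega>: "bounded \<Omega>" "\<Omega> \<in> lmeasurable"
    and V: "\<And>x. (V has_derivative H x) (at x)" "\<And>e. e \<in> Basis \<Longrightarrow> continuous_on UNIV (\<lambda>x. H x e)"
  shows "(\<integral>x. Du x \<bullet> V x \<partial>lebesgue_on \<Omega>) = - (\<integral>x. u x * (\<Sum>e\<in>Basis. H x e \<bullet> e) \<partial>lebesgue_on \<Omega>)"
proof -
  let ?M = "lebesgue_on \<Omega>"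
  obtain \<phi> D\<phi> where \<phi>: "\<And>n::nat. C1_compact_support \<Omega> (\<phi> n) (D\<phi> n)"
    and lim: "(\<lambda>n. \<integral>x. (\<phi> n x - u x)\<^sup>2 \<partial>?M) \<longlonglongrightarrow> 0"
      "(\<lambda>n. \<integral>x. (norm (D\<phi> n x - Du x))\<^sup>2 \<partial>?M) \<longlonglongrightarrow> 0"
    using u unfolding H10_def by auto
  have L2: "L2_on \<Omega> u" "L2_on \<Omega> Du" using u by (auto simp: H10_def)
  have s: "\<Omega> \<in> sets lebesgue" using \<Omega>(2) by (rule fmeasurableD)
  have contV: "continuous_on UNIV V"
    using V(1) by (meson continuous_at_imp_continuous_on has_derivative_continuous)
  define L where "L = (\<lambda>x. \<Sum>e\<in>Basis. H x e \<bullet> e)"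
  have contL: "continuous_on UNIV L" unfolding L_def by (intro continuous_intros V(2))
  obtain B where B: "\<And>x. x \<in> \<Omega> \<Longrightarrow> norm (V x) \<le> B" by (rule continuous_bounded_on[OF contV \<Omega>(1)]) (rule that)
  obtain C where C: "\<And>x. x \<in> \<Omega> \<Longrightarrow> norm (L x) \<le> C" by (rule continuous_bounded_on[OF contL \<Omega>(1)]) (rule that)
  have m: "V \<in> borel_measurable (?M)" "L \<in> borel_measurable (?M)"
    using contV contL s by (auto intro!: continuous_imp_measurable_on_sets_lebesgue intro: continuous_on_subset)
  have "(\<lambda>n. \<integral>x. D\<phi> n x \<bullet> V x \<partial>?M) \<longlonglongrightarrow> (\<integral>x. Du x \<bullet> V x \<partial>?M)"
    by (rule L2_limit_inner_bounded[OF C1_compact_support_L2(2)[OF \<phi> \<Omega>] L2(2) \<Omega>(2) m(1) B lim(2)])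
  moreover have "(\<lambda>n. \<integral>x. \<phi> n x \<bullet> L x \<partial>?M) \<longlonglongrightarrow> (\<integral>x. u x \<bullet> L x \<partial>?M)"
    by (rule L2_limit_inner_bounded[OF C1_compact_support_L2(1)[OF \<phi> \<Omega>] L2(1) \<Omega>(2) m(2) C]) (use lim(1) in simp_all)
  then have "(\<lambda>n. - (\<integral>x. \<phi> n x * L x \<partial>?M)) \<longlonglongrightarrow> - (\<integral>x. u x * L x \<partial>?M)"
    by (intro tendsto_minus) simp
  moreover have "(\<integral>x. D\<phi> n x \<bullet> V x \<partial>?M) = - (\<integral>x. \<phi> n x * L x \<partial>?M)" for n
    unfolding L_def by (rule green_C1_compact_support[OF \<phi> s V])
  ultimately show ?thesis unfolding L_def by (simp add: LIMSEQ_unique)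
qed

section \<open>Functions vanishing at the boundary as elements of the Sobolev space\<close>

text \<open>The natural truncation of the identity is \<open>(max 0 (s - \<epsilon>))\<^sup>2 / s\<close>; the factor \<open>s / (s\<^sup>2 + \<epsilon>\<^sup>2)\<close> replaces
  \<open>1 / s\<close> to avoid the division by zero.\<close>

definition cutoff :: "real \<Rightarrow> real \<Rightarrow> real" where
  "cutoff \<epsilon> s = (max 0 (s - \<epsilon>))\<^sup>2 * s / (s\<^sup>2 + \<epsilon>\<^sup>2)"

definition cutoff' :: "real \<Rightarrow> real \<Rightarrow> real" where
  "cutoff' \<epsilon> s = 2 * max 0 (s - \<epsilon>) * s / (s\<^sup>2 + \<epsilon>\<^sup>2)
     + (max 0 (s - \<epsilon>))\<^sup>2 * (\<epsilon>\<^sup>2 - s\<^sup>2) / (s\<^sup>2 + \<epsilon>\<^sup>2)\<^sup>2"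

lemma DERIV_max_0_power2: "((\<lambda>s::real. (max 0 s)\<^sup>2) has_real_derivative 2 * max 0 s) (at s)"
proof -
  consider "s < 0" | "s > 0" | "s = 0" by linarith
  then show ?thesis
  proof cases
    case 1
    then have "((\<lambda>_. 0) has_real_derivative 2 * max 0 s) (at s)" by simp
    then show ?thesis
      by (rule has_field_derivative_transform_within_open[where S = "{..<0}"]) (use 1 in auto)
  next
    case 2
    then have "((\<lambda>s. s\<^sup>2) has_real_derivative 2 * max 0 s) (at s)"
      by (auto intro!: derivative_eq_intros)
    then show ?thesis
      by (rule has_field_derivative_transform_within_open[where S = "{0<..}"]) (use 2 in auto)
  next
    case 3
    have "((\<lambda>h. (max 0 h)\<^sup>2 / h) \<longlongrightarrow> 0) (at (0::real))"
    proof (rule Lim_null_comparison[where g = "\<lambda>h. \<bar>h\<bar>"])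
      show "\<forall>\<^sub>F h in at 0. norm ((max 0 h)\<^sup>2 / h) \<le> \<bar>h::real\<bar>"
        by (auto intro!: always_eventually simp: max_def power2_eq_square)
      show "((\<lambda>h. \<bar>h\<bar>) \<longlongrightarrow> 0) (at (0::real))" by (auto intro!: tendsto_eq_intros)
    qed
    then show ?thesis using 3 by (simp add: DERIV_def)
  qed
qed

lemma cutoff_deriv: "\<epsilon> > 0 \<Longrightarrow> (cutoff \<epsilon> has_real_derivative cutoff' \<epsilon> s) (at s)"
proof -
  assume e: "\<epsilon> > 0"
  have pos: "s\<^sup>2 + \<epsilon>\<^sup>2 > 0" for s using e by (simp add: add_nonneg_pos)
  have "((\<lambda>s. (max 0 (s - \<epsilon>))\<^sup>2) has_real_derivative 2 * max 0 (s - \<epsilon>) * 1) (at s)"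
    by (rule DERIV_chain2[OF DERIV_max_0_power2]) (auto intro!: derivative_eq_intros)
  moreover have "((\<lambda>s. s / (s\<^sup>2 + \<epsilon>\<^sup>2)) has_real_derivative (\<epsilon>\<^sup>2 - s\<^sup>2) / (s\<^sup>2 + \<epsilon>\<^sup>2)\<^sup>2) (at s)"
    using pos[of s] by (auto intro!: derivative_eq_intros simp: power2_eq_square algebra_simps)
  ultimately have "((\<lambda>s. (max 0 (s - \<epsilon>))\<^sup>2 * (s / (s\<^sup>2 + \<epsilon>\<^sup>2))) has_real_derivative
     2 * max 0 (s - \<epsilon>) * 1 * (s / (s\<^sup>2 + \<epsilon>\<^sup>2)) + (\<epsilon>\<^sup>2 - s\<^sup>2) / (s\<^sup>2 + \<epsilon>\<^sup>2)\<^sup>2 * (max 0 (s - \<epsilon>))\<^sup>2) (at s)"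
    by (rule DERIV_mult)
  then show ?thesis by (simp add: cutoff_def[abs_def] cutoff'_def mult_ac)
qed

lemma cutoff_continuous: "\<epsilon> > 0 \<Longrightarrow> continuous_on A (cutoff \<epsilon>)"
  by (intro continuous_at_imp_continuous_on ballI DERIV_isCont[OF cutoff_deriv])

lemma cutoff'_continuous: "\<epsilon> > 0 \<Longrightarrow> continuous_on A (cutoff' \<epsilon>)"
  unfolding cutoff'_def by (intro continuous_intros) (auto simp: add_nonneg_eq_0_iff)

lemma cutoff_eq_0: "s \<le> \<epsilon> \<Longrightarrow> cutoff \<epsilon> s = 0"
  by (simp add: cutoff_def)

lemma max_0_diff_le: "\<epsilon> > 0 \<Longrightarrow> max 0 (s - \<epsilon>) \<le> \<bar>s\<bar>" for s :: real
  by auto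

lemma abs_cutoff_le: "\<epsilon> > 0 \<Longrightarrow> \<bar>cutoff \<epsilon> s\<bar> \<le> \<bar>s\<bar>"
proof -
  assume e: "\<epsilon> > 0"
  have pos: "s\<^sup>2 + \<epsilon>\<^sup>2 > 0" using e by (simp add: add_nonneg_pos)
  have "(max 0 (s - \<epsilon>))\<^sup>2 \<le> \<bar>s\<bar>\<^sup>2" by (rule power_mono[OF max_0_diff_le[OF e]]) simp
  then have "(max 0 (s - \<epsilon>))\<^sup>2 \<le> s\<^sup>2 + \<epsilon>\<^sup>2" using e by (simp add: add_increasing2)
  then have "(max 0 (s - \<epsilon>))\<^sup>2 * \<bar>s\<bar> \<le> (s\<^sup>2 + \<epsilon>\<^sup>2) * \<bar>s\<bar>" by (intro mult_right_mono) auto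
  then show ?thesis using pos by (simp add: cutoff_def abs_mult abs_div_pos[symmetric] divide_le_eq mult.commute)
qed

lemma abs_cutoff'_le: "\<epsilon> > 0 \<Longrightarrow> \<bar>cutoff' \<epsilon> s\<bar> \<le> 3"
proof -
  assume e: "\<epsilon> > 0"
  define N where "N = s\<^sup>2 + \<epsilon>\<^sup>2"
  define m where "m = max 0 (s - \<epsilon>)"
  have N: "N > 0" "s\<^sup>2 \<le> N" using e by (auto simp: N_def add_nonneg_pos)
  have m: "0 \<le> m" "m \<le> \<bar>s\<bar>" using max_0_diff_le[OF e] by (auto simp: m_def)
  have "m * \<bar>s\<bar> \<le> \<bar>s\<bar> * \<bar>s\<bar>" using m by (intro mult_right_mono) auto
  then have 1: "m * \<bar>s\<bar> \<le> N" using N by (simp add: power2_eq_square)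
  have "m\<^sup>2 \<le> \<bar>s\<bar>\<^sup>2" using m by (intro power_mono)
  then have "m\<^sup>2 \<le> N" using N by simp
  moreover have "\<bar>\<epsilon>\<^sup>2 - s\<^sup>2\<bar> \<le> N" unfolding N_def by (simp add: abs_le_iff)
  ultimately have 2: "m\<^sup>2 * \<bar>\<epsilon>\<^sup>2 - s\<^sup>2\<bar> \<le> N * N" using N by (intro mult_mono) auto
  have "\<bar>cutoff' \<epsilon> s\<bar> \<le> \<bar>2 * m * s / N\<bar> + \<bar>m\<^sup>2 * (\<epsilon>\<^sup>2 - s\<^sup>2) / N\<^sup>2\<bar>"
    unfolding cutoff'_def N_def[symmetric] m_def[symmetric] by (rule abs_triangle_ineq)
  also have "\<bar>2 * m * s / N\<bar> = 2 * (m * \<bar>s\<bar>) / N" using m N by (simp add: abs_mult)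
  also have "\<dots> \<le> 2" using 1 N by (simp add: divide_le_eq)
  also have "\<bar>m\<^sup>2 * (\<epsilon>\<^sup>2 - s\<^sup>2) / N\<^sup>2\<bar> = m\<^sup>2 * \<bar>\<epsilon>\<^sup>2 - s\<^sup>2\<bar> / (N * N)"
    by (simp add: abs_mult power2_eq_square)
  also have "\<dots> \<le> 1" using 2 N by (simp add: divide_le_eq)
  finally show ?thesis by simp
qed

lemma cutoff_tendsto:
  assumes "s > 0" "\<epsilon> \<longlonglongrightarrow> 0"
  shows "(\<lambda>n. cutoff (\<epsilon> n) s) \<longlonglongrightarrow> s" "(\<lambda>n. cutoff' (\<epsilon> n) s) \<longlonglongrightarrow> 1"
proof -
  have "(\<lambda>n. cutoff (\<epsilon> n) s) \<longlonglongrightarrow> (max 0 (s - 0))\<^sup>2 * s / (s\<^sup>2 + 0\<^sup>2)"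
    unfolding cutoff_def using assms by (intro tendsto_intros) auto
  then show "(\<lambda>n. cutoff (\<epsilon> n) s) \<longlonglongrightarrow> s" using assms(1) by (simp add: power2_eq_square)
  have "(\<lambda>n. cutoff' (\<epsilon> n) s) \<longlonglongrightarrow> 2 * max 0 (s - 0) * s / (s\<^sup>2 + 0\<^sup>2) + (max 0 (s - 0))\<^sup>2 * (0\<^sup>2 - s\<^sup>2) / (s\<^sup>2 + 0\<^sup>2)\<^sup>2"
    unfolding cutoff'_def using assms by (intro tendsto_intros) auto
  then show "(\<lambda>n. cutoff' (\<epsilon> n) s) \<longlonglongrightarrow> 1" using assms(1) by (simp add: power2_eq_square)
qed

text \<open>Applying \<open>cutoff\<close> to the values of \<rho> gives a product supported in
  {\<rho> >= \<epsilon>}, which is closed and bounded and lies in the domain. The bounds for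
  \<open>cutoff\<close> and \<open>cutoff'\<close> are uniform in \<epsilon>, so dominated
  convergence gives the convergence of functions and gradients.\<close>

lemma H10_defining_function_mult:
  fixes \<rho> p :: "'a::euclidean_space \<Rightarrow> real"
  assumes \<rho>: "\<And>x. GDERIV \<rho> x :> D\<rho> x" "continuous_on UNIV D\<rho>"
    and p: "\<And>x. GDERIV p x :> Dp x" "continuous_on UNIV Dp"
    and \<Omega>: "bounded {x. \<rho> x > 0}"
  shows "H10 {x. \<rho> x > 0} (\<lambda>x. \<rho> x * p x) (\<lambda>x. \<rho> x *\<^sub>R Dp x + p x *\<^sub>R D\<rho> x)"
proof -
  define \<Omega> where "\<Omega> = {x. \<rho> x > 0}"
  let ?M = "lebesgue_on \<Omega>"
  have cont: "continuous_on UNIV \<rho>" "continuous_on UNIV p"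
    using \<rho>(1) p(1) unfolding gderiv_def
    by (meson continuous_at_imp_continuous_on has_derivative_continuous)+
  have "open \<Omega>" unfolding \<Omega>_def using cont(1) by (intro open_Collect_less) auto
  have bnd: "bounded \<Omega>" using \<Omega> by (simp add: \<Omega>_def)
  have meas: "\<Omega> \<in> lmeasurable" using \<open>open \<Omega>\<close> bnd lmeasurable_open by blast
  have s: "\<Omega> \<in> sets lebesgue" using meas by (rule fmeasurableD)
  interpret finite_measure "?M" by (rule finite_measure_lebesgue_on[OF meas])
  define v where "v = (\<lambda>x. \<rho> x * p x)"
  define Dv where "Dv = (\<lambda>x. \<rho> x *\<^sub>R Dp x + p x *\<^sub>R D\<rho> x)"
  define \<epsilon> where "\<epsilon> = (\<lambda>n::nat. 1 / real (Suc n))"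
  have e: "\<epsilon> n > 0" for n by (simp add: \<epsilon>_def)
  have elim: "\<epsilon> \<longlonglongrightarrow> 0" unfolding \<epsilon>_def using LIMSEQ_Suc[OF lim_1_over_n] .
  define \<phi> where "\<phi> = (\<lambda>n x. cutoff (\<epsilon> n) (\<rho> x) * p x)"
  define D\<phi> where "D\<phi> = (\<lambda>n x. cutoff (\<epsilon> n) (\<rho> x) *\<^sub>R Dp x + p x *\<^sub>R (cutoff' (\<epsilon> n) (\<rho> x) *\<^sub>R D\<rho> x))"
  have contc: "continuous_on UNIV (\<lambda>x. cutoff (\<epsilon> n) (\<rho> x))" for n
    by (rule continuous_on_compose2[OF cutoff_continuous[OF e] cont(1)]) auto
  have contc': "continuous_on UNIV (\<lambda>x. cutoff' (\<epsilon> n) (\<rho> x))" for n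
    by (rule continuous_on_compose2[OF cutoff'_continuous[OF e] cont(1)]) auto
  have C1: "C1_compact_support \<Omega> (\<phi> n) (D\<phi> n)" for n
    unfolding C1_compact_support_def
  proof (intro conjI allI exI[of _ "{x. \<rho> x \<ge> \<epsilon> n}"] impI)
    show "GDERIV (\<phi> n) x :> D\<phi> n x" for x
      unfolding \<phi>_def D\<phi>_def
      by (rule GDERIV_mult[OF GDERIV_DERIV_compose[OF \<rho>(1) cutoff_deriv[OF e]] p(1)])
    show "continuous_on UNIV (D\<phi> n)"
      unfolding D\<phi>_def by (intro continuous_intros contc contc' cont \<rho>(2) p(2))
    show "compact {x. \<rho> x \<ge> \<epsilon> n}"
      unfolding compact_eq_bounded_closed
    proof
      show "bounded {x. \<rho> x \<ge> \<epsilon> n}" using e[of n] by (intro bounded_subset[OF bnd]) (auto simp: \<Omega>_def)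
      show "closed {x. \<rho> x \<ge> \<epsilon> n}" using cont(1) by (intro closed_Collect_le) auto
    qed
    show "{x. \<rho> x \<ge> \<epsilon> n} \<subseteq> \<Omega>" using e[of n] by (auto simp: \<Omega>_def)
    show "x \<notin> {x. \<rho> x \<ge> \<epsilon> n} \<Longrightarrow> \<phi> n x = 0" for x by (simp add: \<phi>_def cutoff_eq_0)
  qed
  have contv: "continuous_on UNIV v" unfolding v_def by (intro continuous_intros cont)
  have contDv: "continuous_on UNIV Dv" unfolding Dv_def by (intro continuous_intros cont \<rho>(2) p(2))
  obtain B1 where B1: "\<And>x. x \<in> \<Omega> \<Longrightarrow> norm (\<rho> x) \<le> B1" by (rule continuous_bounded_on[OF cont(1) bnd]) (rule that)
  obtain B2 where B2: "\<And>x. x \<in> \<Omega> \<Longrightarrow> norm (p x) \<le> B2" by (rule continuous_bounded_on[OF cont(2) bnd]) (rule that)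
  obtain B3 where B3: "\<And>x. x \<in> \<Omega> \<Longrightarrow> norm (D\<rho> x) \<le> B3" by (rule continuous_bounded_on[OF \<rho>(2) bnd]) (rule that)
  obtain B4 where B4: "\<And>x. x \<in> \<Omega> \<Longrightarrow> norm (Dp x) \<le> B4" by (rule continuous_bounded_on[OF p(2) bnd]) (rule that)
  have lim_c: "(\<lambda>n. cutoff (\<epsilon> n) (\<rho> x)) \<longlonglongrightarrow> \<rho> x" "(\<lambda>n. cutoff' (\<epsilon> n) (\<rho> x)) \<longlonglongrightarrow> 1" if "x \<in> \<Omega>" for x
    using cutoff_tendsto[OF _ elim, of "\<rho> x"] that by (auto simp: \<Omega>_def)
  have m: "f \<in> borel_measurable (?M)" if "continuous_on UNIV f" for f :: "'a \<Rightarrow> real"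
    using that s by (auto intro!: continuous_imp_measurable_on_sets_lebesgue intro: continuous_on_subset)
  have "(\<lambda>n. \<integral>x. (\<phi> n x - v x)\<^sup>2 \<partial>?M) \<longlonglongrightarrow> (\<integral>x. 0 \<partial>?M)"
  proof (rule integral_dominated_convergence)
    show "integrable (?M) (\<lambda>_. (2 * B1 * B2)\<^sup>2)" by simp
    show "(\<lambda>x. (\<phi> n x - v x)\<^sup>2) \<in> borel_measurable (?M)" for n
      by (rule m) (unfold \<phi>_def, intro continuous_intros contc cont contv)
    show "AE x in ?M. (\<lambda>n. (\<phi> n x - v x)\<^sup>2) \<longlonglongrightarrow> 0"
    proof (rule AE_I2)
      fix x assume "x \<in> space (?M)"
      then have "x \<in> \<Omega>" by simp
      have "(\<lambda>n. (\<phi> n x - v x)\<^sup>2) \<longlonglongrightarrow> (\<rho> x * p x - v x)\<^sup>2"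
        unfolding \<phi>_def by (intro tendsto_intros lim_c \<open>x \<in> \<Omega>\<close>)
      then show "(\<lambda>n. (\<phi> n x - v x)\<^sup>2) \<longlonglongrightarrow> 0" by (simp add: v_def)
    qed
    show "AE x in ?M. norm ((\<phi> n x - v x)\<^sup>2) \<le> (2 * B1 * B2)\<^sup>2" for n
    proof (rule AE_I2)
      fix x assume "x \<in> space (?M)"
      then have x: "x \<in> \<Omega>" by simp
      have "\<bar>\<phi> n x - v x\<bar> = \<bar>cutoff (\<epsilon> n) (\<rho> x) - \<rho> x\<bar> * \<bar>p x\<bar>"
        by (simp add: \<phi>_def v_def flip: left_diff_distrib abs_mult)
      also have "\<dots> \<le> (2 * B1) * B2"
        using abs_cutoff_le[OF e[of n], of "\<rho> x"] B1[OF x] B2[OF x] by (intro mult_mono) auto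
      finally have "\<bar>\<phi> n x - v x\<bar>\<^sup>2 \<le> (2 * B1 * B2)\<^sup>2" by (intro power_mono) auto
      then show "norm ((\<phi> n x - v x)\<^sup>2) \<le> (2 * B1 * B2)\<^sup>2" by simp
    qed
  qed auto
  moreover have "(\<lambda>n. \<integral>x. (norm (D\<phi> n x - Dv x))\<^sup>2 \<partial>?M) \<longlonglongrightarrow> (\<integral>x. 0 \<partial>?M)"
  proof (rule integral_dominated_convergence)
    \<comment> \<open>The 4 bounds \<open>cutoff' - 1\<close>, as \<open>cutoff'\<close> is at most
      3 in absolute value; the 2 comes from \<open>cutoff\<close> being at most its argument in
      absolute value.\<close>
    show "integrable (?M) (\<lambda>_. (2 * B1 * B4 + B2 * (4 * B3))\<^sup>2)" by simp
    show "(\<lambda>x. (norm (D\<phi> n x - Dv x))\<^sup>2) \<in> borel_measurable (?M)" for n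
      by (rule m) (unfold D\<phi>_def, intro continuous_intros contc contc' cont \<rho>(2) p(2) contDv)
    have eq: "D\<phi> n x - Dv x = (cutoff (\<epsilon> n) (\<rho> x) - \<rho> x) *\<^sub>R Dp x + p x *\<^sub>R ((cutoff' (\<epsilon> n) (\<rho> x) - 1) *\<^sub>R D\<rho> x)" for n x
      by (simp add: D\<phi>_def Dv_def algebra_simps)
    show "AE x in ?M. (\<lambda>n. (norm (D\<phi> n x - Dv x))\<^sup>2) \<longlonglongrightarrow> 0"
    proof (rule AE_I2)
      fix x assume "x \<in> space (?M)"
      then have "x \<in> \<Omega>" by simp
      have "(\<lambda>n. (norm (D\<phi> n x - Dv x))\<^sup>2) \<longlonglongrightarrow> (norm ((\<rho> x - \<rho> x) *\<^sub>R Dp x + p x *\<^sub>R ((1 - 1) *\<^sub>R D\<rho> x)))\<^sup>2"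
        unfolding eq by (intro tendsto_intros lim_c \<open>x \<in> \<Omega>\<close>)
      then show "(\<lambda>n. (norm (D\<phi> n x - Dv x))\<^sup>2) \<longlonglongrightarrow> 0" by simp
    qed
    show "AE x in ?M. norm ((norm (D\<phi> n x - Dv x))\<^sup>2) \<le> (2 * B1 * B4 + B2 * (4 * B3))\<^sup>2" for n
    proof (rule AE_I2)
      fix x assume "x \<in> space (?M)"
      then have x: "x \<in> \<Omega>" by simp
      have "norm (D\<phi> n x - Dv x) \<le> \<bar>cutoff (\<epsilon> n) (\<rho> x) - \<rho> x\<bar> * norm (Dp x) + \<bar>p x\<bar> * (\<bar>cutoff' (\<epsilon> n) (\<rho> x) - 1\<bar> * norm (D\<rho> x))"
        unfolding eq by (rule norm_triangle_le) (simp add: abs_mult)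
      also have "\<dots> \<le> (2 * B1) * B4 + B2 * (4 * B3)"
        using abs_cutoff_le[OF e[of n], of "\<rho> x"] abs_cutoff'_le[OF e[of n], of "\<rho> x"] B1[OF x] B2[OF x] B3[OF x] B4[OF x]
        by (intro add_mono mult_mono) auto
      finally have "(norm (D\<phi> n x - Dv x))\<^sup>2 \<le> (2 * B1 * B4 + B2 * (4 * B3))\<^sup>2" by (intro power_mono) auto
      then show "norm ((norm (D\<phi> n x - Dv x))\<^sup>2) \<le> (2 * B1 * B4 + B2 * (4 * B3))\<^sup>2" by simp
    qed
  qed auto
  ultimately have "H10 \<Omega> v Dv"
    unfolding H10_def using C1 L2_on_continuous[OF contv bnd meas] L2_on_continuous[OF contDv bnd meas]
    by (intro conjI exI[of _ \<phi>] exI[of _ D\<phi>]) auto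
  then show ?thesis by (simp add: \<Omega>_def v_def Dv_def)
qed

section \<open>Moments of eigenfunctions\<close>

definition zeta :: "real^2 \<Rightarrow> complex" where "zeta x = Complex (x $ 1) (x $ 2)"

definition zeta_inv :: "complex \<Rightarrow> real^2" where "zeta_inv z = (\<chi> i. if i = 1 then Re z else Im z)"

lemma bounded_linear_zeta: "bounded_linear zeta"
  by (intro linear_conv_bounded_linear[THEN iffD1] linearI) (auto simp: zeta_def complex_eq_iff)

lemma bounded_linear_zeta_inv: "bounded_linear zeta_inv"
  by (intro linear_conv_bounded_linear[THEN iffD1] linearI) (auto simp: zeta_inv_def vec_eq_iff)

lemma inner_zeta_inv: "inner h (zeta_inv z) = inner (zeta h) z"
  by (simp add: zeta_inv_def zeta_def inner_vec_def sum_2 inner_complex_def)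

lemma norm_zeta [simp]: "norm (zeta x) = norm x"
  by (simp add: zeta_def norm_vec_def L2_set_def sum_2 cmod_def)

lemma continuous_on_zeta [continuous_intros]: "continuous_on A zeta"
  by (rule linear_continuous_on[OF bounded_linear_zeta])

definition mon :: "nat \<Rightarrow> nat \<Rightarrow> real^2 \<Rightarrow> complex" where
  "mon a b x = zeta x ^ a * cnj (zeta x) ^ b"

lemma continuous_on_mon [continuous_intros]: "continuous_on A (mon a b)"
  unfolding mon_def[abs_def] by (intro continuous_intros)

lemma cnj_mon: "cnj (mon a b x) = mon b a x"
  by (simp add: mon_def mult.commute)

lemma norm_mon_le_1: "x \<in> ball 0 1 \<Longrightarrow> norm (mon a b x) \<le> 1"
  by (simp add: mon_def norm_mult norm_power mult_le_one power_le_one)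

text \<open>When an exponent is 0, the truncated \<open>a - 1\<close> or \<open>b - 1\<close> is
  harmless because the coefficient in front vanishes. The same applies to the gradient, the
  Laplacian and the moment recursion.\<close>

definition mon' :: "nat \<Rightarrow> nat \<Rightarrow> real^2 \<Rightarrow> real^2 \<Rightarrow> complex" where
  "mon' a b x h = of_nat a * mon (a - 1) b x * zeta h + of_nat b * mon a (b - 1) x * cnj (zeta h)"

lemma mon_deriv: "(mon a b has_derivative mon' a b x) (at x)"
proof -
  have 1: "(zeta has_derivative zeta) (at x)" by (rule bounded_linear_imp_has_derivative[OF bounded_linear_zeta])
  have 2: "((\<lambda>x. cnj (zeta x)) has_derivative (\<lambda>h. cnj (zeta h))) (at x)"
    by (rule bounded_linear.has_derivative[OF bounded_linear_cnj 1])
  have "((\<lambda>x. zeta x ^ a * cnj (zeta x) ^ b) has_derivative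
     (\<lambda>h. zeta x ^ a * (of_nat b * cnj (zeta h) * cnj (zeta x) ^ (b - 1))
        + of_nat a * zeta h * zeta x ^ (a - 1) * cnj (zeta x) ^ b)) (at x)"
    by (intro has_derivative_mult has_derivative_power 1 2)
  then show ?thesis by (simp add: mon_def[abs_def] mon'_def[abs_def] algebra_simps)
qed

definition test_fun :: "nat \<Rightarrow> nat \<Rightarrow> complex \<Rightarrow> real^2 \<Rightarrow> real" where
  "test_fun a b c x = Re (c * mon a b x)"

text \<open>Wirtinger calculus: read as a complex number, the gradient of Re f is the conjugate of
  the \<zeta>-derivative of f plus its derivative in cnj \<zeta>.\<close>

definition test_fun_grad :: "nat \<Rightarrow> nat \<Rightarrow> complex \<Rightarrow> real^2 \<Rightarrow> real^2" where
  "test_fun_grad a b c x = zeta_inv (cnj c * of_nat a * mon b (a - 1) x + c * of_nat b * mon a (b - 1) x)"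

definition test_fun_hess :: "nat \<Rightarrow> nat \<Rightarrow> complex \<Rightarrow> real^2 \<Rightarrow> real^2 \<Rightarrow> real^2" where
  "test_fun_hess a b c x h = zeta_inv (cnj c * of_nat a * mon' b (a - 1) x h + c * of_nat b * mon' a (b - 1) x h)"

lemma test_fun_gderiv: "GDERIV (test_fun a b c) x :> test_fun_grad a b c x"
  unfolding gderiv_def
proof (rule has_derivative_eq_rhs)
  show "(test_fun a b c has_derivative (\<lambda>h. Re (c * mon' a b x h))) (at x)"
    unfolding test_fun_def[abs_def]
    by (intro bounded_linear.has_derivative[OF bounded_linear_Re]
        bounded_linear.has_derivative[OF bounded_linear_mult_right] mon_deriv)
  show "(\<lambda>h. Re (c * mon' a b x h)) = (\<lambda>h. h \<bullet> test_fun_grad a b c x)"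
  proof
    fix h
    have Re_inner: "inner z w = Re (cnj w * z)" for z w :: complex by (simp add: inner_complex_def)
    have "inner (zeta h) (cnj c * of_nat a * mon b (a - 1) x) = Re (c * (of_nat a * mon (a - 1) b x * zeta h))"
      unfolding Re_inner by (simp add: cnj_mon mult.assoc)
    moreover have "inner (zeta h) (c * of_nat b * mon a (b - 1) x) = Re (c * (of_nat b * mon a (b - 1) x * cnj (zeta h)))"
      by (subst inner_commute, unfold Re_inner) (simp add: mult_ac)
    ultimately show "Re (c * mon' a b x h) = h \<bullet> test_fun_grad a b c x"
      unfolding test_fun_grad_def inner_zeta_inv inner_add_right mon'_def distrib_left by simp
  qed
qed

lemma test_fun_grad_deriv: "(test_fun_grad a b c has_derivative test_fun_hess a b c x) (at x)"
  unfolding test_fun_grad_def[abs_def] test_fun_hess_def[abs_def]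
  by (intro bounded_linear.has_derivative[OF bounded_linear_zeta_inv] has_derivative_add
      bounded_linear.has_derivative[OF bounded_linear_mult_right] mon_deriv)

lemma continuous_on_test_fun_hess: "continuous_on UNIV (\<lambda>x. test_fun_hess a b c x h)"
  unfolding test_fun_hess_def mon'_def
  by (intro bounded_linear.continuous_on[OF bounded_linear_zeta_inv] continuous_intros)

lemma continuous_on_test_fun_grad: "continuous_on UNIV (test_fun_grad a b c)"
  using test_fun_grad_deriv by (meson continuous_at_imp_continuous_on has_derivative_continuous)

text \<open>The Laplacian is four times the mixed Wirtinger derivative. Concretely, the real-linear
  map h |-> P h + Q cnj h has trace 2 Re P.\<close>

lemma test_fun_laplacian:
  "(\<Sum>e\<in>Basis. test_fun_hess a b c x e \<bullet> e) = test_fun (a - 1) (b - 1) (4 * of_nat a * of_nat b * c) x"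
proof -
  define P where "P = cnj c * of_nat a * (of_nat b * mon (b - 1) (a - 1) x) + c * of_nat b * (of_nat a * mon (a - 1) (b - 1) x)"
  define Q where "Q = cnj c * of_nat a * (of_nat (a - 1) * mon b (a - 1 - 1) x) + c * of_nat b * (of_nat (b - 1) * mon a (b - 1 - 1) x)"
  have H: "test_fun_hess a b c x h = zeta_inv (P * zeta h + Q * cnj (zeta h))" for h
    unfolding test_fun_hess_def mon'_def P_def Q_def by (simp add: algebra_simps)
  have B: "Basis = {axis 1 1, axis 2 (1::real) :: real^2}"
    by (auto simp: Basis_vec_def exhaust_2) (metis exhaust_2)
  have ax: "zeta (axis 1 1) = 1" "zeta (axis 2 1) = \<i>"
    by (auto simp: zeta_def axis_def complex_eq_iff)
  have ne: "axis 1 1 \<noteq> (axis 2 1 :: real^2)" by (simp add: axis_eq_axis)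
  have "(\<Sum>e\<in>Basis. test_fun_hess a b c x e \<bullet> e) = inner (P + Q) 1 + inner (P * \<i> + Q * cnj \<i>) \<i>"
    unfolding B using ne by (simp add: H inner_commute[of "zeta_inv _"] inner_zeta_inv ax inner_commute)
  also have "\<dots> = 2 * Re P" by (simp add: inner_complex_def)
  also have "Re P = Re (c * of_nat b * (of_nat a * mon (a - 1) (b - 1) x)) * 2"
  proof -
    have "Re (cnj c * of_nat a * (of_nat b * mon (b - 1) (a - 1) x)) = Re (cnj (cnj c * of_nat a * (of_nat b * mon (b - 1) (a - 1) x)))"
      by simp
    also have "cnj (cnj c * of_nat a * (of_nat b * mon (b - 1) (a - 1) x)) = c * of_nat b * (of_nat a * mon (a - 1) (b - 1) x)"
      by (simp add: cnj_mon)
    finally show ?thesis unfolding P_def by simp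
  qed
  also have "2 * (Re (c * of_nat b * (of_nat a * mon (a - 1) (b - 1) x)) * 2)
    = Re (4 * (c * of_nat b * (of_nat a * mon (a - 1) (b - 1) x)))" by simp
  also have "\<dots> = test_fun (a - 1) (b - 1) (4 * of_nat a * of_nat b * c) x"
    unfolding test_fun_def by (simp only: mult_ac)
  finally show ?thesis .
qed

lemma test_fun_minus: "test_fun a b c x - test_fun (Suc a) (Suc b) c x = (1 - (norm x)\<^sup>2) * test_fun a b c x"
proof -
  have "mon (Suc a) (Suc b) x = (zeta x * cnj (zeta x)) * mon a b x" by (simp add: mon_def)
  also have "zeta x * cnj (zeta x) = of_real ((norm x)\<^sup>2)"
    using complex_norm_square[of "zeta x"] by simp
  finally have *: "c * mon (Suc a) (Suc b) x = of_real ((norm x)\<^sup>2) * (c * mon a b x)" by simp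
  have "Re (of_real r * w) = r * Re w" for r w by simp
  then have "test_fun (Suc a) (Suc b) c x = (norm x)\<^sup>2 * test_fun a b c x"
    unfolding test_fun_def * by simp
  then show ?thesis by (simp add: algebra_simps)
qed

text \<open>Since |x|^2 = \<zeta> cnj \<zeta>, multiplying a monomial by 1 - |x|^2 gives a
  difference of two monomials. Writing the gradient as a difference too, by uniqueness of
  derivatives, lets the Laplacian be taken term by term.\<close>

lemma H10_test_fun: "H10 (ball 0 1) (\<lambda>x. test_fun a b c x - test_fun (Suc a) (Suc b) c x)
    (\<lambda>x. test_fun_grad a b c x - test_fun_grad (Suc a) (Suc b) c x)"
proof -
  define \<rho> where "\<rho> = (\<lambda>x::real^2. test_fun 0 0 1 x - test_fun 1 1 1 x)"
  define D\<rho> where "D\<rho> = (\<lambda>x::real^2. test_fun_grad 0 0 1 x - test_fun_grad 1 1 1 x)"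
  have \<rho>: "\<rho> x = 1 - (norm x)\<^sup>2" for x
    using test_fun_minus[of 0 0 1 x] by (simp add: \<rho>_def test_fun_def mon_def)
  have ball: "{x. \<rho> x > 0} = ball 0 1"
    unfolding \<rho> by (auto simp: power_less_one_iff abs_square_less_1)
  have \<rho>': "GDERIV \<rho> x :> D\<rho> x" for x unfolding \<rho>_def D\<rho>_def by (intro GDERIV_diff test_fun_gderiv)
  have cont: "continuous_on UNIV D\<rho>" unfolding D\<rho>_def by (intro continuous_intros continuous_on_test_fun_grad)
  have "H10 (ball 0 1) (\<lambda>x. \<rho> x * test_fun a b c x) (\<lambda>x. \<rho> x *\<^sub>R test_fun_grad a b c x + test_fun a b c x *\<^sub>R D\<rho> x)"
    unfolding ball[symmetric]
    by (rule H10_defining_function_mult[OF \<rho>' cont test_fun_gderiv continuous_on_test_fun_grad]) (simp add: ball)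
  also have eq: "(\<lambda>x. \<rho> x * test_fun a b c x) = (\<lambda>x. test_fun a b c x - test_fun (Suc a) (Suc b) c x)"
    by (simp add: test_fun_minus \<rho>)
  also have "(\<lambda>x. \<rho> x *\<^sub>R test_fun_grad a b c x + test_fun a b c x *\<^sub>R D\<rho> x) = (\<lambda>x. test_fun_grad a b c x - test_fun_grad (Suc a) (Suc b) c x)"
  proof
    fix x
    have "GDERIV (\<lambda>x. \<rho> x * test_fun a b c x) x :> \<rho> x *\<^sub>R test_fun_grad a b c x + test_fun a b c x *\<^sub>R D\<rho> x"
      by (rule GDERIV_mult[OF \<rho>' test_fun_gderiv])
    moreover have "GDERIV (\<lambda>x. \<rho> x * test_fun a b c x) x :> test_fun_grad a b c x - test_fun_grad (Suc a) (Suc b) c x"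
      unfolding eq by (intro GDERIV_diff test_fun_gderiv)
    ultimately have "(\<lambda>h. h \<bullet> (\<rho> x *\<^sub>R test_fun_grad a b c x + test_fun a b c x *\<^sub>R D\<rho> x))
        = (\<lambda>h. h \<bullet> (test_fun_grad a b c x - test_fun_grad (Suc a) (Suc b) c x))"
      unfolding gderiv_def by (rule has_derivative_unique)
    from fun_cong[OF this] show "\<rho> x *\<^sub>R test_fun_grad a b c x + test_fun a b c x *\<^sub>R D\<rho> x = test_fun_grad a b c x - test_fun_grad (Suc a) (Suc b) c x"
      by (rule vector_eq_ldot[THEN iffD1, OF allI])
  qed
  finally show ?thesis .
qed

section \<open>Moments on the disk and their recursion\<close>

abbreviation disk :: "(real^2) measure" where "disk \<equiv> lebesgue_on (ball 0 1)"

definition moment :: "(real^2 \<Rightarrow> real) \<Rightarrow> nat \<Rightarrow> nat \<Rightarrow> complex" where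
  "moment u a b = (\<integral>x. of_real (u x) * mon a b x \<partial>disk)"

lemma L2_on_integrable_mult_continuous:
  fixes u :: "real^2 \<Rightarrow> real" and g :: "real^2 \<Rightarrow> complex"
  assumes "L2_on (ball 0 1) u" "continuous_on UNIV g"
  shows "integrable (disk) (\<lambda>x. of_real (u x) * g x)"
proof -
  have lm: "ball (0::real^2) 1 \<in> lmeasurable" by simp
  interpret finite_measure "lebesgue_on (ball (0::real^2) 1)" by (rule finite_measure_lebesgue_on[OF lm])
  obtain B where B: "\<And>x. x \<in> ball 0 1 \<Longrightarrow> norm (g x) \<le> B"
    by (rule continuous_bounded_on[OF assms(2) bounded_ball]) (rule that)
  have m: "u \<in> borel_measurable (disk)" "g \<in> borel_measurable (disk)"
    using assms by (auto simp: L2_on_def intro!: continuous_imp_measurable_on_sets_lebesgue intro: continuous_on_subset)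
  show ?thesis
  proof (rule Bochner_Integration.integrable_bound)
    show "integrable (disk) (\<lambda>x. (norm (u x))\<^sup>2 + B\<^sup>2)" using assms(1) by (simp add: L2_on_def)
    have "norm (of_real (u x) * g x) \<le> norm ((norm (u x))\<^sup>2 + B\<^sup>2)" if "x \<in> ball 0 1" for x
    proof -
      have "norm (of_real (u x) * g x) \<le> \<bar>u x\<bar> * B"
        using B[OF that] by (simp add: norm_mult mult_left_mono)
      also have "0 \<le> (\<bar>u x\<bar> - B)\<^sup>2 + \<bar>u x\<bar>\<^sup>2 + B\<^sup>2" by simp
      then have "\<bar>u x\<bar> * B \<le> \<bar>u x\<bar>\<^sup>2 + B\<^sup>2" by (simp only: power2_eq_square algebra_simps)
      finally show ?thesis by simp
    qed
    then show "AE x in disk. norm (of_real (u x) * g x) \<le> norm ((norm (u x))\<^sup>2 + B\<^sup>2)"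
      by (intro AE_I2) simp
    show "(\<lambda>x. of_real (u x) * g x) \<in> borel_measurable (disk)" using m by measurable
  qed
qed

lemma integral_test_fun:
  assumes "L2_on (ball 0 1) u"
  shows "integrable (disk) (\<lambda>x. u x * test_fun a b c x)"
    "(\<integral>x. u x * test_fun a b c x \<partial>disk) = Re (c * moment u a b)"
proof -
  have i: "integrable (disk) (\<lambda>x. of_real (u x) * mon a b x)"
    by (rule L2_on_integrable_mult_continuous[OF assms continuous_on_mon])
  have bl: "bounded_linear (\<lambda>z. Re (c * z))"
    by (rule bounded_linear_compose[OF bounded_linear_Re bounded_linear_mult_right])
  have eq: "Re (c * (of_real (u x) * mon a b x)) = u x * test_fun a b c x" for x
    by (simp add: test_fun_def algebra_simps)
  show "integrable (disk) (\<lambda>x. u x * test_fun a b c x)"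
    using integrable_bounded_linear[OF bl i] unfolding eq .
  show "(\<integral>x. u x * test_fun a b c x \<partial>disk) = Re (c * moment u a b)"
    using integral_bounded_linear[OF bl i] unfolding eq moment_def .
qed

text \<open>The weak equation is tested with v = (1 - |x|^2) Re (c \<open>mon a b\<close>), and
  \<open>green_H10\<close> moves the second gradient onto v, so both sides become moments of
  u.\<close>

lemma eigenfunction_moment_recursion:
  assumes "u \<in> dirichlet_eigenspace (ball 0 1) \<mu>"
  shows "4 * of_nat a * of_nat b * moment u (a - 1) (b - 1) + of_real \<mu> * moment u a b
    = 4 * of_nat (Suc a) * of_nat (Suc b) * moment u a b + of_real \<mu> * moment u (Suc a) (Suc b)"
proof -
  obtain Du where Du: "H10 (ball 0 1) u Du"
    "\<And>v Dv. H10 (ball 0 1) v Dv \<Longrightarrow> (\<integral>x. Du x \<bullet> Dv x \<partial>disk) = (\<integral>x. \<mu> * u x * v x \<partial>disk)"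
    using assms unfolding dirichlet_eigenspace_def dirichlet_laplacian_def by auto
  have L2: "L2_on (ball 0 1) u" using Du(1) by (simp add: H10_def)
  note i = integral_test_fun[OF L2]
  define Z where "Z = 4 * of_nat a * of_nat b * moment u (a - 1) (b - 1) + of_real \<mu> * moment u a b
    - (4 * of_nat (Suc a) * of_nat (Suc b) * moment u a b + of_real \<mu> * moment u (Suc a) (Suc b))"
  have "Re (c * Z) = 0" for c
  proof -
    let ?R = "Re (4 * of_nat a * of_nat b * c * moment u (a - 1) (b - 1))
      - Re (4 * of_nat (Suc a) * of_nat (Suc b) * c * moment u a b)"
    let ?T = "Re (c * moment u a b) - Re (c * moment u (Suc a) (Suc b))"
    let ?E = "4 * of_nat a * of_nat b * c * moment u (a - 1) (b - 1)
       - 4 * of_nat (Suc a) * of_nat (Suc b) * c * moment u a b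
       + of_real \<mu> * (c * moment u a b - c * moment u (Suc a) (Suc b))"
    let ?v = "\<lambda>x. test_fun a b c x - test_fun (Suc a) (Suc b) c x"
    let ?V = "\<lambda>x. test_fun_grad a b c x - test_fun_grad (Suc a) (Suc b) c x"
    let ?H = "\<lambda>x h. test_fun_hess a b c x h - test_fun_hess (Suc a) (Suc b) c x h"
    let ?M = "lebesgue_on (ball (0::real^2) 1)"
    have lap: "(\<Sum>e\<in>Basis. ?H x e \<bullet> e) = test_fun (a - 1) (b - 1) (4 * of_nat a * of_nat b * c) x
       - test_fun a b (4 * of_nat (Suc a) * of_nat (Suc b) * c) x" for x
      using test_fun_laplacian[of a b c x] test_fun_laplacian[of "Suc a" "Suc b" c x]
      by (simp only: inner_diff_left sum_subtractf diff_Suc_1)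
    let ?I = "\<integral>x. Du x \<bullet> ?V x \<partial>?M"
    have i': "(\<integral>x. u x * (\<Sum>e\<in>Basis. ?H x e \<bullet> e) \<partial>?M)
      = ?R"
      unfolding lap right_diff_distrib using i by (subst Bochner_Integration.integral_diff) auto
    have "?I = - (\<integral>x. u x * (\<Sum>e\<in>Basis. ?H x e \<bullet> e) \<partial>?M)"
    proof (rule green_H10[OF Du(1) bounded_ball])
      show "(?V has_derivative ?H x) (at x)" for x by (intro has_derivative_diff test_fun_grad_deriv)
      show "continuous_on UNIV (\<lambda>x. ?H x e)" for e by (intro continuous_intros continuous_on_test_fun_hess)
    qed simp
    note f1 = this[unfolded i']
    have "?I = (\<integral>x. \<mu> * u x * ?v x \<partial>?M)" by (rule Du(2)[OF H10_test_fun])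
    also have "\<dots> = (\<integral>x. \<mu> * (u x * test_fun a b c x - u x * test_fun (Suc a) (Suc b) c x) \<partial>?M)"
      by (simp only: right_diff_distrib mult.assoc)
    also have "\<dots> = \<mu> * (\<integral>x. u x * test_fun a b c x - u x * test_fun (Suc a) (Suc b) c x \<partial>?M)" by simp
    also have "(\<integral>x. u x * test_fun a b c x - u x * test_fun (Suc a) (Suc b) c x \<partial>?M)
      = ?T"
      using i by (subst Bochner_Integration.integral_diff) auto
    finally have f2: "?I = \<mu> * (?T)" .
    have "r + t = 0" if "y = - r" "y = t" for y r t :: real using that by simp
    from this[OF f1 f2] have "?R + \<mu> * (?T) = 0" .
    moreover have "\<mu> * (?T)
      = Re (of_real \<mu> * (c * moment u a b - c * moment u (Suc a) (Suc b)))" by simp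
    ultimately have e1: "Re (?E) = 0"
      by (simp only: minus_complex.sel plus_complex.sel)
    have e2: "?E = c * Z"
      unfolding Z_def by (simp only: algebra_simps)
    show ?thesis by (rule e1[unfolded e2])
  qed
  \<comment> \<open>The two choices of c extract the real and the imaginary part.\<close>
  from this[of 1] this[of "- \<i>"] have "Z = 0" by (simp add: complex_eq_iff)
  then show ?thesis unfolding Z_def by simp
qed

lemma norm_moment_le:
  assumes "L2_on (ball 0 1) u"
  shows "norm (moment u a b) \<le> (\<integral>x. \<bar>u x\<bar> \<partial>disk)"
  unfolding moment_def
proof (rule Bochner_Integration.integral_norm_bound_integral)
  show "integrable (disk) (\<lambda>x. of_real (u x) * mon a b x)"
    by (rule L2_on_integrable_mult_continuous[OF assms continuous_on_mon])
  have "integrable (disk) (\<lambda>x. of_real (u x) * (1::complex))"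
    by (rule L2_on_integrable_mult_continuous[OF assms]) (rule continuous_on_const)
  from integrable_norm[OF this] show "integrable (disk) (\<lambda>x. \<bar>u x\<bar>)" by simp
  fix x :: "real^2" assume "x \<in> space (disk)"
  then have "norm (mon a b x) \<le> 1" by (intro norm_mon_le_1) simp
  then show "norm (of_real (u x) * mon a b x) \<le> \<bar>u x\<bar>" by (simp add: norm_mult mult_left_le)
qed

text \<open>The recursion forces \<open>c\<^sub>j s\<^sub>j = c\<^sub>0 (s\<^sub>0 + \<dots> + s\<^sub>j)\<close> where the \<open>s\<^sub>j\<close> are the terms of the Bessel
  series, so bounded solutions vanish unless the series does.\<close>

lemma bounded_moment_sequence:
  fixes c :: "nat \<Rightarrow> complex" and \<mu> :: real
  assumes rec: "\<And>j. 4 * of_nat j * of_nat (j + m) * c (j - 1) + of_real \<mu> * c j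
      = 4 * of_nat (Suc j) * of_nat (Suc j + m) * c j + of_real \<mu> * c (Suc j)"
    and bnd: "\<And>j. norm (c j) \<le> B"
  shows "c 0 = 0 \<or> bessel_series m \<mu> = 0" "c 0 = 0 \<Longrightarrow> c j = 0"
proof -
  \<comment> \<open>The recursion says that 4 j (j + m) c_(j-1) + \<mu> c_j does not depend on j; at
    j = 0 it is \<mu> c_0.\<close>
  have const: "4 * of_nat (Suc j) * of_nat (Suc j + m) * c j + of_real \<mu> * c (Suc j) = of_real \<mu> * c 0" for j
  proof (induction j)
    case 0
    show ?case using rec[of 0] by simp
  next
    case (Suc j)
    then show ?case using rec[of "Suc j"] by simp
  qed
  have zero: "c j = 0" if "\<mu> = 0" for j
    using const[of j] that by (simp del: of_nat_Suc of_nat_add)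
  show "c j = 0" if "c 0 = 0"
  proof (cases "\<mu> = 0")
    case False
    show ?thesis
    proof (induction j)
      case (Suc j)
      then show ?case using const[of j] that False by simp
    qed (rule that)
  qed (rule zero)
  define s where "s = (\<lambda>j. bessel_coeff m j * \<mu> ^ j)"
  have s_Suc: "s (Suc j) * (4 * real (Suc j) * real (Suc j + m)) = - \<mu> * s j" for j
    unfolding s_def bessel_coeff_def by (simp add: divide_simps del: of_nat_Suc of_nat_add)
  have s_sum: "s sums bessel_series m \<mu>"
    using summable_sums[OF summable_bessel_series[of m \<mu>]] by (simp add: s_def bessel_series_def)
  show "c 0 = 0 \<or> bessel_series m \<mu> = 0"
  proof (cases "\<mu> = 0")
    case True
    then show ?thesis using zero by simp
  next
    case False
    have sc: "of_real (s j) * c j = c 0 * of_real (\<Sum>i<Suc j. s i)" for j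
    proof (induction j)
      case 0
      show ?case by (simp add: s_def bessel_coeff_def)
    next
      case (Suc j)
      have "of_real \<mu> * (of_real (s (Suc j)) * c (Suc j))
        = of_real (s (Suc j)) * (of_real \<mu> * c 0 - 4 * of_nat (Suc j) * of_nat (Suc j + m) * c j)"
        unfolding const[of j, symmetric] by (simp only: add_diff_cancel_left' mult.left_commute)
      also have "\<dots> = of_real \<mu> * c 0 * of_real (s (Suc j)) - of_real (s (Suc j) * (4 * real (Suc j) * real (Suc j + m))) * c j"
        by (simp add: algebra_simps)
      also have "\<dots> = of_real \<mu> * (c 0 * of_real (s (Suc j)) + of_real (s j) * c j)"
        unfolding s_Suc by (simp add: algebra_simps)
      finally have "of_real (s (Suc j)) * c (Suc j) = c 0 * of_real (s (Suc j)) + of_real (s j) * c j"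
        using False by simp
      then show ?case unfolding Suc by (simp add: algebra_simps)
    qed
    have "(\<lambda>j. of_real (s j) * c j) \<longlonglongrightarrow> 0"
    proof (rule Lim_null_comparison)
      show "\<forall>\<^sub>F j in sequentially. norm (of_real (s j) * c j) \<le> \<bar>s j\<bar> * B"
        using bnd by (intro always_eventually allI) (simp add: norm_mult mult_left_mono)
      have "(\<lambda>j. \<bar>s j\<bar> * B) \<longlonglongrightarrow> \<bar>0\<bar> * B"
        by (intro tendsto_intros summable_LIMSEQ_zero sums_summable[OF s_sum])
      then show "(\<lambda>j. \<bar>s j\<bar> * B) \<longlonglongrightarrow> 0" by simp
    qed
    moreover have "(\<lambda>j. c 0 * of_real (\<Sum>i<Suc j. s i)) \<longlonglongrightarrow> c 0 * of_real (bessel_series m \<mu>)"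
      using LIMSEQ_Suc[OF s_sum[unfolded sums_def]] by (intro tendsto_intros)
    ultimately have "c 0 * of_real (bessel_series m \<mu>) = 0"
      unfolding sc by (rule LIMSEQ_unique[symmetric])
    then show ?thesis by simp
  qed
qed

section \<open>Completeness of polynomials\<close>

text \<open>The free factor \<open>g\<close> is what makes the product case of the induction work:
  f1 f2 g is treated as f1 times (f2 g). A linear form is k \<zeta> + cnj (k \<zeta>), so it only
  shifts the exponents of \<open>mon\<close>.\<close>

lemma polynomial_integral_eq_0:
  assumes u: "L2_on (ball 0 1) u" and p: "real_polynomial_function p"
    and g: "continuous_on UNIV g"
    and zero: "\<And>a b. (\<integral>x. of_real (u x) * (of_real (g x) * mon a b x) \<partial>disk) = 0"
  shows "(\<integral>x. of_real (u x) * (of_real (p x * g x) * mon a b x) \<partial>disk) = 0"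
  using p g zero
proof (induction p arbitrary: g a b)
  case (linear f)
  define k where "k = (of_real (f (axis 1 1)) - \<i> * of_real (f (axis 2 1))) / 2"
  have fx: "of_real (f x) = k * zeta x + cnj k * cnj (zeta x)" for x
  proof -
    have "x = (x $ 1) *\<^sub>R axis 1 1 + (x $ 2) *\<^sub>R axis 2 1"
      by (simp add: vec_eq_iff axis_def forall_2)
    then have "f x = f ((x $ 1) *\<^sub>R axis 1 1 + (x $ 2) *\<^sub>R axis 2 1)" by (rule arg_cong)
    also have "\<dots> = (x $ 1) * f (axis 1 1) + (x $ 2) * f (axis 2 1)"
      using linear.hyps by (simp add: linear_add linear_scale bounded_linear.linear)
    finally show ?thesis unfolding k_def zeta_def by (simp add: complex_eq_iff field_simps)
  qed
  have m: "mon (Suc a) b x = zeta x * mon a b x" "mon a (Suc b) x = cnj (zeta x) * mon a b x" for x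
    by (simp_all add: mon_def)
  have i: "integrable (disk) (\<lambda>x. of_real (u x) * (of_real (g x) * mon a b x))" for a b
    by (rule L2_on_integrable_mult_continuous[OF u]) (intro continuous_intros linear.prems)
  have "(\<integral>x. of_real (u x) * (of_real (f x * g x) * mon a b x) \<partial>disk)
    = (\<integral>x. k * (of_real (u x) * (of_real (g x) * mon (Suc a) b x))
        + cnj k * (of_real (u x) * (of_real (g x) * mon a (Suc b) x)) \<partial>disk)"
    unfolding m by (intro Bochner_Integration.integral_cong refl) (simp add: fx algebra_simps)
  also have "\<dots> = k * (\<integral>x. of_real (u x) * (of_real (g x) * mon (Suc a) b x) \<partial>disk)
      + cnj k * (\<integral>x. of_real (u x) * (of_real (g x) * mon a (Suc b) x) \<partial>disk)"
    using i by (subst Bochner_Integration.integral_add) auto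
  also have "\<dots> = 0" by (simp add: linear.prems)
  finally show ?case .
next
  case (const c)
  have "(\<integral>x. of_real (u x) * (of_real (c * g x) * mon a b x) \<partial>disk)
    = (\<integral>x. of_real c * (of_real (u x) * (of_real (g x) * mon a b x)) \<partial>disk)"
    by (intro Bochner_Integration.integral_cong refl) (simp add: algebra_simps)
  also have "\<dots> = of_real c * (\<integral>x. of_real (u x) * (of_real (g x) * mon a b x) \<partial>disk)"
    by (rule integral_mult_right_zero)
  finally show ?case by (simp add: const.prems)
next
  case (add f1 f2)
  have i: "integrable (disk) (\<lambda>x. of_real (u x) * (of_real (f x * g x) * mon a b x))"
    if "real_polynomial_function f" for f
    by (rule L2_on_integrable_mult_continuous[OF u])
       (intro continuous_intros add.prems continuous_on_polymonial_function real_polynomial_function_eq[THEN iffD1] that)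
  have "(\<integral>x. of_real (u x) * (of_real ((f1 x + f2 x) * g x) * mon a b x) \<partial>disk)
    = (\<integral>x. of_real (u x) * (of_real (f1 x * g x) * mon a b x)
         + of_real (u x) * (of_real (f2 x * g x) * mon a b x) \<partial>disk)"
    by (intro Bochner_Integration.integral_cong refl) (simp add: algebra_simps)
  also have "\<dots> = (\<integral>x. of_real (u x) * (of_real (f1 x * g x) * mon a b x) \<partial>disk)
      + (\<integral>x. of_real (u x) * (of_real (f2 x * g x) * mon a b x) \<partial>disk)"
    by (rule Bochner_Integration.integral_add) (intro i add.hyps)+
  also have "\<dots> = 0" using add.IH[OF add.prems] by simp
  finally show ?case .
next
  case (mult f1 f2)
  have "continuous_on UNIV (\<lambda>x. f2 x * g x)"
    by (intro continuous_intros mult.prems continuous_on_polymonial_function real_polynomial_function_eq[THEN iffD1] mult.hyps)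
  from mult.IH(1)[OF this mult.IH(2)[OF mult.prems]] show ?case by (simp add: mult.assoc)
qed

lemma zero_moments_polynomial:
  assumes u: "L2_on (ball 0 1) u" and zero: "\<And>a b. moment u a b = 0" and p: "real_polynomial_function p"
  shows "(\<integral>x. u x * p x \<partial>disk) = 0"
proof -
  have cont: "continuous_on UNIV p"
    using p by (intro continuous_on_polymonial_function real_polynomial_function_eq[THEN iffD1])
  have "(\<integral>x. of_real (u x) * (of_real (p x * 1) * mon 0 0 x) \<partial>disk) = 0"
    by (rule polynomial_integral_eq_0[OF u p]) (use zero in \<open>auto simp: moment_def\<close>)
  then have "(\<integral>x. complex_of_real (u x * p x) \<partial>disk) = 0" by (simp add: mon_def)
  then show ?thesis by (simp only: integral_complex_of_real of_real_eq_0_iff)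
qed

lemma L2_on_integrable_mult_continuous_real:
  fixes u g :: "real^2 \<Rightarrow> real"
  assumes "L2_on (ball 0 1) u" "continuous_on UNIV g"
  shows "integrable (disk) (\<lambda>x. u x * g x)"
proof -
  have "continuous_on UNIV (\<lambda>x. complex_of_real (g x))" by (intro continuous_intros assms)
  from integrable_Re[OF L2_on_integrable_mult_continuous[OF assms(1) this]] show ?thesis by simp
qed

lemma zero_moments_continuous:
  assumes u: "L2_on (ball 0 1) u" and zero: "\<And>a b. moment u a b = 0" and g: "continuous_on UNIV g"
  shows "(\<integral>x. u x * g x \<partial>disk) = 0"
proof -
  define I where "I = (\<integral>x. \<bar>u x\<bar> \<partial>disk)"
  have iu: "integrable (disk) (\<lambda>x. \<bar>u x\<bar>)"
    using integrable_abs[OF L2_on_integrable_mult_continuous_real[OF u continuous_on_const[of _ 1]]] by simp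
  have "\<bar>\<integral>x. u x * g x \<partial>disk\<bar> \<le> e * I" if "e > 0" for e
  proof -
    obtain p where p: "real_polynomial_function p" "\<And>x. x \<in> cball 0 1 \<Longrightarrow> \<bar>g x - p x\<bar> < e"
      using Stone_Weierstrass_real_polynomial_function[OF compact_cball continuous_on_subset[OF g subset_UNIV] \<open>e > 0\<close>, of 0 1]
      by auto
    have cont: "continuous_on UNIV p"
      using p(1) by (intro continuous_on_polymonial_function real_polynomial_function_eq[THEN iffD1])
    have "(\<integral>x. u x * g x \<partial>disk) = (\<integral>x. u x * g x \<partial>disk) - (\<integral>x. u x * p x \<partial>disk)"
      using zero_moments_polynomial[OF u zero p(1)] by simp
    also have "\<dots> = (\<integral>x. u x * g x - u x * p x \<partial>disk)"
      by (intro Bochner_Integration.integral_diff[symmetric] L2_on_integrable_mult_continuous_real[OF u] g cont)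
    also have "\<bar>\<dots>\<bar> \<le> (\<integral>x. e * \<bar>u x\<bar> \<partial>disk)"
      unfolding real_norm_def[symmetric]
    proof (rule Bochner_Integration.integral_norm_bound_integral)
      show "integrable (disk) (\<lambda>x. u x * g x - u x * p x)"
        by (intro Bochner_Integration.integrable_diff L2_on_integrable_mult_continuous_real[OF u] g cont)
      show "integrable (disk) (\<lambda>x. e * norm (u x))" using iu by simp
      fix x :: "real^2" assume "x \<in> space (disk)"
      then have "\<bar>g x - p x\<bar> \<le> e" using p(2)[of x] by simp
      then have "\<bar>u x\<bar> * \<bar>g x - p x\<bar> \<le> \<bar>u x\<bar> * e" by (intro mult_left_mono) auto
      then have "\<bar>u x * (g x - p x)\<bar> \<le> e * \<bar>u x\<bar>" by (simp only: abs_mult mult.commute)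
      then show "norm (u x * g x - u x * p x) \<le> e * norm (u x)"
        by (simp only: real_norm_def right_diff_distrib)
    qed
    also have "\<dots> = e * I" by (simp add: I_def)
    finally show ?thesis .
  qed
  moreover have "I \<ge> 0" unfolding I_def by simp
  ultimately have "\<bar>\<integral>x. u x * g x \<partial>disk\<bar> \<le> 0 + e" if "e > 0" for e
  proof -
    have "\<bar>\<integral>x. u x * g x \<partial>disk\<bar> \<le> e / (I + 1) * I"
      using \<open>\<And>e. e > 0 \<Longrightarrow> _ \<le> e * I\<close>[of "e / (I + 1)"] that \<open>I \<ge> 0\<close> by simp
    also have "\<dots> \<le> e" using that \<open>I \<ge> 0\<close> by (simp add: field_simps)
    finally show ?thesis by simp
  qed
  then have "\<bar>\<integral>x. u x * g x \<partial>disk\<bar> \<le> 0" by (rule field_le_epsilon)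
  then show ?thesis by simp
qed

lemma infdist_indicator_tendsto:
  fixes T :: "'a::metric_space set"
  assumes "closed T" "T \<noteq> {}"
  shows "(\<lambda>n. max 0 (1 - real n * infdist x T)) \<longlonglongrightarrow> indicator T x"
proof (cases "x \<in> T")
  case True
  then show ?thesis by simp
next
  case False
  then have d: "infdist x T > 0" using assms by (simp add: infdist_pos_not_in_closed)
  obtain N :: nat where N: "1 / infdist x T < N" using reals_Archimedean2 by blast
  have "max 0 (1 - real n * infdist x T) = 0" if "n \<ge> N" for n
  proof -
    have "1 / infdist x T < real n" using N that by (meson le_less_trans less_le_trans of_nat_le_iff)
    then show ?thesis using d by (simp add: field_simps)
  qed
  then have "\<forall>\<^sub>F n in sequentially. max 0 (1 - real n * infdist x T) = 0"
    unfolding eventually_sequentially by blast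
  then show ?thesis using False by (simp add: tendsto_eventually)
qed

text \<open>The indicator of a closed set is the pointwise limit of continuous functions with values
  in [0, 1], so |u| dominates.\<close>

lemma zero_moments_closed:
  assumes u: "L2_on (ball 0 1) u" and zero: "\<And>a b. moment u a b = 0" and T: "closed T"
  shows "(\<integral>x. u x * indicator T x \<partial>disk) = 0"
proof (cases "T = {}")
  case False
  define g where "g = (\<lambda>n x. max 0 (1 - real n * infdist x T))"
  have cont: "continuous_on UNIV (g n)" for n
    unfolding g_def by (intro continuous_intros)
  have iu: "integrable (disk) (\<lambda>x. \<bar>u x\<bar>)"
    using integrable_abs[OF L2_on_integrable_mult_continuous_real[OF u continuous_on_const[of _ 1]]] by simp
  have um: "u \<in> borel_measurable (disk)" using u by (simp add: L2_on_def)
  have "(\<lambda>n. \<integral>x. u x * g n x \<partial>disk) \<longlonglongrightarrow> (\<integral>x. u x * indicator T x \<partial>disk)"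
  proof (rule integral_dominated_convergence)
    show "integrable (disk) (\<lambda>x. \<bar>u x\<bar>)" by (rule iu)
    have lim: "(\<lambda>n. u x * g n x) \<longlonglongrightarrow> u x * indicator T x" for x
      unfolding g_def by (intro tendsto_intros infdist_indicator_tendsto T False)
    then show "AE x in disk. (\<lambda>n. u x * g n x) \<longlonglongrightarrow> u x * indicator T x" by simp
    show m: "(\<lambda>x. u x * g n x) \<in> borel_measurable (disk)" for n
      using L2_on_integrable_mult_continuous_real[OF u cont] by (rule borel_measurable_integrable)
    show "(\<lambda>x. u x * indicator T x) \<in> borel_measurable (disk)"
      by (rule borel_measurable_LIMSEQ_metric[OF m lim])
    have "\<bar>u x\<bar> * \<bar>g n x\<bar> \<le> \<bar>u x\<bar> * 1" for n x
      unfolding g_def using infdist_nonneg[of x T] by (intro mult_left_mono) auto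
    then show "AE x in disk. norm (u x * g n x) \<le> \<bar>u x\<bar>" for n
      by (intro AE_I2) (simp add: abs_mult)
  qed
  then show ?thesis unfolding zero_moments_continuous[OF u zero cont] by (metis LIMSEQ_unique tendsto_const)
qed simp

text \<open>Inner regularity fills {u >= d} by a closed set T up to measure e. The integral of u
  over T is 0 and at least d times the measure of T, so T is a null set and {u >= d} has measure at
  most e.\<close>

lemma zero_moments_nonpos:
  assumes u: "L2_on (ball 0 1) u" and zero: "\<And>a b. moment u a b = 0"
  shows "AE x in disk. u x \<le> 0"
proof -
  let ?M = "lebesgue_on (ball (0::real^2) 1)"
  have um: "u \<in> borel_measurable ?M" using u by (simp add: L2_on_def)
  have null: "{x \<in> ball 0 1. d \<le> u x} \<in> null_sets lebesgue" if d: "d > 0" for d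
  proof -
    define A where "A = {x \<in> ball 0 1. d \<le> u x}"
    have "{x \<in> space ?M. d \<le> u x} \<in> sets ?M" using um by measurable
    then have A: "A \<in> sets lebesgue" by (simp add: A_def sets_restrict_space_iff)
    have le: "emeasure lebesgue A \<le> 0 + ennreal e" if "e > 0" for e
    proof -
      obtain T where T: "closed T" "T \<subseteq> A" "A - T \<in> lmeasurable" "emeasure lebesgue (A - T) < ennreal e"
        using sets_lebesgue_inner_closed[OF A \<open>e > 0\<close>] by blast
      have Ts: "T \<in> sets lebesgue" using T(1) by (simp add: borel_closed)
      have Tb: "T \<subseteq> ball 0 1" using T(2) by (auto simp: A_def)
      have Tm: "T \<in> sets ?M" using Ts Tb by (simp add: sets_restrict_space_iff)
      have fin: "finite_measure ?M" by (rule finite_measure_lebesgue_on) simp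
      have "integrable ?M (\<lambda>x. d * indicator T x)"
        using Tm finite_measure.emeasure_finite[OF fin] by (intro integrable_mult_right integrable_real_indicator) (auto simp: less_top)
      moreover have "integrable ?M (\<lambda>x. u x * indicator T x)"
        using integrable_real_mult_indicator[OF Tm L2_on_integrable_mult_continuous_real[OF u continuous_on_const[of _ 1]]] by simp
      ultimately have "(\<integral>x. d * indicator T x \<partial>?M) \<le> (\<integral>x. u x * indicator T x \<partial>?M)"
        using T(2) by (intro integral_mono) (auto simp: A_def indicator_def)
      also have "\<dots> = 0" by (rule zero_moments_closed[OF u zero T(1)])
      finally have "measure ?M T \<le> 0" using d Tm Int_absorb2[OF Tb] by (simp add: mult_le_0_iff)
      then have "measure ?M T = 0" using measure_nonneg[of ?M T] by simp
      then have "emeasure ?M T = 0" by (simp add: finite_measure.emeasure_eq_measure[OF fin])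
      then have T0: "emeasure lebesgue T = 0" using Tb by (simp add: emeasure_restrict_space)
      have "emeasure lebesgue A \<le> emeasure lebesgue T + emeasure lebesgue (A - T)"
        using emeasure_subadditive[OF Ts fmeasurableD[OF T(3)]] T(2) by (simp add: Un_absorb1 Un_Diff_cancel)
      then show ?thesis using T0 T(4) by simp
    qed
    have "emeasure lebesgue A \<le> 0" by (rule ennreal_le_epsilon) (rule le)
    then show ?thesis using A unfolding A_def[symmetric] by (simp add: null_sets_def)
  qed
  have "{x \<in> ball 0 1. \<not> u x \<le> 0} \<subseteq> (\<Union>n. {x \<in> ball 0 1. 1 / real (Suc n) \<le> u x})"
  proof
    fix x assume x: "x \<in> {x \<in> ball 0 1. \<not> u x \<le> 0}"
    then obtain n where "1 / real (Suc n) < u x" using nat_approx_posE[of "u x"] by auto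
    then show "x \<in> (\<Union>n. {x \<in> ball 0 1. 1 / real (Suc n) \<le> u x})" using x by (auto intro!: exI[of _ n])
  qed
  then have sub: "\<not> u x \<le> 0 \<Longrightarrow> x \<in> ball 0 1 \<Longrightarrow> x \<in> (\<Union>n. {x \<in> ball 0 1. 1 / real (Suc n) \<le> u x})" for x
    by (rule subsetD) simp
  have "(\<Union>n. {x \<in> ball 0 1. 1 / real (Suc n) \<le> u x}) \<in> null_sets lebesgue"
    by (intro null_sets_UN null) simp
  then have "AE x in lebesgue. x \<notin> (\<Union>n. {x \<in> ball 0 1. 1 / real (Suc n) \<le> u x})"
    by (rule AE_not_in)
  then have "AE x in lebesgue. x \<in> ball 0 1 \<longrightarrow> u x \<le> 0"
    by eventually_elim (use sub in blast)
  then show ?thesis by (subst AE_restrict_space_iff) simp_all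
qed

lemma zero_moments_AE:
  assumes u: "L2_on (ball 0 1) u" and zero: "\<And>a b. moment u a b = 0"
  shows "AE x in disk. u x = 0"
proof -
  have "L2_on (ball 0 1) (\<lambda>x. - u x)" using u by (simp add: L2_on_def)
  moreover have "moment (\<lambda>x. - u x) a b = 0" for a b
    using zero[of a b] by (simp add: moment_def)
  ultimately have "AE x in disk. - u x \<le> 0" by (rule zero_moments_nonpos)
  with zero_moments_nonpos[OF u zero] show ?thesis by eventually_elim simp
qed

section \<open>Counting eigenvalues\<close>

text \<open>Gaussian elimination: one equation with a nonzero entry is used to eliminate one unknown
  \<open>i0\<close>. Below, the equations are indexed by modes and the unknowns by
  eigenfunctions.\<close>

lemma homogeneous_system_nontrivial_solution:
  fixes A :: "'j \<Rightarrow> 'i \<Rightarrow> real"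
  assumes "finite J" "finite I" "card J < card I"
  shows "\<exists>c. (\<exists>i\<in>I. c i \<noteq> 0) \<and> (\<forall>j\<in>J. (\<Sum>i\<in>I. c i * A j i) = 0)"
  using assms
proof (induction J arbitrary: I A rule: finite_induct)
  case empty
  then obtain i where "i \<in> I" by fastforce
  then show ?case by (intro exI[of _ "\<lambda>_. 1"]) auto
next
  case (insert j0 J)
  show ?case
  proof (cases "\<forall>i\<in>I. A j0 i = 0")
    case True
    have "card J < card I" using insert by simp
    from insert.IH[OF insert.prems(1) this, of A] True show ?thesis by auto
  next
    case False
    then obtain i0 where i0: "i0 \<in> I" "A j0 i0 \<noteq> 0" by auto
    have "card J < card (I - {i0})" using insert i0 by simp
    from insert.IH[OF _ this, of "\<lambda>j i. A j i - A j i0 * (A j0 i / A j0 i0)"]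
    obtain c where c: "\<exists>i\<in>I - {i0}. c i \<noteq> 0"
      "\<And>j. j \<in> J \<Longrightarrow> (\<Sum>i\<in>I - {i0}. c i * (A j i - A j i0 * (A j0 i / A j0 i0))) = 0"
      using insert.prems by auto
    define c' where "c' = c(i0 := - (\<Sum>i\<in>I - {i0}. c i * A j0 i) / A j0 i0)"
    have sum: "(\<Sum>i\<in>I. c' i * A j i) = (\<Sum>i\<in>I - {i0}. c i * A j i) - (\<Sum>i\<in>I - {i0}. c i * A j0 i) / A j0 i0 * A j i0" for j
    proof -
      have "(\<Sum>i\<in>I. c' i * A j i) = c' i0 * A j i0 + (\<Sum>i\<in>I - {i0}. c' i * A j i)"
        by (rule sum.remove) (use insert.prems i0 in auto)
      also have "(\<Sum>i\<in>I - {i0}. c' i * A j i) = (\<Sum>i\<in>I - {i0}. c i * A j i)"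
        by (rule sum.cong) (auto simp: c'_def)
      finally show ?thesis by (simp add: c'_def)
    qed
    have "(\<Sum>i\<in>I. c' i * A j i) = 0" if "j \<in> insert j0 J" for j
    proof (cases "j = j0")
      case True
      then show ?thesis unfolding sum using i0 by simp
    next
      case False
      have "(\<Sum>i\<in>I - {i0}. c i * (A j i - A j i0 * (A j0 i / A j0 i0)))
        = (\<Sum>i\<in>I - {i0}. c i * A j i) - (\<Sum>i\<in>I - {i0}. c i * A j0 i) / A j0 i0 * A j i0"
        by (simp add: right_diff_distrib sum_subtractf sum_divide_distrib sum_distrib_right sum_distrib_left mult_ac)
      then show ?thesis unfolding sum using c(2)[of j] that False by simp
    qed
    moreover have "\<exists>i\<in>I. c' i \<noteq> 0" using c(1) by (auto simp: c'_def)
    ultimately show ?thesis by blast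
  qed
qed

text \<open>Both m and -m are listed: for m > 0 a complex moment imposes two real conditions, while
  the moment of mode 0 is real and imposes one.\<close>

definition angular_modes :: "real \<Rightarrow> int set" where
  "angular_modes \<mu> = {m. bessel_series (nat \<bar>m\<bar>) \<mu> = 0}"

lemma cnj_moment:
  assumes "L2_on (ball 0 1) u"
  shows "cnj (moment u a b) = moment u b a"
  using integral_bounded_linear[OF bounded_linear_cnj L2_on_integrable_mult_continuous[OF assms continuous_on_mon], of a b]
  by (simp add: moment_def cnj_mon)

text \<open>One real equation per mode (real part for m >= 0, imaginary part for m < 0) forces
  \<open>moment U m 0\<close> to vanish wherever the series is zero at \<mu>; elsewhere boundedness
  does so. Then every moment of \<open>U\<close> vanishes, and \<open>U\<close> is 0 almost
  everywhere.\<close>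

lemma eigenfunctions_dependent:
  fixes u :: "nat \<Rightarrow> real^2 \<Rightarrow> real"
  assumes u: "\<And>i. i < k \<Longrightarrow> u i \<in> dirichlet_eigenspace (ball 0 1) \<mu>"
    and fin: "finite (angular_modes \<mu>)" and k: "card (angular_modes \<mu>) < k"
  shows "\<exists>c. (\<exists>i<k. c i \<noteq> 0) \<and> (AE x in disk. (\<Sum>i<k. c i * u i x) = 0)"
proof -
  define A where "A = (\<lambda>(m::int) i. if m \<ge> 0 then Re (moment (u i) (nat \<bar>m\<bar>) 0) else Im (moment (u i) (nat \<bar>m\<bar>) 0))"
  obtain c where c: "\<exists>i\<in>{..<k}. c i \<noteq> 0" "\<And>m. m \<in> angular_modes \<mu> \<Longrightarrow> (\<Sum>i<k. c i * A m i) = 0"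
    using homogeneous_system_nontrivial_solution[OF fin, of "{..<k}" A] k by auto
  define U where "U = (\<lambda>x. \<Sum>i<k. c i * u i x)"
  have L2: "L2_on (ball 0 1) (u i)" if "i < k" for i
    using u[OF that] by (auto simp: dirichlet_eigenspace_def dirichlet_laplacian_def H10_def)
  have int: "integrable (disk) (\<lambda>x. of_real (u i x) * mon a b x)" if "i < k" for i a b
    by (rule L2_on_integrable_mult_continuous[OF L2[OF that] continuous_on_mon])
  have mom: "moment U a b = (\<Sum>i<k. of_real (c i) * moment (u i) a b)" for a b
  proof -
    have "moment U a b = (\<integral>x. (\<Sum>i<k. of_real (c i) * (of_real (u i x) * mon a b x)) \<partial>disk)"
      unfolding moment_def U_def by (intro Bochner_Integration.integral_cong refl) (simp add: sum_distrib_right mult.assoc)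
    also have "\<dots> = (\<Sum>i<k. \<integral>x. of_real (c i) * (of_real (u i x) * mon a b x) \<partial>disk)"
      using int by (intro Bochner_Integration.integral_sum) auto
    finally show ?thesis by (simp add: moment_def)
  qed
  have U2: "L2_on (ball 0 1) U"
  proof -
    have "L2_on (ball 0 1) (\<lambda>x. \<Sum>i<n. c i * u i x)" if "n \<le> k" for n
      using that
    proof (induction n)
      case 0
      show ?case by (simp add: L2_on_def)
    next
      case (Suc n)
      have "L2_on (ball 0 1) (\<lambda>x. - c n * u n x)"
        using L2[of n] Suc.prems by (auto simp: L2_on_def power_mult_distrib)
      from Suc.IH this Suc.prems have a: "L2_on (ball 0 1) (\<lambda>x. \<Sum>i<n. c i * u i x)" "L2_on (ball 0 1) (\<lambda>x. - c n * u n x)" by auto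
      have "(\<lambda>x. \<Sum>i<Suc n. c i * u i x) \<in> borel_measurable (disk)"
        using L2 Suc.prems by (intro borel_measurable_sum borel_measurable_times) (auto simp: L2_on_def)
      with L2_on_diff_norm(2)[OF a] show ?case by (simp add: L2_on_def)
    qed
    then show ?thesis unfolding U_def by simp
  qed
  have rec: "4 * of_nat a * of_nat b * moment U (a - 1) (b - 1) + of_real \<mu> * moment U a b
    = 4 * of_nat (Suc a) * of_nat (Suc b) * moment U a b + of_real \<mu> * moment U (Suc a) (Suc b)" for a b
  proof -
    have lin: "K * (\<Sum>i<k. of_real (c i) * x i) + L * (\<Sum>i<k. of_real (c i) * y i)
      = (\<Sum>i<k. of_real (c i) * (K * x i + L * y i))" for K L :: complex and x y
      by (simp add: sum_distrib_left sum.distrib algebra_simps)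
    show ?thesis
      unfolding mom lin
      by (intro sum.cong refl arg_cong[where f = "(*) _"] eigenfunction_moment_recursion u) simp
  qed
  \<comment> \<open>The moments with exponent difference m form a bounded solution of the recursion
    of \<open>bounded_moment_sequence\<close>, with first entry \<open>moment U m 0\<close>.\<close>
  have seq: "moment U m 0 = 0 \<or> bessel_series m \<mu> = 0"
    "moment U m 0 = 0 \<Longrightarrow> moment U (j + m) j = 0" for m j
  proof -
    have "4 * of_nat j * of_nat (j + m) * moment U (j - 1 + m) (j - 1) + of_real \<mu> * moment U (j + m) j
      = 4 * of_nat (Suc j) * of_nat (Suc j + m) * moment U (j + m) j + of_real \<mu> * moment U (Suc j + m) (Suc j)" for j
    proof -
      have e: "4 * of_nat (j + m) * of_nat j = 4 * of_nat j * (of_nat (j + m) :: complex)"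
        "4 * of_nat (Suc (j + m)) * of_nat (Suc j) = 4 * of_nat (Suc j) * (of_nat (Suc j + m) :: complex)"
        by (simp_all only: add_Suc mult_ac)
      have "4 * of_nat j * of_nat (j + m) * moment U (j - 1 + m) (j - 1)
        = 4 * of_nat j * of_nat (j + m) * moment U (j + m - 1) (j - 1)" by (cases j) auto
      then show ?thesis using rec[of "j + m" j] unfolding e by (simp only: add_Suc)
    qed
    note b = bounded_moment_sequence[where c = "\<lambda>j. moment U (j + m) j", OF this norm_moment_le[OF U2]]
    from b(1) show "moment U m 0 = 0 \<or> bessel_series m \<mu> = 0" by simp
    from b(2)[of j] show "moment U m 0 = 0 \<Longrightarrow> moment U (j + m) j = 0" by simp
  qed
  have "moment U m 0 = 0" for m
  proof (cases "bessel_series m \<mu> = 0")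
    case True
    then have modes: "int m \<in> angular_modes \<mu>" "- int m \<in> angular_modes \<mu>"
      by (simp_all add: angular_modes_def)
    have "Re (moment U m 0) = (\<Sum>i<k. c i * A (int m) i)" by (simp add: mom A_def)
    then have "Re (moment U m 0) = 0" using c(2)[OF modes(1)] by simp
    moreover have "Im (moment U m 0) = 0"
    proof (cases "m = 0")
      case True
      have "cnj (moment U 0 0) = moment U 0 0" by (rule cnj_moment[OF U2])
      then show ?thesis using True by (simp add: complex_eq_iff)
    next
      case False
      then have "Im (moment U m 0) = (\<Sum>i<k. c i * A (- int m) i)" by (simp add: mom A_def)
      then show ?thesis using c(2)[OF modes(2)] by simp
    qed
    ultimately show ?thesis by (simp add: complex_eq_iff)
  qed (use seq(1)[of m] in simp)
  then have diag: "moment U (j + m) j = 0" for j m by (rule seq(2))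
  have "moment U a b = 0" for a b
  proof (cases "b \<le> a")
    case True
    then show ?thesis using diag[of b "a - b"] by simp
  next
    case False
    then have "moment U b a = 0" using diag[of a "b - a"] by simp
    then show ?thesis using cnj_moment[OF U2, of b a] by simp
  qed
  then have "AE x in disk. U x = 0" by (rule zero_moments_AE[OF U2])
  then show ?thesis using c(1) unfolding U_def by auto
qed

lemma dirichlet_mult_le:
  assumes "finite (angular_modes \<mu>)"
  shows "dirichlet_mult (ball (0::real^2) 1) \<mu> \<le> enat (card (angular_modes \<mu>))"
  unfolding dirichlet_mult_def
proof (rule Sup_least, clarify)
  fix k and u :: "nat \<Rightarrow> real^2 \<Rightarrow> real"
  assume u: "\<forall>i<k. u i \<in> dirichlet_eigenspace (ball 0 1) \<mu>"
    and indep: "\<forall>c :: nat \<Rightarrow> real. (AE x in disk. (\<Sum>i<k. c i * u i x) = 0) \<longrightarrow> (\<forall>i<k. c i = 0)"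
  show "enat k \<le> enat (card (angular_modes \<mu>))"
  proof (rule ccontr)
    assume "\<not> ?thesis"
    then have "card (angular_modes \<mu>) < k" by simp
    from eigenfunctions_dependent[OF _ assms this, of u] u obtain c
      where "\<exists>i<k. c i \<noteq> 0" "AE x in disk. (\<Sum>i<k. c i * u i x) = 0" by blast
    then show False using indep by blast
  qed
qed

text \<open>For \<mu> <= 0 all terms of the series are nonnegative and the first is 1. Together with
  \<open>dirichlet_mult_le\<close> this excludes eigenvalues that are not positive.\<close>

lemma angular_modes_nonpos:
  assumes "\<mu> \<le> 0"
  shows "angular_modes \<mu> = {}"
proof -
  have pos: "bessel_series m \<mu> > 0" for m
  proof -
    have "of_real (bessel_coeff m i) * \<mu> ^ i = (- \<mu> / 4) ^ i * (fact m / (fact i * fact (i + m)))" for i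
      by (simp add: bessel_coeff_def power_mult_distrib[symmetric])
    then have "0 \<le> of_real (bessel_coeff m i) * \<mu> ^ i" for i using assms by simp
    then have "(\<Sum>i\<in>{0}. of_real (bessel_coeff m i) * \<mu> ^ i) \<le> bessel_series m \<mu>"
      unfolding bessel_series_def by (intro sum_le_suminf summable_bessel_series) auto
    then show ?thesis by (simp add: bessel_coeff_def)
  qed
  have "bessel_series m \<mu> \<noteq> 0" for m using pos[of m] by simp
  then show ?thesis by (simp add: angular_modes_def)
qed

section \<open>Comparison of eigenvalues, Bessel zeros and lattice points\<close>

definition bessel_zeros :: "real \<Rightarrow> nat \<Rightarrow> real set" where
  "bessel_zeros l m = {x. 0 < x \<and> x \<le> l \<and> bessel_series m (x\<^sup>2) = 0}"

text \<open>The phase bound at \<open>l\<close> limits the cardinality of every finite set of zeros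
  in (0, l].\<close>

lemma finite_bessel_zeros: "finite (bessel_zeros l m)"
proof (rule ccontr)
  assume inf: "infinite (bessel_zeros l m)"
  obtain n :: nat where n: "bessel_phase m l / pi + 1 / 4 < n" using reals_Archimedean2 by blast
  obtain B where B: "B \<subseteq> bessel_zeros l m" "finite B" "card B = Suc n"
    using infinite_arbitrarily_large[OF inf, of "Suc n"] by blast
  have "B \<noteq> {}" using B(3) by auto
  then have "(real (Suc n) - 1 / 4) * pi \<le> bessel_phase m l"
    using bessel_zeros_phase[of B l m] B unfolding bessel_zeros_def by auto
  then have "real (Suc n) - 1 / 4 \<le> bessel_phase m l / pi" by (simp only: pos_le_divide_eq[OF pi_gt_zero])
  with n show False by simp
qed

text \<open>The phase bound holds at \<open>l\<close> for every set of k zeros in (0, l], so column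
  m of \<open>lattice\<close> contains each k from 1 up to the number of zeros. Columns with |m| >=
  l contain no zeros, which keeps the sum finite.\<close>

lemma (in disk_lattice) card_all_bessel_zeros:
  "finite (SIGMA m:UNIV. bessel_zeros l (nat \<bar>m\<bar>))"
  "card (SIGMA m:UNIV. bessel_zeros l (nat \<bar>m\<bar>)) \<le> card lattice"
proof -
  define I where "I = {- \<lceil>l\<rceil>..\<lceil>l\<rceil>}"
  have zeros: "real (nat \<bar>m\<bar>) < l \<and> (real (card B) - 1 / 4) * pi \<le> bessel_phase (nat \<bar>m\<bar>) l"
    if "B \<subseteq> bessel_zeros l (nat \<bar>m\<bar>)" "B \<noteq> {}" for B m
    by (rule bessel_zeros_phase)
       (use that finite_subset[OF that(1) finite_bessel_zeros] in \<open>auto simp: bessel_zeros_def\<close>)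
  have eq: "(SIGMA m:UNIV. bessel_zeros l (nat \<bar>m\<bar>)) = (SIGMA m:I. bessel_zeros l (nat \<bar>m\<bar>))"
  proof -
    have "m \<in> I" if "x \<in> bessel_zeros l (nat \<bar>m\<bar>)" for m x
      using zeros[of "{x}" m] that unfolding I_def by auto linarith+
    then show ?thesis by blast
  qed
  show "finite (SIGMA m:UNIV. bessel_zeros l (nat \<bar>m\<bar>))"
    unfolding eq by (intro finite_SigmaI finite_bessel_zeros) (simp add: I_def)
  have "card (SIGMA m:UNIV. bessel_zeros l (nat \<bar>m\<bar>)) = (\<Sum>m\<in>I. card (bessel_zeros l (nat \<bar>m\<bar>)))"
    unfolding eq by (rule card_SigmaI) (simp_all add: I_def finite_bessel_zeros)
  also have "\<dots> = card (SIGMA m:I. {1..card (bessel_zeros l (nat \<bar>m\<bar>))})"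
    by (subst card_SigmaI) (simp_all add: I_def)
  also have "\<dots> \<le> card lattice"
  proof (rule card_mono[OF finite_lattice], clarify)
    fix m k assume k: "k \<in> {1..card (bessel_zeros l (nat \<bar>m\<bar>))}"
    then obtain B where B: "B \<subseteq> bessel_zeros l (nat \<bar>m\<bar>)" "card B = k"
      using obtain_subset_with_card_n[of k "bessel_zeros l (nat \<bar>m\<bar>)"] by auto
    then have "B \<noteq> {}" using k by auto
    from zeros[OF B(1) this] show "(m, k) \<in> lattice" using k B(2) by (simp add: lattice_def)
  qed
  finally show "card (SIGMA m:UNIV. bessel_zeros l (nat \<bar>m\<bar>)) \<le> card lattice" .
qed

theorem theorem1p5:
  fixes l :: real
  assumes "l > 0"
  shows "ereal_of_enat (dirichlet_count (ball (0::real^2) 1) l)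
           < ereal (l\<^sup>2 / 4 - of_int \<lfloor>omega0 * l\<rfloor> / 2)"
proof -
  interpret disk_lattice l by unfold_locales (rule assms)
  define Z where "Z = (SIGMA m:(UNIV::int set). bessel_zeros l (nat \<bar>m\<bar>))"
  define C where "C = {(\<mu>, i). \<mu> \<le> l\<^sup>2 \<and> enat i < dirichlet_mult (ball (0::real^2) 1) \<mu>}"
  have modes: "(\<lambda>m. (m, sqrt \<mu>)) ` angular_modes \<mu> \<subseteq> Z" if "\<mu> \<le> l\<^sup>2" "0 < \<mu>" for \<mu>
    using that assms real_sqrt_le_mono[OF that(1)]
    by (auto simp: Z_def angular_modes_def bessel_zeros_def)
  have fin: "finite (angular_modes \<mu>)" if "\<mu> \<le> l\<^sup>2" for \<mu>
  proof (cases "\<mu> \<le> 0")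
    case False
    have "finite ((\<lambda>m. (m, sqrt \<mu>)) ` angular_modes \<mu>)"
      using modes[OF that] False card_all_bessel_zeros(1) unfolding Z_def by (auto intro: finite_subset)
    then show ?thesis by (rule finite_imageD) (auto simp: inj_on_def)
  qed (simp add: angular_modes_nonpos)
  have "\<exists>e. bij_betw e {0..<card (angular_modes \<mu>)} (angular_modes \<mu>)" if "\<mu> \<le> l\<^sup>2" for \<mu>
    by (rule ex_bij_betw_nat_finite[OF fin[OF that]])
  then obtain e where e: "\<And>\<mu>. \<mu> \<le> l\<^sup>2 \<Longrightarrow> bij_betw (e \<mu>) {0..<card (angular_modes \<mu>)} (angular_modes \<mu>)"
    by metis
  have C: "\<mu> \<le> l\<^sup>2 \<and> 0 < \<mu> \<and> i < card (angular_modes \<mu>)" if "(\<mu>, i) \<in> C" for \<mu> i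
  proof -
    have \<mu>: "\<mu> \<le> l\<^sup>2" "enat i < dirichlet_mult (ball (0::real^2) 1) \<mu>" using that by (auto simp: C_def)
    have "i < card (angular_modes \<mu>)"
      using less_le_trans[OF \<mu>(2) dirichlet_mult_le[OF fin[OF \<mu>(1)]]] by simp
    moreover from this have "0 < \<mu>" using angular_modes_nonpos[of \<mu>] by (cases "0 < \<mu>") auto
    ultimately show ?thesis using \<mu>(1) by simp
  qed
  \<comment> \<open>The i-th copy of the eigenvalue \<mu> goes to the i-th mode of \<mu>, paired
    with the zero sqrt \<mu>. The second component recovers \<mu>, hence the injectivity; finiteness
    of the target also shows that the count is not infinite.\<close>
  let ?f = "\<lambda>(\<mu>, i). (e \<mu> i, sqrt \<mu>)"
  have "inj_on ?f C"
  proof (rule inj_onI, clarify)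
    fix \<mu> i \<nu> j assume *: "(\<mu>, i) \<in> C" "(\<nu>, j) \<in> C" "e \<mu> i = e \<nu> j" "sqrt \<mu> = sqrt \<nu>"
    then have "\<mu> = \<nu>" by simp
    with * C[OF *(1)] C[OF *(2)] bij_betw_imp_inj_on[OF e[of \<mu>]] show "\<mu> = \<nu> \<and> i = j"
      by (auto dest: inj_onD)
  qed
  moreover have "?f ` C \<subseteq> Z"
  proof clarify
    fix \<mu> i assume "(\<mu>, i) \<in> C"
    from C[OF this] have \<mu>: "\<mu> \<le> l\<^sup>2" "0 < \<mu>" "i \<in> {0..<card (angular_modes \<mu>)}" by auto
    then have "e \<mu> i \<in> angular_modes \<mu>" using bij_betwE[OF e] by blast
    then show "(e \<mu> i, sqrt \<mu>) \<in> Z" using modes[OF \<mu>(1,2)] by blast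
  qed
  moreover have "finite Z" unfolding Z_def by (rule card_all_bessel_zeros(1))
  ultimately have "finite C" "card C \<le> card Z"
    by (auto intro: inj_on_finite card_inj_on_le)
  then have "real (card C) \<le> real (card lattice)"
    using card_all_bessel_zeros(2) by (simp add: Z_def)
  also note card_lattice
  finally have "real (card C) < l\<^sup>2 / 4 - of_int \<lfloor>omega0 * l\<rfloor> / 2" .
  then show ?thesis
    using \<open>finite C\<close> unfolding dirichlet_count_def C_def[symmetric] enat_card_def by simp
qed

end
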